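(* Let $1<p<\infty$, $a<b$ real, $\gamma\in\mathcal M^+_{\rm loc}(\mathbb R^d)$ and $\phi\in\mathcal A_p(a,b)$. Then: (i) $\mathcal W_{\phi,\gamma}$ is a pseudo-distance on $\mathcal M_{\rm loc}(\mathbb R^d)$, i.e. it satisfies the axioms of a distance but can assume the value $+\infty$. (ii) The topology induced by $\mathcal W_{\phi,\gamma}$ on $\mathcal M_{\rm loc}(\mathbb R^d)$ is stronger than or equivalent to the weak* topology. (iii) Bounded sets with respect to $\mathcal W_{\phi,\gamma}$ are weakly* relatively compact.
   Context: Notation. $\mathcal M_{\rm loc}(\mathbb R^d)$, $\mathcal M^+_{\rm loc}(\mathbb R^d)$, $\mathcal M_{\rm loc}(\mathbb R^d;\mathbb R^d)$ are the signed, non-negative, and $\mathbb R^d$-valued Radon measures on $\mathbb R^d$, with the weak* topology (duality with $C_c$). Admissible densities: for $1<p<\infty$, $\mathcal A_p$ is the set of l.s.c. proper convex functions $\phi:\mathbb R\times\mathbb R^d\to[0,+\infty]$ such that (F1) for every $\rho$ with $(\{\rho\}\times\mathbb R^d)\cap\mathrm{dom}(\phi)\neq\emptyset$ one has $\phi(\rho,0)=0$ and $\phi(\rho,\lambda w)=|\lambda|^p\phi(\rho,w)$ for all $\lambda\ne0$, $w\in\mathbb R^d$; (F2) there is $\rho_0\in\mathbb R$ with $\{\rho_0\}\times\mathbb R^d\subseteq\mathrm{dom}(\phi)$ and $\phi(\rho_0,w)>0$ for all $w\neq0$. Here $\mathrm{dom}(\phi)=\{\phi<+\infty\}$. For real $a<b$,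 $\mathcal A_p(a,b)$ is the set of $\phi\in\mathcal A_p$ with $\mathrm{int}(\mathrm{dom}(\phi))=(a,b)\times\mathbb R^d$. Action functional: the recession function of $\phi$ is $\phi^\infty(y):=\sup\{\phi(x+y)-\phi(x):x\in\mathrm{dom}(\phi)\}$, $y\in\mathbb R\times\mathbb R^d$. Given $\gamma\in\mathcal M^+_{\rm loc}(\mathbb R^d)$, $\mu\in\mathcal M_{\rm loc}(\mathbb R^d)$, $\nu\in\mathcal M_{\rm loc}(\mathbb R^d;\mathbb R^d)$ with supports contained in $\mathrm{supp}(\gamma)$, write the Lebesgue decompositions $\mu=\rho\gamma+\mu^\perp$, $\nu=w\gamma+\nu^\perp$, take $\sigma=|\mu^\perp|+|\nu^\perp|$, write $\mu^\perp=\rho^\perp\sigma$, $\nu^\perp=w^\perp\sigma$, and set $\Phi(\mu,\nu|\gamma):=\int\phi(\rho,w)\,d\gamma+\int\phi^\infty(\rho^\perp,w^\perp)\,d\sigma$. Continuity equation: $\mathcal{CE}(0,T)$ is the set of families $(\mu_t,\nu_t)_{t\in[0,T]}$ with $t\mapsto\mu_t\in\mathcal M_{\rm loc}(\mathbb R^d)$ weakly* continuous on $[0,T]$, $(\nu_t)$ a Borel family in $\mathcal M_{\rm loc}(\mathbb R^d;\mathbb R^d)$, $\int_0^T|\mu_t|(B(0,R))\,dt<\infty$ and $\int_0^T|\nu_t|(B(0,R))\,dt<\infty$ for all $R>0$, and $\partial_t\mu_t+\mathrm{div}\,\nu_t=0$ in the sense of distributions on $\mathbb R^d\times(0,T)$,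 i.e. $\int_0^T\int\partial_t\zeta\,d\mu_t\,dt+\int_0^T\int\nabla_x\zeta\cdot d\nu_t\,dt=0$ for all $\zeta\in C^1_c(\mathbb R^d\times(0,T))$. $\mathcal{CE}_{\phi,\gamma}(0,1;\mu^0\to\mu^1)$ is the set of $(\mu,\nu)\in\mathcal{CE}(0,1)$ with $\mu_{t=0}=\mu^0$, $\mu_{t=1}=\mu^1$ and $\int_0^1\Phi(\mu_t,\nu_t|\gamma)\,dt<+\infty$. Distance: $\mathcal W_{\phi,\gamma}(\mu^0,\mu^1):=\inf\big\{\big(\int_0^1\Phi(\mu_t,\nu_t|\gamma)\,dt\big)^{1/p}:(\mu,\nu)\in\mathcal{CE}_{\phi,\gamma}(0,1;\mu^0\to\mu^1)\big\}$, equal to $+\infty$ if this set is empty.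
   Formalization: In (i), the axiom W(μ,μ)=0 is required except at measures μ for which no ν has Φ(μ,ν|γ)<∞; there the admissible set is empty, so W(μ,·)=+∞, including W(μ,μ)=+∞, and the axiom as literally stated fails. *)

theory Defs
  imports "HOL-Analysis.Analysis"
begin

section \<open>Radon measures\<close>

text \<open>
  The space of (signed or vector-valued) Radon measures: set functions on the bounded Borel sets
  that are countably additive on every bounded region.  The total variation may be infinite on
  unbounded sets, so no value is attached to them; outside the bounded Borel sets the function is
  normalised to \<open>0\<close> so that equality of the type is equality of measures.
\<close>

definition bounded_borel :: "'a::euclidean_space set \<Rightarrow> bool" where
  "bounded_borel B \<longleftrightarrow> B \<in> sets borel \<and> bounded B"

typedef (overloaded) ('a::euclidean_space, 'b::euclidean_space) radon =
  "{m :: 'a set \<Rightarrow> 'b.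
      (\<forall>B. \<not> bounded_borel B \<longrightarrow> m B = 0) \<and>
      (\<forall>A :: nat \<Rightarrow> 'a set. range A \<subseteq> sets borel \<longrightarrow> disjoint_family A \<longrightarrow> bounded (\<Union>i. A i) \<longrightarrow>
         (\<lambda>i. m (A i)) sums m (\<Union>i. A i))}"
  morphisms rmeas Abs_radon
  by (rule exI[of _ "\<lambda>_. 0"]) auto

type_synonym 'a signed_radon = "('a, real) radon"
type_synonym 'a vector_radon = "('a, 'a) radon"

definition nonneg_radon :: "'a::euclidean_space measure \<Rightarrow> bool" where
  "nonneg_radon \<gamma> \<longleftrightarrow> sets \<gamma> = sets borel \<and> (\<forall>K. compact K \<longrightarrow> emeasure \<gamma> K < \<infinity>)"

definition total_variation :: "('a::euclidean_space, 'b::euclidean_space) radon \<Rightarrow> 'a measure" where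
  "total_variation m = measure_of UNIV (sets borel)
     (\<lambda>B. SUP P \<in> {P. finite P \<and> disjoint P \<and> (\<forall>A\<in>P. bounded_borel A \<and> A \<subseteq> B)}.
            \<Sum>A\<in>P. ennreal (norm (rmeas m A)))"

definition is_density :: "'a measure \<Rightarrow> ('a \<Rightarrow> 'b) \<Rightarrow> ('a::euclidean_space, 'b::euclidean_space) radon \<Rightarrow> bool" where
  "is_density \<gamma> g m \<longleftrightarrow> g \<in> borel_measurable borel \<and>
     (\<forall>B. bounded_borel B \<longrightarrow>
        set_integrable \<gamma> B g \<and> rmeas m B = set_lebesgue_integral \<gamma> B g)"

definition density_wrt :: "'a measure \<Rightarrow> ('a::euclidean_space, 'b::euclidean_space) radon \<Rightarrow> 'a \<Rightarrow> 'b" where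
  "density_wrt \<gamma> m = (SOME g. is_density \<gamma> g m)"

text \<open>
  The integral of \<open>V \<bullet> dm\<close>, computed from the polar decomposition of \<open>m\<close> with respect to its
  total variation.  For signed measures \<open>\<bullet>\<close> is multiplication and this is the integral of the
  scalar function \<open>V\<close> against \<open>m\<close>.
\<close>

definition radon_integral :: "('a::euclidean_space, 'b::euclidean_space) radon \<Rightarrow> ('a \<Rightarrow> 'b) \<Rightarrow> real" where
  "radon_integral m V =
     (\<integral>x. V x \<bullet> density_wrt (total_variation m) m x \<partial>total_variation m)"

definition compactly_supported_continuous :: "('a::euclidean_space \<Rightarrow> real) \<Rightarrow> bool" where
  "compactly_supported_continuous f \<longleftrightarrow>
     continuous_on UNIV f \<and> (\<exists>K. compact K \<and> (\<forall>x. x \<notin> K \<longrightarrow> f x = 0))"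

definition weak_star :: "'a::euclidean_space signed_radon topology" where
  "weak_star = topology_generated_by
     {{\<mu>. radon_integral \<mu> f \<in> U} | f U. compactly_supported_continuous f \<and> open U}"

definition msupport :: "'a::euclidean_space measure \<Rightarrow> 'a set" where
  "msupport \<gamma> = {x. \<forall>U. open U \<and> x \<in> U \<longrightarrow> emeasure \<gamma> U > 0}"

definition mutually_singular :: "'a::euclidean_space measure \<Rightarrow> 'a measure \<Rightarrow> bool" where
  "mutually_singular \<gamma> \<sigma> \<longleftrightarrow>
     (\<exists>N \<in> sets borel. emeasure \<gamma> N = 0 \<and> emeasure \<sigma> (- N) = 0)"

definition is_lebesgue_decomposition ::
    "'a measure \<Rightarrow> ('a::euclidean_space, 'b::euclidean_space) radon \<Rightarrow> ('a \<Rightarrow> 'b) \<times> ('a, 'b) radon \<Rightarrow> bool" where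
  "is_lebesgue_decomposition \<gamma> m = (\<lambda>(g, s).
     g \<in> borel_measurable borel \<and>
     mutually_singular \<gamma> (total_variation s) \<and>
     (\<forall>B. bounded_borel B \<longrightarrow>
        set_integrable \<gamma> B g \<and> rmeas m B = set_lebesgue_integral \<gamma> B g + rmeas s B))"

definition ac_density :: "'a measure \<Rightarrow> ('a::euclidean_space, 'b::euclidean_space) radon \<Rightarrow> 'a \<Rightarrow> 'b" where
  "ac_density \<gamma> m = fst (SOME d. is_lebesgue_decomposition \<gamma> m d)"

definition singular_part :: "'a measure \<Rightarrow> ('a::euclidean_space, 'b::euclidean_space) radon \<Rightarrow> ('a, 'b) radon" where
  "singular_part \<gamma> m = snd (SOME d. is_lebesgue_decomposition \<gamma> m d)"

definition measure_sum :: "'a measure \<Rightarrow> 'a measure \<Rightarrow> 'a::euclidean_space measure" where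
  "measure_sum M N = measure_of UNIV (sets borel) (\<lambda>B. emeasure M B + emeasure N B)"


section \<open>Admissible densities\<close>

definition edom :: "('c \<Rightarrow> ereal) \<Rightarrow> 'c set" where
  "edom \<phi> = {x. \<phi> x < \<infinity>}"

definition lsc :: "('c::topological_space \<Rightarrow> ereal) \<Rightarrow> bool" where
  "lsc \<phi> \<longleftrightarrow> (\<forall>x. \<phi> x \<le> Liminf (at x) \<phi>)"

definition econvex :: "('c::real_vector \<Rightarrow> ereal) \<Rightarrow> bool" where
  "econvex \<phi> \<longleftrightarrow> (\<forall>x y t. 0 < t \<and> t < 1 \<longrightarrow>
     \<phi> ((1 - t) *\<^sub>R x + t *\<^sub>R y) \<le> ereal (1 - t) * \<phi> x + ereal t * \<phi> y)"

definition admissible :: "real \<Rightarrow> (real \<times> 'a::euclidean_space \<Rightarrow> ereal) \<Rightarrow> bool" where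
  "admissible p \<phi> \<longleftrightarrow>
     (\<forall>x. 0 \<le> \<phi> x) \<and> edom \<phi> \<noteq> {} \<and> lsc \<phi> \<and> econvex \<phi> \<and>
     (\<forall>\<rho>. ({\<rho>} \<times> UNIV) \<inter> edom \<phi> \<noteq> {} \<longrightarrow>
        \<phi> (\<rho>, 0) = 0 \<and>
        (\<forall>c w. c \<noteq> 0 \<longrightarrow> \<phi> (\<rho>, c *\<^sub>R w) = ereal (\<bar>c\<bar> powr p) * \<phi> (\<rho>, w))) \<and>
     (\<exists>\<rho>0. {\<rho>0} \<times> UNIV \<subseteq> edom \<phi> \<and> (\<forall>w. w \<noteq> 0 \<longrightarrow> \<phi> (\<rho>0, w) > 0))"

definition admissible_on :: "real \<Rightarrow> real \<Rightarrow> real \<Rightarrow> (real \<times> 'a::euclidean_space \<Rightarrow> ereal) \<Rightarrow> bool" where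
  "admissible_on p a b \<phi> \<longleftrightarrow> admissible p \<phi> \<and> interior (edom \<phi>) = {a<..<b} \<times> UNIV"

definition recession :: "('c::real_vector \<Rightarrow> ereal) \<Rightarrow> 'c \<Rightarrow> ereal" where
  "recession \<phi> y = (SUP x \<in> edom \<phi>. \<phi> (x + y) - \<phi> x)"


section \<open>Action functional\<close>

text \<open>
  Pairs whose supports are not contained in that of \<open>\<gamma>\<close> get action \<open>\<infinity>\<close>.
  Both \<open>\<phi>\<close> and its recession function are nonnegative, so \<^const>\<open>e2ennreal\<close> loses nothing.
\<close>

definition action ::
    "(real \<times> 'a::euclidean_space \<Rightarrow> ereal) \<Rightarrow> 'a measure \<Rightarrow> 'a signed_radon \<Rightarrow> 'a vector_radon \<Rightarrow> ennreal" where
  "action \<phi> \<gamma> \<mu> \<nu> =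
     (if msupport (total_variation \<mu>) \<subseteq> msupport \<gamma> \<and> msupport (total_variation \<nu>) \<subseteq> msupport \<gamma> then
        let \<rho> = ac_density \<gamma> \<mu>; w = ac_density \<gamma> \<nu>;
            \<mu>s = singular_part \<gamma> \<mu>; \<nu>s = singular_part \<gamma> \<nu>;
            \<sigma> = measure_sum (total_variation \<mu>s) (total_variation \<nu>s);
            \<rho>s = density_wrt \<sigma> \<mu>s; ws = density_wrt \<sigma> \<nu>s
        in (\<integral>\<^sup>+x. e2ennreal (\<phi> (\<rho> x, w x)) \<partial>\<gamma>) + (\<integral>\<^sup>+x. e2ennreal (recession \<phi> (\<rho>s x, ws x)) \<partial>\<sigma>)
      else \<infinity>)"


section \<open>Continuity equation and distance\<close>

text \<open>
  Test functions on \<open>\<real>\<^sup>d \<times> (0,T)\<close> are extended by zero to all \<open>(x, t)\<close>; \<open>g\<close> is the space-time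
  gradient, so \<open>fst (g (x, t))\<close> and \<open>snd (g (x, t))\<close> are the space gradient and the time
  derivative.
\<close>

definition C1c_test :: "real \<Rightarrow> ('a::euclidean_space \<times> real \<Rightarrow> real) \<Rightarrow> ('a \<times> real \<Rightarrow> 'a \<times> real) \<Rightarrow> bool" where
  "C1c_test T \<zeta> g \<longleftrightarrow>
     (\<forall>z. GDERIV \<zeta> z :> g z) \<and> continuous_on UNIV g \<and>
     (\<exists>K. compact K \<and> K \<subseteq> UNIV \<times> {0<..<T} \<and> (\<forall>z. z \<notin> K \<longrightarrow> \<zeta> z = 0))"

definition continuity_equation ::
    "real \<Rightarrow> (real \<Rightarrow> 'a::euclidean_space signed_radon) \<Rightarrow> (real \<Rightarrow> 'a vector_radon) \<Rightarrow> bool" where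
  "continuity_equation T \<mu> \<nu> \<longleftrightarrow>
     continuous_map (top_of_set {0..T}) weak_star \<mu> \<and>
     (\<forall>B. bounded_borel B \<longrightarrow>
        (\<lambda>t. rmeas (\<nu> t) B) \<in> borel_measurable (restrict_space borel {0..T})) \<and>
     (\<forall>R>0. (\<integral>\<^sup>+t\<in>{0..T}. emeasure (total_variation (\<mu> t)) (ball 0 R) \<partial>lborel) < \<infinity>) \<and>
     (\<forall>R>0. (\<integral>\<^sup>+t\<in>{0..T}. emeasure (total_variation (\<nu> t)) (ball 0 R) \<partial>lborel) < \<infinity>) \<and>
     (\<forall>\<zeta> g. C1c_test T \<zeta> g \<longrightarrow>
        (LBINT t:{0..T}. radon_integral (\<mu> t) (\<lambda>x. snd (g (x, t)))) +
        (LBINT t:{0..T}. radon_integral (\<nu> t) (\<lambda>x. fst (g (x, t)))) = 0)"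

definition total_action ::
    "(real \<times> 'a::euclidean_space \<Rightarrow> ereal) \<Rightarrow> 'a measure \<Rightarrow> (real \<Rightarrow> 'a signed_radon) \<Rightarrow> (real \<Rightarrow> 'a vector_radon) \<Rightarrow> ennreal" where
  "total_action \<phi> \<gamma> \<mu> \<nu> = (\<integral>\<^sup>+t\<in>{0..1}. action \<phi> \<gamma> (\<mu> t) (\<nu> t) \<partial>lborel)"

definition finite_action_curves ::
    "(real \<times> 'a::euclidean_space \<Rightarrow> ereal) \<Rightarrow> 'a measure \<Rightarrow> 'a signed_radon \<Rightarrow> 'a signed_radon \<Rightarrow>
     ((real \<Rightarrow> 'a signed_radon) \<times> (real \<Rightarrow> 'a vector_radon)) set" where
  "finite_action_curves \<phi> \<gamma> \<mu>0 \<mu>1 =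
     {(\<mu>, \<nu>). continuity_equation 1 \<mu> \<nu> \<and> \<mu> 0 = \<mu>0 \<and> \<mu> 1 = \<mu>1 \<and> total_action \<phi> \<gamma> \<mu> \<nu> < \<infinity>}"

text \<open>The infimum over the empty set is \<open>\<infinity>\<close> in \<^typ>\<open>ennreal\<close>.\<close>

definition W_dist ::
    "real \<Rightarrow> (real \<times> 'a::euclidean_space \<Rightarrow> ereal) \<Rightarrow> 'a measure \<Rightarrow> 'a signed_radon \<Rightarrow> 'a signed_radon \<Rightarrow> ennreal" where
  "W_dist p \<phi> \<gamma> \<mu>0 \<mu>1 =
     (INF (\<mu>, \<nu>) \<in> finite_action_curves \<phi> \<gamma> \<mu>0 \<mu>1.
        ennreal (enn2real (total_action \<phi> \<gamma> \<mu> \<nu>) powr (1 / p)))"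


section \<open>Topology and bounded sets of a pseudo-distance\<close>

definition dist_topology :: "('c \<Rightarrow> 'c \<Rightarrow> ennreal) \<Rightarrow> 'c topology" where
  "dist_topology d = topology (\<lambda>U. \<forall>x\<in>U. \<exists>r>0. \<forall>y. d x y < r \<longrightarrow> y \<in> U)"

lemma openin_dist_topology:
  "openin (dist_topology d) U \<longleftrightarrow> (\<forall>x\<in>U. \<exists>r>0. \<forall>y. d x y < r \<longrightarrow> y \<in> U)"
proof -
  have "istopology (\<lambda>U. \<forall>x\<in>U. \<exists>r>0. \<forall>y. d x y < r \<longrightarrow> y \<in> U)"
    unfolding istopology_def
  proof (intro conjI allI impI ballI)
    fix S T x
    assume S: "\<forall>x\<in>S. \<exists>r>0. \<forall>y. d x y < r \<longrightarrow> y \<in> S"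
      and T: "\<forall>x\<in>T. \<exists>r>0. \<forall>y. d x y < r \<longrightarrow> y \<in> T" and x: "x \<in> S \<inter> T"
    obtain r where r: "r > 0" "\<forall>y. d x y < r \<longrightarrow> y \<in> S" using S x by blast
    obtain s where s: "s > 0" "\<forall>y. d x y < s \<longrightarrow> y \<in> T" using T x by blast
    show "\<exists>r>0. \<forall>y. d x y < r \<longrightarrow> y \<in> S \<inter> T"
      using r s by (intro exI[of _ "min r s"]) auto
  next
    fix \<K> x
    assume "\<forall>K\<in>\<K>. \<forall>x\<in>K. \<exists>r>0. \<forall>y. d x y < r \<longrightarrow> y \<in> K" and "x \<in> \<Union>\<K>"
    then show "\<exists>r>0. \<forall>y. d x y < r \<longrightarrow> y \<in> \<Union>\<K>"
      by (meson UnionE UnionI)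
  qed
  then show ?thesis
    by (simp add: dist_topology_def)
qed

definition dist_bounded :: "('c \<Rightarrow> 'c \<Rightarrow> ennreal) \<Rightarrow> 'c set \<Rightarrow> bool" where
  "dist_bounded d S \<longleftrightarrow> (\<exists>x C. C < \<infinity> \<and> (\<forall>y\<in>S. d x y \<le> C))"

definition relatively_compactin :: "'c topology \<Rightarrow> 'c set \<Rightarrow> bool" where
  "relatively_compactin X S \<longleftrightarrow> S \<subseteq> topspace X \<and> compactin X (X closure_of S)"

text \<open>
  Axioms of a distance that can assume the value \<open>\<infinity>\<close>, also on the diagonal: a point need not
  have distance \<open>0\<close> to itself only if it lies outside \<open>D\<close> and has distance \<open>\<infinity>\<close> to every point.
  The exception is unavoidable: for the transport distance \<open>W\<close>, if no flux gives
  \<open>\<mu>\<close> finite action, then no admissible curve starts at \<open>\<mu>\<close>, and \<open>W \<mu> \<mu>\<close> is an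
  infimum over the empty set.
\<close>

definition pseudo_distance :: "'c set \<Rightarrow> ('c \<Rightarrow> 'c \<Rightarrow> ennreal) \<Rightarrow> bool" where
  "pseudo_distance D d \<longleftrightarrow>
     (\<forall>x. d x x = 0 \<or> (x \<notin> D \<and> (\<forall>y. d x y = \<infinity>))) \<and>
     (\<forall>x y. d x y = 0 \<longrightarrow> x = y) \<and>
     (\<forall>x y. d x y = d y x) \<and>
     (\<forall>x y z. d x z \<le> d x y + d y z)"

definition action_domain ::
    "(real \<times> 'a::euclidean_space \<Rightarrow> ereal) \<Rightarrow> 'a measure \<Rightarrow> 'a signed_radon set" where
  "action_domain \<phi> \<gamma> = {\<mu>. \<exists>\<nu>. action \<phi> \<gamma> \<mu> \<nu> < \<infinity>}"

end

theory Submission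
  imports Defs
begin

text \<open>
  The recession function of \<open>\<phi>\<close> is infinite off the origin, so finite action forces
  \<open>\<mu> = \<rho> \<gamma>\<close> and \<open>\<nu> = w \<gamma>\<close> with \<open>\<rho> \<in> [a, b]\<close>, and coercivity \<open>\<phi> (\<rho>, w) \<ge> c \<bar>w\<bar> powr p\<close>
  (inherited from an interior point of \<open>[a, b]\<close> by convexity) bounds the flux by the action.
  Hence every measure at finite distance from another one lies in the set of measures between
  \<open>a \<gamma>\<close> and \<open>b \<gamma>\<close>, which is weak* closed and, by Tychonoff's theorem applied to set functions,
  weak* compact; no Riesz representation is needed.  Testing the continuity equation with
  continuously differentiable functions shows that the distance controls integrals of continuous
  functions.  The triangle inequality follows by concatenating curves with the optimal split of
  the unit time interval.
\<close>

section \<open>Radon set functions and their total variation\<close>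

text \<open>The recession function is infinite for two different reasons: in the \<rho>-direction
  because the domain is a strip of bounded width, in the w-direction because p > 1 makes the growth
  superlinear. Three obstacles shape the rest. Densities, singular parts and polar decompositions
  are picked by \<open>SOME\<close>, so every computation with them goes through uniqueness almost
  everywhere, and \<open>radon_integral\<close> is brought back to values of the set function by
  finite-valued approximation. The action is not known to be measurable in time; its
  \<open>nn_integral\<close> is a lower integral, which is monotone and splits along measurable sets
  but is not subadditive, so Hoelder's inequality is replaced by a Young inequality that is linear
  in the action and has a free parameter. Finally, test functions vanish near the ends of the time
  interval, while reversal and concatenation concern the end points; both rest on a boundary formula
  for test functions that are unrestricted in time.\<close>

lemma bounded_borel_subset: "bounded_borel B \<Longrightarrow> A \<in> sets borel \<Longrightarrow> A \<subseteq> B \<Longrightarrow> bounded_borel A"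
  by (auto simp: bounded_borel_def intro: bounded_subset)

lemma bounded_borel_Int: "bounded_borel B \<Longrightarrow> A \<in> sets borel \<Longrightarrow> bounded_borel (B \<inter> A)"
  by (auto simp: bounded_borel_def intro: bounded_subset)

lemma bounded_borel_Diff: "bounded_borel B \<Longrightarrow> A \<in> sets borel \<Longrightarrow> bounded_borel (B - A)"
  by (auto simp: bounded_borel_def intro: bounded_subset)

lemma bounded_borel_empty [simp]: "bounded_borel {}"
  by (auto simp: bounded_borel_def)

lemma bounded_borel_ball [simp]: "bounded_borel (ball x r)" "bounded_borel (cball x r)"
  by (auto simp: bounded_borel_def)

lemma bounded_borel_UN: "finite I \<Longrightarrow> (\<And>i. i \<in> I \<Longrightarrow> bounded_borel (A i)) \<Longrightarrow> bounded_borel (\<Union>i\<in>I. A i)"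
  by (auto simp: bounded_borel_def)

lemma rmeas_outside: "\<not> bounded_borel B \<Longrightarrow> rmeas m B = 0"
  using rmeas[of m] by auto

lemma rmeas_sums:
  "range A \<subseteq> sets borel \<Longrightarrow> disjoint_family A \<Longrightarrow> bounded (\<Union>i. A i) \<Longrightarrow>
    (\<lambda>i::nat. rmeas m (A i)) sums rmeas m (\<Union>i. A i)"
  using rmeas[of m] by auto

text \<open>A constant series converges only if its term is zero.\<close>

lemma rmeas_empty [simp]: "rmeas m {} = 0"
proof -
  have "(\<lambda>i::nat. rmeas m {}) sums rmeas m (\<Union>i::nat. {})"
    by (intro rmeas_sums) (auto simp: disjoint_family_on_def)
  then have "(\<lambda>i::nat. rmeas m {}) \<longlonglongrightarrow> 0"
    by (intro summable_LIMSEQ_zero sums_summable)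
  then show ?thesis
    by (simp add: LIMSEQ_const_iff)
qed

lemma rmeas_Un:
  assumes "bounded_borel A" "bounded_borel B" "A \<inter> B = {}"
  shows "rmeas m (A \<union> B) = rmeas m A + rmeas m B"
proof -
  define S where "S i = (if i = 0 then A else if i = 1 then B else {})" for i :: nat
  have U: "(\<Union>i. S i) = A \<union> B"
    unfolding S_def by (auto split: if_splits)
  have "(\<lambda>i. rmeas m (S i)) sums rmeas m (\<Union>i. S i)"
  proof (rule rmeas_sums)
    show "range S \<subseteq> sets borel" "disjoint_family S" "bounded (\<Union>i. S i)"
      unfolding U using assms by (auto simp: S_def bounded_borel_def disjoint_family_on_def)
  qed
  moreover have "(\<lambda>i. rmeas m (S i)) sums (\<Sum>i\<in>{0,1}. rmeas m (S i))"
    by (rule sums_finite) (auto simp: S_def)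
  ultimately show ?thesis
    unfolding U by (auto simp: S_def dest: sums_unique2)
qed

lemma rmeas_Diff:
  assumes "bounded_borel A" "B \<in> sets borel"
  shows "rmeas m (A - B) = rmeas m A - rmeas m (A \<inter> B)"
  using rmeas_Un[of "A \<inter> B" "A - B" m] bounded_borel_Int[OF assms] bounded_borel_Diff[OF assms]
  by (simp add: Int_Diff_Un Int_Diff_disjoint algebra_simps)

lemma rmeas_UN:
  assumes "finite I" "\<And>i. i \<in> I \<Longrightarrow> bounded_borel (A i)" "disjoint_family_on A I"
  shows "rmeas m (\<Union>i\<in>I. A i) = (\<Sum>i\<in>I. rmeas m (A i))"
  using assms
proof (induction I rule: finite_induct)
  case (insert i I)
  have "A i \<inter> (\<Union>i\<in>I. A i) = {}"
    using insert.prems(2) insert.hyps(2) by (force simp: disjoint_family_on_def)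
  then have "rmeas m (A i \<union> (\<Union>i\<in>I. A i)) = rmeas m (A i) + rmeas m (\<Union>i\<in>I. A i)"
    using insert by (intro rmeas_Un bounded_borel_UN) auto
  then show ?case
    using insert by (simp add: disjoint_family_on_def)
qed simp

lemma rmeas_Union:
  assumes "finite P" "\<And>A. A \<in> P \<Longrightarrow> bounded_borel A" "disjoint P"
  shows "rmeas m (\<Union>P) = (\<Sum>A\<in>P. rmeas m A)"
  using rmeas_UN[of P "\<lambda>A. A" m] assms by (simp add: disjoint_family_on_disjoint_image disjoint_def disjoint_family_on_def)

text \<open>The normalisation to 0 off the bounded Borel sets makes agreement on them
  enough.\<close>

lemma radon_eqI: "(\<And>B. bounded_borel B \<Longrightarrow> rmeas m B = rmeas m' B) \<Longrightarrow> m = m'"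
  by (metis (no_types, lifting) ext rmeas_inject rmeas_outside)

section \<open>Total variation of a Radon set function\<close>

definition subpartitions :: "'a::euclidean_space set \<Rightarrow> 'a set set set" where
  "subpartitions B = {P. finite P \<and> disjoint P \<and> (\<forall>A\<in>P. bounded_borel A \<and> A \<subseteq> B)}"

text \<open>The set function inside \<open>total_variation\<close>, split off so that its countable
  additivity can be proved separately. The families do not have to cover the set: their members are
  bounded, and the set may not be.\<close>

definition variation :: "('a::euclidean_space, 'b::euclidean_space) radon \<Rightarrow> 'a set \<Rightarrow> ennreal" where
  "variation m B = (SUP P \<in> subpartitions B. \<Sum>A\<in>P. ennreal (norm (rmeas m A)))"

lemma empty_in_subpartitions [simp]: "{} \<in> subpartitions B"
  by (auto simp: subpartitions_def)

lemma variation_upper: "P \<in> subpartitions B \<Longrightarrow> (\<Sum>A\<in>P. ennreal (norm (rmeas m A))) \<le> variation m B"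
  unfolding variation_def by (rule SUP_upper)

lemma variation_mono: "A \<subseteq> B \<Longrightarrow> variation m A \<le> variation m B"
  unfolding variation_def by (intro SUP_subset_mono) (auto simp: subpartitions_def)

lemma norm_rmeas_le_variation:
  assumes "bounded_borel B"
  shows "ennreal (norm (rmeas m B)) \<le> variation m B"
  using variation_upper[of "{B}" B m] assms by (auto simp: subpartitions_def)

lemma variation_empty [simp]: "variation m {} = 0"
proof -
  have "(\<Sum>A\<in>P. ennreal (norm (rmeas m A))) = 0" if "P \<in> subpartitions {}" for P
    using that by (intro sum.neutral) (auto simp: subpartitions_def)
  then show ?thesis
    unfolding variation_def by (intro antisym SUP_least) auto
qed

text \<open>Subpartitions of two disjoint sets join to a subpartition of the union, and their sums
  add up; the suprema over the two families are then taken one after the other.\<close>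

lemma variation_superadd:
  assumes "A \<inter> B = {}"
  shows "variation m A + variation m B \<le> variation m (A \<union> B)"
proof -
  let ?s = "\<lambda>P. \<Sum>A\<in>P. ennreal (norm (rmeas m A))"
  have *: "?s P + ?s Q \<le> variation m (A \<union> B)"
    if P: "P \<in> subpartitions A" and Q: "Q \<in> subpartitions B" for P Q
  proof -
    have fin: "finite P" "finite Q"
      using P Q by (auto simp: subpartitions_def)
    \<comment> \<open>Both families may contain the empty set, which the union counts only once; its
      value is 0, so nothing is lost.\<close>
    have "E = {}" if "E \<in> P \<inter> Q" for E
      using that P Q assms unfolding subpartitions_def by blast
    then have "?s (P \<inter> Q) = 0"
      by (intro sum.neutral) (use rmeas_empty in force)
    then have "?s P + ?s Q = ?s (P \<union> Q)"
      using sum.union_inter[OF fin, of "\<lambda>A. ennreal (norm (rmeas m A))"] by simp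
    also have "disjoint (P \<union> Q)"
      unfolding disjoint_def
    proof (intro ballI impI)
      fix E F assume "E \<in> P \<union> Q" "F \<in> P \<union> Q" "E \<noteq> F"
      then consider "E \<in> P" "F \<in> P" | "E \<in> Q" "F \<in> Q" | "E \<in> P" "F \<in> Q" | "E \<in> Q" "F \<in> P"
        by blast
      then show "E \<inter> F = {}"
      proof cases
        case 1
        then show ?thesis using P \<open>E \<noteq> F\<close> by (simp add: subpartitions_def disjoint_def)
      next
        case 2
        then show ?thesis using Q \<open>E \<noteq> F\<close> by (simp add: subpartitions_def disjoint_def)
      next
        case 3
        then have "E \<subseteq> A" "F \<subseteq> B" using P Q by (simp_all add: subpartitions_def)
        then show ?thesis using assms by blast
      next
        case 4
        then have "E \<subseteq> B" "F \<subseteq> A" using P Q by (simp_all add: subpartitions_def)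
        then show ?thesis using assms by blast
      qed
    qed
    then have "P \<union> Q \<in> subpartitions (A \<union> B)"
      using P Q by (auto simp: subpartitions_def)
    then have "?s (P \<union> Q) \<le> variation m (A \<union> B)"
      by (rule variation_upper)
    finally show ?thesis .
  qed
  have ne: "subpartitions C \<noteq> {}" for C :: "'a set"
    using empty_in_subpartitions by blast
  have "?s P + variation m B \<le> variation m (A \<union> B)" if P: "P \<in> subpartitions A" for P
  proof -
    have "?s P + variation m B = (SUP Q\<in>subpartitions B. ?s P + ?s Q)"
      unfolding variation_def by (simp add: ennreal_SUP_add_right ne)
    also have "\<dots> \<le> variation m (A \<union> B)"
      using * P by (intro SUP_least) auto
    finally show ?thesis .
  qed
  then have "(SUP P\<in>subpartitions A. ?s P + variation m B) \<le> variation m (A \<union> B)"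
    by (intro SUP_least) auto
  then show ?thesis
    by (subst (asm) ennreal_SUP_add_left) (auto simp: ne variation_def[of m A])
qed

lemma norm_sums_le_suminf:
  fixes f :: "nat \<Rightarrow> 'b::euclidean_space"
  assumes "f sums s"
  shows "ennreal (norm s) \<le> (\<Sum>i. ennreal (norm (f i)))"
proof (rule LIMSEQ_le)
  show "(\<lambda>n. ennreal (norm (\<Sum>i<n. f i))) \<longlonglongrightarrow> ennreal (norm s)"
    using assms unfolding sums_def by (intro tendsto_intros)
  show "(\<lambda>n. \<Sum>i<n. ennreal (norm (f i))) \<longlonglongrightarrow> (\<Sum>i. ennreal (norm (f i)))"
    by (rule summable_LIMSEQ) simp
  show "\<exists>N. \<forall>n\<ge>N. ennreal (norm (\<Sum>i<n. f i)) \<le> (\<Sum>i<n. ennreal (norm (f i)))"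
    by (auto simp: sum_ennreal intro!: ennreal_leI norm_sum)
qed

text \<open>Superadditivity and monotonicity give one inequality. For the other, each member of a
  subpartition of the union is cut along the sets \<open>A i\<close>; the norm of its value is at
  most the sum of the norms of the pieces, and the pieces inside \<open>A i\<close> form a
  subpartition of \<open>A i\<close>.\<close>

lemma variation_countably_additive: "countably_additive (sets borel) (variation m)"
proof (rule countably_additiveI)
  fix A :: "nat \<Rightarrow> 'a set"
  assume A: "range A \<subseteq> sets borel" "disjoint_family A"
  let ?U = "\<Union>i. A i"
  show "(\<Sum>i. variation m (A i)) = variation m ?U"
  proof (rule antisym)
    have "(\<Sum>i<n. variation m (A i)) \<le> variation m (\<Union>i<n. A i)" for n
    proof (induction n)
      case (Suc n)
      have "A i \<inter> A n = {}" if "i < n" for i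
        using A(2) that by (simp add: disjoint_family_on_def)
      then have "(\<Union>i<n. A i) \<inter> A n = {}"
        by auto
      from variation_superadd[OF this, of m] Suc show ?case
        by (simp add: lessThan_Suc Un_commute add.commute) (meson add_left_mono order_trans)
    qed simp
    then have "(\<Sum>i<n. variation m (A i)) \<le> variation m ?U" for n
      by (rule order_trans) (auto intro: variation_mono)
    then show "(\<Sum>i. variation m (A i)) \<le> variation m ?U"
      by (simp add: suminf_eq_SUP SUP_least)
  next
    have "(\<Sum>E\<in>P. ennreal (norm (rmeas m E))) \<le> (\<Sum>i. variation m (A i))"
      if P: "P \<in> subpartitions ?U" for P
    proof -
      have PD: "finite P" "disjoint P" "\<And>E. E \<in> P \<Longrightarrow> bounded_borel E \<and> E \<subseteq> ?U"
        using P by (auto simp: subpartitions_def)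
      have "ennreal (norm (rmeas m E)) \<le> (\<Sum>i. ennreal (norm (rmeas m (E \<inter> A i))))" if E: "E \<in> P" for E
      proof (rule norm_sums_le_suminf)
        have "E = (\<Union>i. E \<inter> A i)"
          using PD(3)[OF E] by auto
        moreover have "(\<lambda>i. rmeas m (E \<inter> A i)) sums rmeas m (\<Union>i. E \<inter> A i)"
        proof (rule rmeas_sums)
          show "bounded (\<Union>i. E \<inter> A i)"
            by (rule bounded_subset[of E]) (use PD(3)[OF E] in \<open>auto simp: bounded_borel_def\<close>)
        qed (use A PD(3)[OF E] in \<open>auto simp: disjoint_family_on_def bounded_borel_def\<close>)
        ultimately show "(\<lambda>i. rmeas m (E \<inter> A i)) sums rmeas m E"
          by simp
      qed
      then have "(\<Sum>E\<in>P. ennreal (norm (rmeas m E))) \<le> (\<Sum>E\<in>P. \<Sum>i. ennreal (norm (rmeas m (E \<inter> A i))))"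
        by (rule sum_mono)
      also have "\<dots> = (\<Sum>i. \<Sum>E\<in>P. ennreal (norm (rmeas m (E \<inter> A i))))"
        by (rule suminf_sum[symmetric]) simp
      also have "\<dots> \<le> (\<Sum>i. variation m (A i))"
      proof (rule suminf_le)
        fix i
        let ?Q = "(\<lambda>E. E \<inter> A i) ` P"
        have "(\<Sum>E\<in>P. ennreal (norm (rmeas m (E \<inter> A i)))) = (\<Sum>F\<in>?Q. ennreal (norm (rmeas m F)))"
        proof (subst sum.reindex_nontrivial)
          \<comment> \<open>Different members are disjoint, so they can have the same trace on
            \<open>A i\<close> only if that trace is empty.\<close>
          fix E F assume "E \<in> P" "F \<in> P" "E \<noteq> F" "E \<inter> A i = F \<inter> A i"
          then have "E \<inter> A i = {}"
            using PD(2) unfolding disjoint_def by blast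
          then show "ennreal (norm (rmeas m (E \<inter> A i))) = 0" by simp
        qed (auto simp: PD(1))
        also have "?Q \<in> subpartitions (A i)"
        proof -
          have "disjoint ?Q"
            using PD(2) unfolding disjoint_def by blast
          moreover have "bounded_borel (E \<inter> A i)" if "E \<in> P" for E
            using PD(3)[OF that] A(1) by (intro bounded_borel_Int) auto
          ultimately show ?thesis
            using PD(1) by (auto simp: subpartitions_def)
        qed
        then have "(\<Sum>F\<in>?Q. ennreal (norm (rmeas m F))) \<le> variation m (A i)"
          by (rule variation_upper)
        finally show "(\<Sum>E\<in>P. ennreal (norm (rmeas m (E \<inter> A i)))) \<le> variation m (A i)" .
      qed auto
      finally show ?thesis .
    qed
    then show "variation m ?U \<le> (\<Sum>i. variation m (A i))"
      unfolding variation_def[of m ?U] by (rule SUP_least)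
  qed
qed

lemma total_variation_eq: "total_variation m = measure_of UNIV (sets borel) (variation m)"
  unfolding total_variation_def variation_def subpartitions_def ..

lemma sets_total_variation [simp, measurable_cong]: "sets (total_variation m) = sets borel"
  unfolding total_variation_eq using sets.sigma_sets_eq[of borel] by (simp add: sets_measure_of_conv)

lemma space_total_variation [simp]: "space (total_variation m) = UNIV"
  using sets_eq_imp_space_eq[OF sets_total_variation] by simp

lemma emeasure_total_variation:
  assumes "B \<in> sets borel"
  shows "emeasure (total_variation m) B = variation m B"
proof (rule emeasure_measure_of[OF total_variation_eq])
  show "positive (sets (total_variation m)) (variation m)"
    by (simp add: positive_def)
  show "countably_additive (sets (total_variation m)) (variation m)"
    by (simp add: variation_countably_additive)
qed (use assms in auto)

lemma variation_Un:
  assumes "A \<in> sets borel" "B \<in> sets borel" "A \<inter> B = {}"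
  shows "variation m (A \<union> B) = variation m A + variation m B"
  using plus_emeasure[of A "total_variation m" B] assms by (simp add: emeasure_total_variation)

text \<open>Rudin's splitting argument: a set of infinite variation contains a subset on which \<open>m\<close> is
  large, together with its complement; iterating produces a divergent disjoint series.\<close>

lemma infinite_variation_split:
  assumes E: "bounded_borel E" and inf: "variation m E = \<infinity>"
  obtains A where "bounded_borel A" "A \<subseteq> E" "norm (rmeas m (E - A)) \<ge> 1" "variation m A = \<infinity>"
proof -
  \<comment> \<open>The factor \<open>DIM('b)\<close> allows one coordinate to be singled out, the
    factor 2 one sign of that coordinate.\<close>
  define t where "t = 2 * real DIM('b) * (1 + norm (rmeas m E))"
  have "ennreal t < variation m E"
    using inf by simp
  then obtain P where P: "P \<in> subpartitions E" "ennreal t < (\<Sum>A\<in>P. ennreal (norm (rmeas m A)))"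
    unfolding variation_def less_SUP_iff by auto
  have PD: "finite P" "disjoint P" "\<And>F. F \<in> P \<Longrightarrow> bounded_borel F \<and> F \<subseteq> E"
    using P(1) by (auto simp: subpartitions_def)
  have "t < (\<Sum>A\<in>P. norm (rmeas m A))"
    using P(2) by (simp add: sum_ennreal ennreal_less_iff t_def)
  also have "\<dots> \<le> (\<Sum>A\<in>P. \<Sum>b\<in>Basis. \<bar>rmeas m A \<bullet> b\<bar>)"
    by (intro sum_mono norm_le_l1)
  also have "\<dots> = (\<Sum>b\<in>Basis. \<Sum>A\<in>P. \<bar>rmeas m A \<bullet> b\<bar>)"
    by (rule sum.swap)
  finally have *: "t < (\<Sum>b\<in>Basis. \<Sum>A\<in>P. \<bar>rmeas m A \<bullet> b\<bar>)" .
  have "\<exists>b\<in>Basis. 2 * (1 + norm (rmeas m E)) < (\<Sum>A\<in>P. \<bar>rmeas m A \<bullet> b\<bar>)"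
  proof (rule ccontr)
    assume "\<not> ?thesis"
    then have "(\<Sum>b\<in>Basis. \<Sum>A\<in>P. \<bar>rmeas m A \<bullet> b\<bar>) \<le> (\<Sum>b\<in>(Basis::'b set). 2 * (1 + norm (rmeas m E)))"
      by (intro sum_mono) (auto simp: not_less)
    with * show False
      by (simp add: t_def algebra_simps)
  qed
  then obtain b where b: "b \<in> Basis" "2 * (1 + norm (rmeas m E)) < (\<Sum>A\<in>P. \<bar>rmeas m A \<bullet> b\<bar>)"
    by blast
  let ?pos = "{A\<in>P. rmeas m A \<bullet> b \<ge> 0}" and ?neg = "{A\<in>P. rmeas m A \<bullet> b < 0}"
  have U: "rmeas m (\<Union>Q) = (\<Sum>A\<in>Q. rmeas m A)" if "Q \<subseteq> P" for Q
    using that PD pairwise_subset[OF PD(2) that] by (intro rmeas_Union) (auto intro: finite_subset)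
  have "(\<Sum>A\<in>P. \<bar>rmeas m A \<bullet> b\<bar>) = (\<Sum>A\<in>?pos. \<bar>rmeas m A \<bullet> b\<bar>) + (\<Sum>A\<in>?neg. \<bar>rmeas m A \<bullet> b\<bar>)"
    by (subst sum.union_disjoint[symmetric]) (auto simp: PD(1) intro!: sum.cong)
  also have "(\<Sum>A\<in>?pos. \<bar>rmeas m A \<bullet> b\<bar>) = (\<Sum>A\<in>?pos. rmeas m A \<bullet> b)"
    by (intro sum.cong) auto
  also have "\<dots> = rmeas m (\<Union>?pos) \<bullet> b"
    by (subst U) (auto simp: inner_sum_left)
  also have "(\<Sum>A\<in>?neg. \<bar>rmeas m A \<bullet> b\<bar>) = (\<Sum>A\<in>?neg. - (rmeas m A \<bullet> b))"
    by (intro sum.cong) auto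
  also have "\<dots> = - (rmeas m (\<Union>?neg) \<bullet> b)"
    by (subst U) (auto simp: inner_sum_left sum_negf)
  finally have sum_eq: "(\<Sum>A\<in>P. \<bar>rmeas m A \<bullet> b\<bar>) = rmeas m (\<Union>?pos) \<bullet> b - rmeas m (\<Union>?neg) \<bullet> b" by simp
  have "\<exists>Q\<subseteq>P. 1 + norm (rmeas m E) < norm (rmeas m (\<Union>Q))"
  proof (rule ccontr)
    assume "\<not> ?thesis"
    then have "norm (rmeas m (\<Union>?pos)) \<le> 1 + norm (rmeas m E)" "norm (rmeas m (\<Union>?neg)) \<le> 1 + norm (rmeas m E)"
      by (auto simp: not_less)
    moreover have "rmeas m (\<Union>?pos) \<bullet> b \<le> norm (rmeas m (\<Union>?pos))"
      using Basis_le_norm[OF b(1), of "rmeas m (\<Union>?pos)"] by (rule order_trans[OF abs_ge_self])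
    moreover have "- (rmeas m (\<Union>?neg) \<bullet> b) \<le> norm (rmeas m (\<Union>?neg))"
      using Basis_le_norm[OF b(1), of "rmeas m (\<Union>?neg)"] by (rule order_trans[OF abs_ge_minus_self])
    ultimately show False
      using b(2) unfolding sum_eq by argo
  qed
  then obtain Q where Q: "Q \<subseteq> P" "1 + norm (rmeas m E) < norm (rmeas m (\<Union>Q))"
    by blast
  define A where "A = \<Union>Q"
  have A: "bounded_borel A" "A \<subseteq> E"
    using Q(1) PD bounded_borel_UN[of Q "\<lambda>x. x"] by (auto simp: A_def intro: finite_subset)
  have Ab: "A \<in> sets borel" "E \<in> sets borel"
    using A E by (auto simp: bounded_borel_def)
  have nA: "norm (rmeas m A) \<ge> 1"
    using Q(2) norm_ge_zero[of "rmeas m E"] unfolding A_def by linarith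
  have "rmeas m (E - A) = rmeas m E - rmeas m A"
    using rmeas_Diff[OF E Ab(1), of m] A(2) by (simp add: Int_absorb1)
  \<comment> \<open>Here the summand \<open>norm (rmeas m E)\<close> of the threshold is spent: A
    and its complement in E both have values of norm at least 1, so whichever of them has infinite
    variation can be kept.\<close>
  then have nEA: "norm (rmeas m (E - A)) \<ge> 1"
    using Q(2) norm_triangle_ineq2[of "rmeas m A" "rmeas m E"] unfolding A_def
    by (simp add: norm_minus_commute)
  have "variation m A + variation m (E - A) = \<infinity>"
    using variation_Un[of A "E - A" m] Ab A(2) inf by (simp add: Un_absorb1)
  then consider "variation m A = \<infinity>" | "variation m (E - A) = \<infinity>"
    by (auto simp: infinity_ennreal_def)
  then show thesis
  proof cases
    case 1
    with A nEA show ?thesis by (intro that[of A]) auto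
  next
    case 2
    have "E - (E - A) = A" using A(2) by auto
    with 2 A nA Ab E show ?thesis by (intro that[of "E - A"]) (auto intro: bounded_borel_Diff)
  qed
qed

text \<open>The type only asks for countable additivity with finite values. Finiteness of the
  variation on bounded sets has to be derived from it; it makes \<open>total_variation\<close>
  locally finite and thereby gives access to Radon-Nikodym and polar decompositions.\<close>

lemma variation_finite:
  assumes "bounded_borel E"
  shows "variation m E < \<infinity>"
proof (rule ccontr)
  assume "\<not> ?thesis"
  then have inf: "variation m E = \<infinity>"
    by (simp add: less_top[symmetric])
  let ?P = "\<lambda>A. bounded_borel A \<and> variation m A = \<infinity>"
  obtain S where S: "\<And>n. ?P (S n)" and step: "\<And>n. S (Suc n) \<subseteq> S n \<and> norm (rmeas m (S n - S (Suc n))) \<ge> 1"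
    and S0: "S 0 = E"
  proof -
    have "\<exists>B. ?P B \<and> B \<subseteq> A \<and> norm (rmeas m (A - B)) \<ge> 1" if "?P A" for A
      using that by (metis infinite_variation_split)
    then obtain f where f: "\<And>A. ?P A \<Longrightarrow> ?P (f A) \<and> f A \<subseteq> A \<and> norm (rmeas m (A - f A)) \<ge> 1"
      by metis
    define S where "S n = (f ^^ n) E" for n
    have "?P (S n)" for n
      by (induction n) (use assms inf f in \<open>auto simp: S_def\<close>)
    then show thesis
      using f by (intro that[of S]) (auto simp: S_def)
  qed
  define D where "D n = S n - S (Suc n)" for n
  have dec: "S n \<subseteq> S k" if "k \<le> n" for k n
    using that by (rule lift_Suc_antimono_le[rotated]) (use step in auto)
  have dis: "disjoint_family D"
  proof -
    have "D i \<inter> D j = {}" if "i < j" for i j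
      using dec[of "Suc i" j] that by (auto simp: D_def)
    then have "D i \<inter> D j = {}" if "i \<noteq> j" for i j
      using that by (metis Int_commute linorder_neqE_nat)
    then show ?thesis
      by (simp add: disjoint_family_on_def)
  qed
  have "D n \<subseteq> E" for n
    using dec[of 0 n] S0 by (auto simp: D_def)
  then have "bounded (\<Union>i. D i)"
    using assms by - (rule bounded_subset[of E], auto simp: bounded_borel_def)
  moreover have "range D \<subseteq> sets borel"
    using S by (auto simp: D_def bounded_borel_def)
  ultimately have "(\<lambda>i. rmeas m (D i)) sums rmeas m (\<Union>i. D i)"
    using dis by (intro rmeas_sums)
  then have "(\<lambda>i. rmeas m (D i)) \<longlonglongrightarrow> 0"
    by (intro summable_LIMSEQ_zero sums_summable)
  then have "\<exists>n. norm (rmeas m (D n)) < 1"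
    by (metis LIMSEQ_iff diff_zero order_refl zero_less_one)
  then show False
    using step by (auto simp: D_def not_le[symmetric])
qed

section \<open>Locally finite Borel measures and domination\<close>

lemma nonneg_radonD:
  assumes "nonneg_radon M"
  shows nonneg_radon_sets: "sets M = sets borel" and nonneg_radon_space: "space M = UNIV"
    and nonneg_radon_finite: "bounded B \<Longrightarrow> emeasure M B < \<infinity>"
    and nonneg_radon_sigma_finite: "sigma_finite_measure M"
proof -
  show s: "sets M = sets borel" using assms by (simp add: nonneg_radon_def)
  show sp: "space M = UNIV" using sets_eq_imp_space_eq[OF s] by simp
  have c: "emeasure M (cball 0 r) < \<infinity>" for r
    using assms by (simp add: nonneg_radon_def)
  show "emeasure M B < \<infinity>" if B: "bounded B" for B
  proof -
    obtain r where "B \<subseteq> cball 0 r"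
      using bounded_subset_ballD[OF B, of 0] ball_subset_cball by blast
    then have "emeasure M B \<le> emeasure M (cball 0 r)"
      by (intro emeasure_mono) (auto simp: s)
    then show ?thesis using c by (rule order_le_less_trans)
  qed
  show "sigma_finite_measure M"
  proof
    show "\<exists>A. countable A \<and> A \<subseteq> sets M \<and> \<Union>A = space M \<and> (\<forall>a\<in>A. emeasure M a \<noteq> \<infinity>)"
    proof (intro exI conjI ballI)
      show "countable (range (\<lambda>n::nat. cball (0::'a) (real n)))" by simp
      show "range (\<lambda>n::nat. cball (0::'a) (real n)) \<subseteq> sets M" by (auto simp: s)
      show "\<Union> (range (\<lambda>n::nat. cball (0::'a) (real n))) = space M"
        using real_arch_simple by (auto simp: sp)
      show "emeasure M A \<noteq> \<infinity>" if "A \<in> range (\<lambda>n::nat. cball (0::'a) (real n))" for A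
        using that c less_top by auto
    qed
  qed
qed

lemma nonneg_radon_total_variation: "nonneg_radon (total_variation m)"
  unfolding nonneg_radon_def
  by (auto simp: emeasure_total_variation borel_compact compact_imp_bounded bounded_borel_def intro!: variation_finite[simplified])

lemma norm_rmeas_le:
  assumes "bounded_borel B"
  shows "norm (rmeas m B) \<le> measure (total_variation m) B"
proof -
  have "B \<in> sets borel" using assms by (simp add: bounded_borel_def)
  then have "emeasure (total_variation m) B = variation m B"
    by (rule emeasure_total_variation)
  then have "variation m B = ennreal (measure (total_variation m) B)"
    using variation_finite[OF assms, of m] by (metis emeasure_eq_ennreal_measure infinity_ennreal_def less_irrefl)
  then show ?thesis
    using norm_rmeas_le_variation[OF assms, of m] by (simp add: ennreal_le_iff)
qed

text \<open>The total variation is the least measure dominating the norm of the set function, so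
  domination by a multiple of M on bounded sets passes to it, also on unbounded Borel sets.\<close>

lemma total_variation_le:
  assumes M: "nonneg_radon M" and C: "0 \<le> C"
    and le: "\<And>A. bounded_borel A \<Longrightarrow> norm (rmeas m A) \<le> C * measure M A"
    and B: "B \<in> sets borel"
  shows "emeasure (total_variation m) B \<le> ennreal C * emeasure M B"
  unfolding emeasure_total_variation[OF B] variation_def
proof (rule SUP_least)
  fix P assume P: "P \<in> subpartitions B"
  then have PD: "finite P" "disjoint P" "\<And>E. E \<in> P \<Longrightarrow> bounded_borel E \<and> E \<subseteq> B"
    by (auto simp: subpartitions_def)
  have "(\<Sum>A\<in>P. ennreal (norm (rmeas m A))) \<le> (\<Sum>A\<in>P. ennreal C * emeasure M A)"
  proof (rule sum_mono)
    fix A assume "A \<in> P"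
    then have A: "bounded_borel A" using PD by auto
    then have "emeasure M A = ennreal (measure M A)"
      using nonneg_radon_finite[OF M, of A] by (simp add: bounded_borel_def emeasure_eq_ennreal_measure less_top)
    then show "ennreal (norm (rmeas m A)) \<le> ennreal C * emeasure M A"
      using le[OF A] C by (simp add: ennreal_mult[symmetric] ennreal_leI)
  qed
  also have "\<dots> = ennreal C * (\<Sum>A\<in>P. emeasure M A)"
    by (simp add: sum_distrib_left)
  also have "(\<Sum>A\<in>P. emeasure M A) = emeasure M (\<Union>P)"
  proof -
    have "(\<lambda>x. x) ` P \<subseteq> sets M"
      using PD nonneg_radon_sets[OF M] by (auto simp: bounded_borel_def)
    moreover have "disjoint_family_on (\<lambda>x. x) P"
      using PD(2) by (auto simp: disjoint_def disjoint_family_on_def)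
    ultimately show ?thesis
      using sum_emeasure[of "\<lambda>x. x" P M] PD(1) by simp
  qed
  also have "emeasure M (\<Union>P) \<le> emeasure M B"
    using PD B nonneg_radon_sets[OF M] by (intro emeasure_mono) auto
  finally show "(\<Sum>A\<in>P. ennreal (norm (rmeas m A))) \<le> ennreal C * emeasure M B"
    by (simp add: mult_left_mono)
qed

section \<open>Densities\<close>

lemma is_densityD:
  assumes "is_density M g m"
  shows is_density_measurable: "g \<in> borel_measurable borel"
    and is_density_integrable: "bounded_borel B \<Longrightarrow> set_integrable M B g"
    and is_density_eq: "bounded_borel B \<Longrightarrow> rmeas m B = set_lebesgue_integral M B g"
  using assms by (auto simp: is_density_def)

text \<open>The integral is tested on the negativity set of h. Only bounded sets are available, so
  that set is cut by balls, and countably many balls exhaust the space.\<close>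

lemma AE_nonneg_if_integrals_nonneg:
  fixes h :: "'a::euclidean_space \<Rightarrow> real"
  assumes M: "nonneg_radon M" and h: "h \<in> borel_measurable borel"
    and int: "\<And>B. bounded_borel B \<Longrightarrow> set_integrable M B h"
    and nn: "\<And>B. bounded_borel B \<Longrightarrow> 0 \<le> set_lebesgue_integral M B h"
  shows "AE x in M. 0 \<le> h x"
proof -
  note [measurable_cong] = nonneg_radon_sets[OF M] and [measurable] = h
  have "AE x in M. x \<in> ball 0 (real n) \<longrightarrow> 0 \<le> h x" for n
  proof -
    define E where "E = {x. h x < 0} \<inter> ball 0 (real n)"
    have E: "bounded_borel E"
      unfolding bounded_borel_def E_def by (auto intro: bounded_subset[OF bounded_ball])
    have i: "integrable M (\<lambda>x. indicator E x * (- h x))"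
      using int[OF E] unfolding set_integrable_def by simp
    have "(\<integral>x. indicator E x * (- h x) \<partial>M) \<le> 0"
      using nn[OF E] unfolding set_lebesgue_integral_def by simp
    moreover have nn': "0 \<le> indicator E x * (- h x)" for x
      by (auto simp: E_def indicator_def)
    ultimately have "(\<integral>x. indicator E x * (- h x) \<partial>M) = 0"
      by (intro antisym integral_nonneg_AE) auto
    then have "AE x in M. indicator E x * (- h x) = 0"
      using integral_nonneg_eq_0_iff_AE[OF i] nn' by simp
    then show ?thesis
      by eventually_elim (auto simp: E_def indicator_def split: if_splits)
  qed
  then have "AE x in M. \<forall>n. x \<in> ball 0 (real n) \<longrightarrow> 0 \<le> h x"
    by (subst AE_all_countable) blast
  then show ?thesis
  proof eventually_elim
    case (elim x)
    obtain n where "norm x < real n"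
      using reals_Archimedean2 by blast
    then have "x \<in> ball 0 (real n)"
      by simp
    with elim show ?case
      by blast
  qed
qed

lemma suminf_ennreal_commute:
  fixes f :: "nat \<Rightarrow> nat \<Rightarrow> ennreal"
  shows "(\<Sum>i. \<Sum>j. f i j) = (\<Sum>j. \<Sum>i. f i j)"
proof -
  have "(\<Sum>i. \<Sum>j. f i j) = (\<integral>\<^sup>+i. (\<Sum>j. f i j) \<partial>count_space UNIV)"
    by (simp add: nn_integral_count_space_nat)
  also have "\<dots> = (\<Sum>j. \<integral>\<^sup>+i. f i j \<partial>count_space UNIV)"
    by (rule nn_integral_suminf) auto
  finally show ?thesis
    by (simp add: nn_integral_count_space_nat)
qed

text \<open>Adding \<open>C * measure M\<close> makes the set function nonnegative. It is glued from
  bounded pieces to a measure on the whole space, Radon-Nikodym applies, and C is subtracted again.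
  The set function is a bare function, not a \<open>radon\<close>, because the result is applied to
  coordinates of vector measures and to differences \<mu> - c \<gamma>.\<close>

lemma ex_bounded_real_density:
  fixes m :: "'a::euclidean_space set \<Rightarrow> real"
  assumes M: "nonneg_radon M"
    and sums: "\<And>A :: nat \<Rightarrow> 'a set. range A \<subseteq> sets borel \<Longrightarrow> disjoint_family A \<Longrightarrow> bounded (\<Union>i. A i) \<Longrightarrow>
         (\<lambda>i. m (A i)) sums m (\<Union>i. A i)"
    and le: "\<And>B. bounded_borel B \<Longrightarrow> \<bar>m B\<bar> \<le> C * measure M B" and C: "0 \<le> C"
  obtains g where "g \<in> borel_measurable borel" "\<And>x. \<bar>g x\<bar> \<le> C"
    "\<And>B. bounded_borel B \<Longrightarrow> set_integrable M B g \<and> m B = set_lebesgue_integral M B g"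
proof -
  interpret M: sigma_finite_measure M by (rule nonneg_radon_sigma_finite[OF M])
  note [measurable_cong] = nonneg_radon_sets[OF M]
  have fin: "emeasure M B \<noteq> \<infinity>" if "bounded B" for B
    using nonneg_radon_finite[OF M that] by simp
  define e where "e B = m B + C * measure M B" for B
  have e0: "0 \<le> e B" if "bounded_borel B" for B
    using le[OF that] by (auto simp: e_def)
  have e_sums: "(\<Sum>i. ennreal (e (A i))) = ennreal (e (\<Union>i. A i))"
    if A: "range A \<subseteq> sets borel" "disjoint_family A" "bounded (\<Union>i. A i)" for A :: "nat \<Rightarrow> 'a set"
  proof (rule suminf_ennreal_eq)
    have "bounded (A i)" for i
      using A(3) by (rule bounded_subset) auto
    then show "0 \<le> e (A i)" for i
      using A(1) by (intro e0) (auto simp: bounded_borel_def)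
    have "(\<lambda>i. measure M (A i)) sums measure M (\<Union>i. A i)"
      using A fin nonneg_radon_sets[OF M] by (intro measure_UNION) auto
    then show "(\<lambda>i. e (A i)) sums e (\<Union>i. A i)"
      unfolding e_def by (intro sums_add sums_mult sums[OF A])
  qed
  \<comment> \<open>Disjoint bounded annuli covering the space: e is meaningful on bounded sets
    only, and summing over the annuli extends it to all Borel sets.\<close>
  define Q where "Q n = {x::'a. real n \<le> norm x \<and> norm x < real (Suc n)}" for n
  have Q: "bounded_borel (Q n)" for n
  proof -
    have "Q n \<subseteq> ball 0 (real (Suc n))" by (auto simp: Q_def)
    moreover have "Q n \<in> sets borel" unfolding Q_def by measurable
    ultimately show ?thesis
      unfolding bounded_borel_def using bounded_subset[OF bounded_ball] by blast
  qed
  then have Qb: "Q n \<in> sets borel" "bounded (Q n)" for n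
    by (auto simp: bounded_borel_def)
  have Qdisj: "disjoint_family Q"
    unfolding disjoint_family_on_def
  proof (intro ballI impI)
    fix i j :: nat assume "i \<noteq> j"
    then have "Suc i \<le> j \<or> Suc j \<le> i" by linarith
    then have "real (Suc i) \<le> real j \<or> real (Suc j) \<le> real i" by (metis of_nat_mono)
    then show "Q i \<inter> Q j = {}" by (force simp: Q_def)
  qed
  have QU: "(\<Union>n. Q n) = UNIV"
  proof -
    have "x \<in> Q (nat \<lfloor>norm x\<rfloor>)" for x
      by (auto simp: Q_def) linarith
    then show ?thesis by blast
  qed
  let ?N = "\<lambda>B. \<Sum>n. ennreal (e (B \<inter> Q n))"
  define N where "N = measure_of UNIV (sets borel) ?N"
  have sN: "sets N = sets borel"
    unfolding N_def using sets.sigma_sets_eq[of borel] by (simp add: sets_measure_of_conv)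
  have e_empty: "e {} = 0"
    using le[of "{}"] by (simp add: e_def)
  have emN: "emeasure N B = ?N B" if "B \<in> sets borel" for B
  proof (rule emeasure_measure_of[OF N_def])
    show "positive (sets N) ?N"
      by (simp add: positive_def e_empty)
    show "countably_additive (sets N) ?N"
    proof (rule countably_additiveI)
      fix A :: "nat \<Rightarrow> 'a set" assume A: "range A \<subseteq> sets N" "disjoint_family A"
      have "(\<Sum>i. ?N (A i)) = (\<Sum>n. \<Sum>i. ennreal (e (A i \<inter> Q n)))"
        by (rule suminf_ennreal_commute)
      also have "\<dots> = (\<Sum>n. ennreal (e (\<Union>i. A i \<inter> Q n)))"
      proof (intro suminf_cong e_sums)
        fix n
        show "bounded (\<Union>i. A i \<inter> Q n)"
          by (rule bounded_subset[OF Qb(2)[of n]]) auto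
        show "disjoint_family (\<lambda>i. A i \<inter> Q n)"
          using A(2) by (auto simp: disjoint_family_on_def)
      qed (use A Qb sN in auto)
      also have "\<dots> = ?N (\<Union>i. A i)"
        by simp
      finally show "(\<Sum>i. ?N (A i)) = ?N (\<Union>i. A i)" .
    qed
  qed (use that sN in auto)
  have emN_bb: "emeasure N B = ennreal (e B)" if B: "bounded_borel B" for B
  proof -
    have "(\<Sum>n. ennreal (e (B \<inter> Q n))) = ennreal (e (\<Union>n. B \<inter> Q n))"
    proof (rule e_sums)
      show "bounded (\<Union>n. B \<inter> Q n)"
        by (rule bounded_subset[of B]) (use B in \<open>auto simp: bounded_borel_def\<close>)
      show "disjoint_family (\<lambda>n. B \<inter> Q n)"
        using Qdisj by (auto simp: disjoint_family_on_def)
    qed (use B Qb in \<open>auto simp: bounded_borel_def\<close>)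
    also have "(\<Union>n. B \<inter> Q n) = B"
      using QU by blast
    finally show ?thesis
      using B emN[of B] by (simp add: bounded_borel_def)
  qed
  have "absolutely_continuous M N"
    unfolding absolutely_continuous_def
  proof
    fix B assume B: "B \<in> null_sets M"
    then have Bb: "B \<in> sets borel"
      using nonneg_radon_sets[OF M] by auto
    have "e (B \<inter> Q n) = 0" for n
    proof -
      have "B \<inter> Q n \<in> null_sets M"
        using B Qb nonneg_radon_sets[OF M] by (intro null_set_Int2) auto
      then have "measure M (B \<inter> Q n) = 0"
        by (simp add: null_sets_def measure_def)
      moreover have "bounded_borel (B \<inter> Q n)"
        using bounded_borel_Int[OF Q[of n] Bb] by (simp add: Int_commute)
      ultimately show ?thesis
        using le[of "B \<inter> Q n"] by (simp add: e_def)
    qed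
    then show "B \<in> null_sets N"
      using Bb by (auto simp: null_sets_def sN emN)
  qed
  then obtain f where f: "f \<in> borel_measurable M" "density M f = N"
    using M.Radon_Nikodym[of N] sN nonneg_radon_sets[OF M] by auto
  note [measurable] = f(1)
  \<comment> \<open>The Radon-Nikodym density may be infinite on a null set; the integral over each
    bounded B is finite, so passing to reals changes nothing almost everywhere.\<close>
  define h where "h x = enn2real (f x)" for x
  have h_meas[measurable]: "h \<in> borel_measurable M" unfolding h_def by measurable
  have h: "set_integrable M B h \<and> set_lebesgue_integral M B h = e B" if B: "bounded_borel B" for B
  proof -
    have Bs[measurable]: "B \<in> sets M" using B nonneg_radon_sets[OF M] by (auto simp: bounded_borel_def)
    have i: "(\<integral>\<^sup>+x. f x * indicator B x \<partial>M) = ennreal (e B)"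
      using emN_bb[OF B] emeasure_density[OF f(1) Bs] f(2) by simp
    have "AE x in M. f x * indicator B x \<noteq> \<infinity>"
      using i by (intro nn_integral_PInf_AE) auto
    then have "AE x in M. f x * indicator B x = ennreal (indicator B x * h x)"
      by eventually_elim (auto simp: h_def indicator_def ennreal_enn2real_if split: if_splits)
    then have "(\<integral>\<^sup>+x. f x * indicator B x \<partial>M) = (\<integral>\<^sup>+x. ennreal (indicator B x * h x) \<partial>M)"
      by (rule nn_integral_cong_AE)
    then have "(\<integral>\<^sup>+x. ennreal (indicator B x * h x) \<partial>M) = ennreal (e B)"
      unfolding i by (rule sym)
    then have "integrable M (\<lambda>x. indicator B x * h x) \<and> (\<integral>x. indicator B x * h x \<partial>M) = e B"
      using e0[OF B] by (subst (asm) nn_integral_eq_integrable) (auto simp: h_def)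
    then show ?thesis
      by (simp add: set_integrable_def set_lebesgue_integral_def)
  qed
  define g0 where "g0 x = h x - C" for x
  have c: "set_integrable M B (\<lambda>x. c) \<and> set_lebesgue_integral M B (\<lambda>x. c) = c * measure M B"
    if B: "bounded_borel B" for B and c :: real
    using B fin[of B] nonneg_radon_sets[OF M]
    by (auto simp: set_integrable_def set_lebesgue_integral_def bounded_borel_def less_top)
  have g0: "set_integrable M B g0 \<and> set_lebesgue_integral M B g0 = m B" if B: "bounded_borel B" for B
    using h[OF B] c[OF B, of C] unfolding g0_def
    by (auto simp: set_integral_diff e_def)
  have hb: "h \<in> borel_measurable borel"
    using h_meas nonneg_radon_sets[OF M] measurable_cong_sets by blast
  then have g0b: "g0 \<in> borel_measurable borel"
    unfolding g0_def by measurable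
  \<comment> \<open>The bound \<open>- C \<le> g0 x\<close> holds everywhere because h is
    nonnegative; the upper bound holds only almost everywhere, and the truncation below turns it
    into a pointwise one.\<close>
  have "AE x in M. 0 \<le> C - g0 x"
  proof (rule AE_nonneg_if_integrals_nonneg[OF M])
    show "(\<lambda>x. C - g0 x) \<in> borel_measurable borel" using g0b by measurable
    fix B :: "'a set" assume B: "bounded_borel B"
    show "set_integrable M B (\<lambda>x. C - g0 x)" "0 \<le> set_lebesgue_integral M B (\<lambda>x. C - g0 x)"
      using g0[OF B] c[OF B, of C] le[OF B] by (auto simp: set_integral_diff)
  qed
  then have AE: "AE x in M. max (- C) (min C (g0 x)) = g0 x"
    by eventually_elim (auto simp: g0_def h_def)
  show thesis
  proof (rule that[of "\<lambda>x. max (- C) (min C (g0 x))"])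
    show "(\<lambda>x. max (- C) (min C (g0 x))) \<in> borel_measurable borel"
      using g0b by measurable
    show "\<bar>max (- C) (min C (g0 x))\<bar> \<le> C" for x using C by auto
    fix B :: "'a set" assume B: "bounded_borel B"
    then have Bs[measurable]: "B \<in> sets M" using nonneg_radon_sets[OF M] by (auto simp: bounded_borel_def)
    have [measurable]: "g0 \<in> borel_measurable M" unfolding g0_def by measurable
    have "AE x in M. indicator B x *\<^sub>R max (- C) (min C (g0 x)) = indicator B x *\<^sub>R g0 x"
      using AE by eventually_elim simp
    then have "set_integrable M B (\<lambda>x. max (- C) (min C (g0 x))) = set_integrable M B g0"
      "set_lebesgue_integral M B (\<lambda>x. max (- C) (min C (g0 x))) = set_lebesgue_integral M B g0"
      unfolding set_integrable_def set_lebesgue_integral_def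
      by - (rule integrable_cong_AE, measurable, rule integral_cong_AE, measurable)
    then show "set_integrable M B (\<lambda>x. max (- C) (min C (g0 x))) \<and>
      m B = set_lebesgue_integral M B (\<lambda>x. max (- C) (min C (g0 x)))"
      using g0[OF B] by simp
  qed
qed

text \<open>Scalar densities of the coordinates are assembled into a vector. The factor
  \<open>DIM('b)\<close> is the crude sum of the coordinate bounds; it enters later estimates only
  as a fixed constant.\<close>

lemma ex_bounded_density:
  fixes m :: "('a::euclidean_space, 'b::euclidean_space) radon"
  assumes M: "nonneg_radon M" and C: "0 \<le> C"
    and le: "\<And>B. bounded_borel B \<Longrightarrow> norm (rmeas m B) \<le> C * measure M B"
  obtains g where "is_density M g m" "\<And>x. norm (g x) \<le> C * DIM('b)"
proof -
  have "\<exists>g. g \<in> borel_measurable borel \<and> (\<forall>x. \<bar>g x\<bar> \<le> C) \<and>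
    (\<forall>B. bounded_borel B \<longrightarrow> set_integrable M B g \<and> rmeas m B \<bullet> b = set_lebesgue_integral M B g)"
    if b: "b \<in> Basis" for b
  proof (rule ex_bounded_real_density[OF M, of "\<lambda>B. rmeas m B \<bullet> b" C])
    show "(\<lambda>i. rmeas m (A i) \<bullet> b) sums (rmeas m (\<Union>i. A i) \<bullet> b)"
      if "range A \<subseteq> sets borel" "disjoint_family A" "bounded (\<Union>i. A i)" for A :: "nat \<Rightarrow> 'a set"
      using rmeas_sums[OF that, of m] by (rule bounded_linear.sums[OF bounded_linear_inner_left])
    show "\<bar>rmeas m B \<bullet> b\<bar> \<le> C * measure M B" if "bounded_borel B" for B
      using le[OF that] Basis_le_norm[OF b, of "rmeas m B"] by linarith
  qed (use C in blast)+
  then obtain g where g: "\<And>b. b \<in> Basis \<Longrightarrow> g b \<in> borel_measurable borel"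
    "\<And>b x. b \<in> Basis \<Longrightarrow> \<bar>g b x\<bar> \<le> C"
    "\<And>b B. b \<in> Basis \<Longrightarrow> bounded_borel B \<Longrightarrow> set_integrable M B (g b)"
    "\<And>b B. b \<in> Basis \<Longrightarrow> bounded_borel B \<Longrightarrow> rmeas m B \<bullet> b = set_lebesgue_integral M B (g b)"
    by metis
  define G where "G x = (\<Sum>b\<in>Basis. g b x *\<^sub>R b)" for x
  have [measurable]: "G \<in> borel_measurable borel"
    unfolding G_def using g(1) by (intro borel_measurable_sum borel_measurable_scaleR) auto
  have "set_integrable M B G \<and> rmeas m B = set_lebesgue_integral M B G" if B: "bounded_borel B" for B
  proof -
    have eq: "indicator B x *\<^sub>R G x = (\<Sum>b\<in>Basis. (indicator B x *\<^sub>R g b x) *\<^sub>R b)" for x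
      unfolding G_def by (simp add: scaleR_sum_right)
    have i: "integrable M (\<lambda>x. (indicator B x *\<^sub>R g b x) *\<^sub>R b)" if "b \<in> Basis" for b
      using g(3)[OF that B] unfolding set_integrable_def by (rule integrable_scaleR_left)
    have "integrable M (\<lambda>x. indicator B x *\<^sub>R G x)"
      unfolding eq using i by (intro Bochner_Integration.integrable_sum)
    moreover have "(\<integral>x. indicator B x *\<^sub>R G x \<partial>M) = (\<Sum>b\<in>Basis. (rmeas m B \<bullet> b) *\<^sub>R b)"
      unfolding eq using i g(3,4) B
      by (subst Bochner_Integration.integral_sum) (auto simp: set_lebesgue_integral_def set_integrable_def)
    ultimately show ?thesis
      by (simp add: set_integrable_def set_lebesgue_integral_def euclidean_representation)
  qed
  then have "is_density M G m"
    by (simp add: is_density_def)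
  moreover have "norm (G x) \<le> C * DIM('b)" for x
  proof -
    have "norm (G x) \<le> (\<Sum>b\<in>Basis. norm (g b x *\<^sub>R b))"
      unfolding G_def by (rule norm_sum)
    also have "\<dots> \<le> (\<Sum>b\<in>(Basis::'b set). C)"
      using g(2) by (intro sum_mono) auto
    finally show ?thesis by (simp add: mult.commute)
  qed
  ultimately show thesis using that by blast
qed

lemma set_integral_inner_left:
  fixes g :: "'a \<Rightarrow> 'b::euclidean_space"
  assumes "set_integrable M B g"
  shows "set_integrable M B (\<lambda>x. g x \<bullet> b)"
    and "set_lebesgue_integral M B (\<lambda>x. g x \<bullet> b) = set_lebesgue_integral M B g \<bullet> b"
  using assms integrable_inner_left[of b M "\<lambda>x. indicator B x *\<^sub>R g x"]
    integral_inner_left[of b M "\<lambda>x. indicator B x *\<^sub>R g x"]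
  by (auto simp: set_integrable_def set_lebesgue_integral_def)

text \<open>The differences in both orders have integral 0 over every bounded set, in every
  coordinate. This frees all later statements from the choices hidden in \<open>density_wrt\<close>
  and \<open>ac_density\<close>.\<close>

lemma is_density_unique:
  fixes m :: "('a::euclidean_space, 'b::euclidean_space) radon"
  assumes M: "nonneg_radon M" and g: "is_density M g m" and g': "is_density M g' m"
  shows "AE x in M. g x = g' x"
proof -
  have *: "AE x in M. 0 \<le> (u x - v x) \<bullet> b" if u: "is_density M u m" and v: "is_density M v m" for u v and b :: 'b
  proof (rule AE_nonneg_if_integrals_nonneg[OF M])
    show "(\<lambda>x. (u x - v x) \<bullet> b) \<in> borel_measurable borel"
      using is_density_measurable[OF u] is_density_measurable[OF v] by measurable
    fix B :: "'a set" assume B: "bounded_borel B"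
    have d: "set_integrable M B (\<lambda>x. u x - v x)" "set_lebesgue_integral M B (\<lambda>x. u x - v x) = 0"
      using is_density_integrable[OF u B] is_density_integrable[OF v B]
        is_density_eq[OF u B] is_density_eq[OF v B] by (auto simp: set_integral_diff)
    then show "set_integrable M B (\<lambda>x. (u x - v x) \<bullet> b)" "0 \<le> set_lebesgue_integral M B (\<lambda>x. (u x - v x) \<bullet> b)"
      using set_integral_inner_left[OF d(1), of b] by auto
  qed
  have "AE x in M. g x \<bullet> b = g' x \<bullet> b" for b
    using *[OF g g', of b] *[OF g' g, of b] by eventually_elim (simp add: inner_diff_left)
  then have "AE x in M. \<forall>b\<in>Basis. g x \<bullet> b = g' x \<bullet> b"
    by (intro AE_finite_allI) auto
  then show ?thesis
    by eventually_elim (auto intro: euclidean_eqI)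
qed

lemma is_density_bound:
  fixes m :: "('a::euclidean_space, 'b::euclidean_space) radon"
  assumes M: "nonneg_radon M" and C: "0 \<le> C"
    and le: "\<And>B. bounded_borel B \<Longrightarrow> norm (rmeas m B) \<le> C * measure M B"
    and g: "is_density M g m"
  shows "AE x in M. norm (g x) \<le> C * DIM('b)"
proof -
  obtain g' where g': "is_density M g' m" "\<And>x. norm (g' x) \<le> C * DIM('b)"
    using ex_bounded_density[OF M C le] by blast
  show ?thesis
    using is_density_unique[OF M g g'(1)] by eventually_elim (simp add: g'(2))
qed

lemma is_density_scaleR:
  assumes "is_density M g m" "\<And>B. bounded_borel B \<Longrightarrow> rmeas m' B = c *\<^sub>R rmeas m B"
  shows "is_density M (\<lambda>x. c *\<^sub>R g x) m'"
  unfolding is_density_def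
  using is_densityD[OF assms(1)] assms(2) by auto

section \<open>Integrals of bounded functions with bounded support\<close>

text \<open>One class of integrands that contains continuous functions of compact support, gradients
  of test functions and indicators of bounded sets. The carrier S is kept explicit because error
  bounds refer to its mass.\<close>

definition bounded_fn :: "'a::euclidean_space set \<Rightarrow> ('a \<Rightarrow> 'b::euclidean_space) \<Rightarrow> bool" where
  "bounded_fn S V \<longleftrightarrow> bounded_borel S \<and> V \<in> borel_measurable borel \<and> bounded (range V) \<and> (\<forall>x. x \<notin> S \<longrightarrow> V x = 0)"

lemma bounded_fnI:
  assumes "bounded_borel S" "V \<in> borel_measurable borel" "\<And>x. norm (V x) \<le> C" "\<And>x. x \<notin> S \<Longrightarrow> V x = 0"
  shows "bounded_fn S V"
  using assms by (auto simp: bounded_fn_def bounded_iff)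

lemma bounded_fn_bound:
  assumes "bounded_fn S V"
  obtains C where "0 < C" "\<And>x. norm (V x) \<le> C"
  using assms by (auto simp: bounded_fn_def bounded_pos)

lemma bounded_fn_add:
  assumes "bounded_fn S V" "bounded_fn S W"
  shows "bounded_fn S (\<lambda>x. V x + W x)"
proof -
  obtain C D where "\<And>x. norm (V x) \<le> C" "\<And>x. norm (W x) \<le> D"
    using bounded_fn_bound assms by metis
  then have "norm (V x + W x) \<le> C + D" for x
    by (rule norm_triangle_mono)
  then show ?thesis
    using assms by (intro bounded_fnI[where C = "C + D"]) (auto simp: bounded_fn_def)
qed

lemma bounded_fn_scaleR: "bounded_fn S V \<Longrightarrow> bounded_fn S (\<lambda>x. c *\<^sub>R V x)"
  by (auto simp: bounded_fn_def bounded_scaleR_comp intro: borel_measurable_scaleR)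

lemma bounded_fn_diff: "bounded_fn S V \<Longrightarrow> bounded_fn S W \<Longrightarrow> bounded_fn S (\<lambda>x. V x - W x)"
  using bounded_fn_add[of S V "\<lambda>x. -1 *\<^sub>R W x"] bounded_fn_scaleR[of S W "-1"] by simp

lemma bounded_fn_mono: "bounded_fn S V \<Longrightarrow> S \<subseteq> T \<Longrightarrow> bounded_borel T \<Longrightarrow> bounded_fn T V"
  by (auto simp: bounded_fn_def)

lemma bounded_fn_continuous:
  assumes "compact K" "continuous_on UNIV V" "\<And>x. x \<notin> K \<Longrightarrow> V x = 0"
  shows "bounded_fn K V"
proof -
  have "bounded (V ` K)"
    using assms by (intro compact_imp_bounded compact_continuous_image) (auto intro: continuous_on_subset)
  then obtain C where C: "\<And>x. x \<in> K \<Longrightarrow> norm (V x) \<le> C"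
    by (auto simp: bounded_iff)
  show ?thesis
  proof (rule bounded_fnI[where C = "max C 0"])
    show "bounded_borel K"
      using assms(1) by (auto simp: bounded_borel_def borel_compact compact_imp_bounded)
    show "V \<in> borel_measurable borel"
      using assms(2) by (rule borel_measurable_continuous_onI)
    show "norm (V x) \<le> max C 0" for x
      using C[of x] assms(3)[of x] by (cases "x \<in> K") auto
  qed (use assms in auto)
qed

lemma bounded_fn_integrable:
  assumes M: "nonneg_radon M" and g: "is_density M g m" and V: "bounded_fn S V"
  shows "integrable M (\<lambda>x. V x \<bullet> g x)"
    and "\<And>C. (\<And>x. norm (V x) \<le> C) \<Longrightarrow> \<bar>\<integral>x. V x \<bullet> g x \<partial>M\<bar> \<le> C * (\<integral>x. indicator S x * norm (g x) \<partial>M)"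
proof -
  note [measurable_cong] = nonneg_radon_sets[OF M]
  have S: "bounded_borel S" and V0: "\<And>x. x \<notin> S \<Longrightarrow> V x = 0" and [measurable]: "V \<in> borel_measurable borel"
    using V by (auto simp: bounded_fn_def)
  have [measurable]: "g \<in> borel_measurable borel"
    by (rule is_density_measurable[OF g])
  have i: "integrable M (\<lambda>x. indicator S x * norm (g x))"
    using integrable_norm[OF is_density_integrable[OF g S, unfolded set_integrable_def]] by simp
  have le: "norm (V x \<bullet> g x) \<le> C * (indicator S x * norm (g x))" if C: "\<And>x. norm (V x) \<le> C" for C x
  proof (cases "x \<in> S")
    case True
    have "norm (V x \<bullet> g x) \<le> norm (V x) * norm (g x)"
      using Cauchy_Schwarz_ineq2[of "V x" "g x"] by simp
    also have "\<dots> \<le> C * norm (g x)"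
      by (intro mult_right_mono C) auto
    finally show ?thesis using True by simp
  qed (simp add: V0)
  obtain C where C: "\<And>x. norm (V x) \<le> C"
    using bounded_fn_bound[OF V] by blast
  have i2: "integrable M (\<lambda>x. C * (indicator S x * norm (g x)))" for C
    using i by (rule integrable_mult_right)
  have "norm (V x \<bullet> g x) \<le> norm (C * (indicator S x * norm (g x)))" for x
    using le[OF C, of x] by (rule order_trans) simp
  then show iV: "integrable M (\<lambda>x. V x \<bullet> g x)"
    by (intro Bochner_Integration.integrable_bound[OF i2[of C]]) auto
  show "\<bar>\<integral>x. V x \<bullet> g x \<partial>M\<bar> \<le> C * (\<integral>x. indicator S x * norm (g x) \<partial>M)" if C: "\<And>x. norm (V x) \<le> C" for C
  proof -
    have "\<bar>\<integral>x. V x \<bullet> g x \<partial>M\<bar> \<le> (\<integral>x. norm (V x \<bullet> g x) \<partial>M)"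
      using integral_norm_bound[of M "\<lambda>x. V x \<bullet> g x"] by simp
    also have "\<dots> \<le> (\<integral>x. C * (indicator S x * norm (g x)) \<partial>M)"
      using iV i2 le[OF C] by (intro integral_mono) auto
    finally show ?thesis by simp
  qed
qed

text \<open>The right side mentions neither M nor g: for a function with finitely many values, the
  integral depends on the set function alone. The value 0 is left out since its level set is
  unbounded.\<close>

lemma simple_bounded_fn_integral:
  assumes M: "nonneg_radon M" and g: "is_density M g m" and W: "bounded_fn S W" and fin: "finite (range W)"
  shows "(\<integral>x. W x \<bullet> g x \<partial>M) = (\<Sum>c\<in>range W - {0}. c \<bullet> rmeas m (W -` {c}))"
proof -
  have [measurable]: "W \<in> borel_measurable borel" and S: "bounded_borel S" "\<And>x. x \<notin> S \<Longrightarrow> W x = 0"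
    using W by (auto simp: bounded_fn_def)
  have bb: "bounded_borel (W -` {c})" if "c \<noteq> 0" for c
  proof (rule bounded_borel_subset[OF S(1)])
    show "W -` {c} \<in> sets borel"
      using measurable_sets[of W borel borel "{c}"] by simp
    show "W -` {c} \<subseteq> S" using S(2) that by auto
  qed
  have eq: "W x \<bullet> g x = (\<Sum>c\<in>range W - {0}. c \<bullet> (indicator (W -` {c}) x *\<^sub>R g x))" for x
  proof (cases "W x = 0")
    case False
    then have "(\<Sum>c\<in>range W - {0}. c \<bullet> (indicator (W -` {c}) x *\<^sub>R g x)) = (\<Sum>c\<in>{W x}. c \<bullet> (indicator (W -` {c}) x *\<^sub>R g x))"
      using fin by (intro sum.mono_neutral_right) (auto simp: indicator_def)
    then show ?thesis by simp
  qed (auto simp: indicator_def intro!: sum.neutral)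
  have i: "integrable M (\<lambda>x. indicator (W -` {c}) x *\<^sub>R g x)" if "c \<noteq> 0" for c
    using is_density_integrable[OF g bb[OF that]] by (simp add: set_integrable_def)
  have "(\<integral>x. W x \<bullet> g x \<partial>M) = (\<Sum>c\<in>range W - {0}. \<integral>x. c \<bullet> (indicator (W -` {c}) x *\<^sub>R g x) \<partial>M)"
    unfolding eq using i by (intro Bochner_Integration.integral_sum integrable_inner_right) auto
  also have "\<dots> = (\<Sum>c\<in>range W - {0}. c \<bullet> rmeas m (W -` {c}))"
  proof (rule sum.cong)
    fix c assume "c \<in> range W - {0}"
    then have "c \<noteq> 0" by auto
    then show "(\<integral>x. c \<bullet> (indicator (W -` {c}) x *\<^sub>R g x) \<partial>M) = c \<bullet> rmeas m (W -` {c})"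
      using integral_inner_right[OF i] is_density_eq[OF g bb] by (simp add: set_lebesgue_integral_def del: inner_scaleR_right)
  qed simp
  finally show ?thesis .
qed

lemma simple_bounded_fn_approx:
  fixes V :: "'a::euclidean_space \<Rightarrow> 'b::euclidean_space"
  assumes V: "bounded_fn S V" and e: "0 < e"
  obtains W where "bounded_fn S W" "finite (range W)" "\<And>x. norm (V x - W x) \<le> e"
proof -
  define d where "d = e / DIM('b)"
  have d: "0 < d" using e by (simp add: d_def)
  obtain C where C: "0 < C" "\<And>x. norm (V x) \<le> C"
    using bounded_fn_bound[OF V] by blast
  \<comment> \<open>Rounding down to a grid of mesh d, applied to each coordinate. Since r fixes 0,
    the rounded function vanishes wherever V does.\<close>
  define r where "r y = d * of_int \<lfloor>y / d\<rfloor>" for y :: real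
  have r: "\<bar>y - r y\<bar> \<le> d" for y
  proof -
    have "r y \<le> y" "y \<le> r y + d"
      using floor_divide_lower[OF d, of y] floor_divide_upper[OF d, of y]
      by (auto simp: r_def algebra_simps)
    then show ?thesis by linarith
  qed
  have r_fin: "finite (r ` {-C..C})"
  proof -
    have "r ` {-C..C} \<subseteq> (\<lambda>k. d * of_int k) ` {\<lfloor>-C / d\<rfloor>..\<lfloor>C / d\<rfloor>}"
    proof
      fix z assume "z \<in> r ` {-C..C}"
      then obtain y where y: "z = r y" "-C \<le> y" "y \<le> C" by auto
      then have "-C / d \<le> y / d" "y / d \<le> C / d"
        using d by (intro divide_right_mono; simp)+
      then have "\<lfloor>y / d\<rfloor> \<in> {\<lfloor>-C / d\<rfloor>..\<lfloor>C / d\<rfloor>}"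
        by (auto intro: floor_mono)
      then show "z \<in> (\<lambda>k. d * of_int k) ` {\<lfloor>-C / d\<rfloor>..\<lfloor>C / d\<rfloor>}"
        using y by (auto simp: r_def)
    qed
    then show ?thesis
      by (rule finite_subset) auto
  qed
  define W where "W x = (\<Sum>b\<in>Basis. r (V x \<bullet> b) *\<^sub>R b)" for x
  have Wb: "W x \<bullet> b = r (V x \<bullet> b)" if "b \<in> Basis" for x b
    using that by (simp add: W_def)
  have near: "norm (V x - W x) \<le> e" for x
  proof -
    have "norm (V x - W x) \<le> (\<Sum>b\<in>Basis. \<bar>(V x - W x) \<bullet> b\<bar>)"
      by (rule norm_le_l1)
    also have "\<dots> \<le> (\<Sum>b\<in>(Basis::'b set). d)"
      using r by (intro sum_mono) (auto simp: inner_diff_left Wb)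
    also have "\<dots> = e" by (simp add: d_def)
    finally show ?thesis .
  qed
  have "range W \<subseteq> (\<lambda>f. \<Sum>b\<in>Basis. f b *\<^sub>R b) ` (Basis \<rightarrow>\<^sub>E r ` {-C..C})"
  proof
    fix z assume "z \<in> range W"
    then obtain x where z: "z = W x" by auto
    have "\<bar>V x \<bullet> b\<bar> \<le> C" if "b \<in> Basis" for b
      using Basis_le_norm[OF that, of "V x"] C(2)[of x] by linarith
    then have "(\<lambda>b\<in>Basis. r (V x \<bullet> b)) \<in> Basis \<rightarrow>\<^sub>E r ` {-C..C}"
      by (force simp: abs_le_iff)
    moreover have "z = (\<Sum>b\<in>Basis. (\<lambda>b\<in>Basis. r (V x \<bullet> b)) b *\<^sub>R b)"
      unfolding z W_def by (intro sum.cong) auto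
    ultimately show "z \<in> (\<lambda>f. \<Sum>b\<in>Basis. f b *\<^sub>R b) ` (Basis \<rightarrow>\<^sub>E r ` {-C..C})"
      by blast
  qed
  then have fin: "finite (range W)"
    by (rule finite_subset) (intro finite_imageI finite_PiE r_fin finite_Basis)
  have "bounded_fn S W"
  proof (rule bounded_fnI[where C = "C + e"])
    have [measurable]: "V \<in> borel_measurable borel" using V by (simp add: bounded_fn_def)
    show "W \<in> borel_measurable borel"
      unfolding W_def r_def by measurable
    show "norm (W x) \<le> C + e" for x
      using norm_triangle_sub[of "W x" "V x"] near[of x] C(2)[of x] by (simp add: norm_minus_commute)
    show "W x = 0" if "x \<notin> S" for x
      using V that by (simp add: bounded_fn_def W_def r_def)
  qed (use V in \<open>simp add: bounded_fn_def\<close>)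
  then show thesis using that fin near by blast
qed

text \<open>For functions with finitely many values both sides reduce to the same finite sum;
  uniform approximation by such functions carries this over to V.\<close>

lemma bounded_fn_integral_eq:
  assumes M: "nonneg_radon M" and g: "is_density M g m" and M': "nonneg_radon M'" and g': "is_density M' g' m"
    and V: "bounded_fn S V"
  shows "(\<integral>x. V x \<bullet> g x \<partial>M) = (\<integral>x. V x \<bullet> g' x \<partial>M')"
proof -
  define D where "D = (\<integral>x. indicator S x * norm (g x) \<partial>M) + (\<integral>x. indicator S x * norm (g' x) \<partial>M')"
  have "\<bar>(\<integral>x. V x \<bullet> g x \<partial>M) - (\<integral>x. V x \<bullet> g' x \<partial>M')\<bar> \<le> e * D" if "0 < e" for e
  proof -
    obtain W where W: "bounded_fn S W" "finite (range W)" "\<And>x. norm (V x - W x) \<le> e"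
      using simple_bounded_fn_approx[OF V \<open>0 < e\<close>] by blast
    have VW: "bounded_fn S (\<lambda>x. V x - W x)"
      using V W(1) by (rule bounded_fn_diff)
    have 1: "(\<integral>x. (V x - W x) \<bullet> g x \<partial>M) = (\<integral>x. V x \<bullet> g x \<partial>M) - (\<integral>x. W x \<bullet> g x \<partial>M)"
      using bounded_fn_integrable(1)[OF M g] V W(1) by (simp add: inner_diff_left)
    have 2: "(\<integral>x. (V x - W x) \<bullet> g' x \<partial>M') = (\<integral>x. V x \<bullet> g' x \<partial>M') - (\<integral>x. W x \<bullet> g' x \<partial>M')"
      using bounded_fn_integrable(1)[OF M' g'] V W(1) by (simp add: inner_diff_left)
    have 3: "(\<integral>x. W x \<bullet> g x \<partial>M) = (\<integral>x. W x \<bullet> g' x \<partial>M')"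
      using simple_bounded_fn_integral[OF M g W(1,2)] simple_bounded_fn_integral[OF M' g' W(1,2)] by simp
    show ?thesis
      using bounded_fn_integrable(2)[OF M g VW W(3)] bounded_fn_integrable(2)[OF M' g' VW W(3)]
      unfolding 1 2 3 D_def by (simp add: algebra_simps abs_le_iff)
  qed
  note * = this
  have D0: "0 \<le> D"
    unfolding D_def by (intro add_nonneg_nonneg Bochner_Integration.integral_nonneg) auto
  have "\<bar>(\<integral>x. V x \<bullet> g x \<partial>M) - (\<integral>x. V x \<bullet> g' x \<partial>M')\<bar> \<le> 0"
  proof (rule field_le_epsilon)
    fix e :: real assume "0 < e"
    \<comment> \<open>The summand 1 covers the case D = 0.\<close>
    then have "0 < e / (D + 1)" using D0 by simp
    from *[OF this] have "\<bar>(\<integral>x. V x \<bullet> g x \<partial>M) - (\<integral>x. V x \<bullet> g' x \<partial>M')\<bar> \<le> e / (D + 1) * D" .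
    also have "\<dots> \<le> e"
      using D0 \<open>0 < e\<close> by (simp add: field_simps)
    finally show "\<bar>(\<integral>x. V x \<bullet> g x \<partial>M) - (\<integral>x. V x \<bullet> g' x \<partial>M')\<bar> \<le> 0 + e" by simp
  qed
  then show ?thesis by simp
qed

section \<open>Polar densities and the integral against a Radon measure\<close>

lemma density_wrt_is_density:
  assumes "is_density M g m"
  shows "is_density M (density_wrt M m) m"
  unfolding density_wrt_def using someI[of "\<lambda>g. is_density M g m", OF assms] .

text \<open>A set function is dominated by its own total variation with constant 1, which yields a
  density. The crude bound on its norm suffices for all estimates below.\<close>

lemma polar_density:
  fixes m :: "('a::euclidean_space, 'b::euclidean_space) radon"
  shows "is_density (total_variation m) (density_wrt (total_variation m) m) m"
    and "AE x in total_variation m. norm (density_wrt (total_variation m) m x) \<le> DIM('b)"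
proof -
  note M = nonneg_radon_total_variation[of m]
  obtain g where "is_density (total_variation m) g m"
    by (rule ex_bounded_density[OF M, of 1 m]) (auto intro: norm_rmeas_le)
  then show d: "is_density (total_variation m) (density_wrt (total_variation m) m) m"
    by (rule density_wrt_is_density)
  show "AE x in total_variation m. norm (density_wrt (total_variation m) m x) \<le> DIM('b)"
    using is_density_bound[OF M, of 1 m, OF _ _ d] norm_rmeas_le[of _ m] by simp
qed

text \<open>Replaces the total variation by any convenient reference measure; in the applications
  this is mostly \<gamma>, with the densities that occur in the action.\<close>

lemma radon_integral_density:
  assumes "nonneg_radon M" "is_density M g m" "bounded_fn S V"
  shows "radon_integral m V = (\<integral>x. V x \<bullet> g x \<partial>M)"
  unfolding radon_integral_def
  by (rule bounded_fn_integral_eq[OF nonneg_radon_total_variation polar_density(1) assms])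

lemma radon_integral_simple:
  assumes "bounded_fn S W" "finite (range W)"
  shows "radon_integral m W = (\<Sum>c\<in>range W - {0}. c \<bullet> rmeas m (W -` {c}))"
  unfolding radon_integral_def
  by (rule simple_bounded_fn_integral[OF nonneg_radon_total_variation polar_density(1) assms])

lemma radon_integral_zero [simp]: "radon_integral m (\<lambda>x. 0) = 0"
  by (simp add: radon_integral_def)

lemma radon_integral_add:
  "bounded_fn S V \<Longrightarrow> bounded_fn S W \<Longrightarrow> radon_integral m (\<lambda>x. V x + W x) = radon_integral m V + radon_integral m W"
  unfolding radon_integral_def
  by (simp add: inner_add_left bounded_fn_integrable(1)[OF nonneg_radon_total_variation polar_density(1)])

lemma radon_integral_scaleR: "radon_integral m (\<lambda>x. c *\<^sub>R V x) = c * radon_integral m V"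
  by (simp add: radon_integral_def)

lemma radon_integral_diff:
  "bounded_fn S V \<Longrightarrow> bounded_fn S W \<Longrightarrow> radon_integral m (\<lambda>x. V x - W x) = radon_integral m V - radon_integral m W"
  unfolding radon_integral_def
  by (simp add: inner_diff_left bounded_fn_integrable(1)[OF nonneg_radon_total_variation polar_density(1)])

lemma radon_integral_bound:
  fixes m :: "('a::euclidean_space, 'b::euclidean_space) radon"
  assumes V: "bounded_fn S V" and C: "\<And>x. norm (V x) \<le> C"
  shows "\<bar>radon_integral m V\<bar> \<le> C * (DIM('b) * measure (total_variation m) S)"
proof -
  let ?M = "total_variation m" and ?g = "density_wrt (total_variation m) m"
  note M = nonneg_radon_total_variation[of m]
  have S: "bounded_borel S" using V by (simp add: bounded_fn_def)
  have C0: "0 \<le> C" using order_trans[OF norm_ge_zero C] .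
  have i: "integrable ?M (\<lambda>x. indicator S x * norm (?g x))"
    using integrable_norm[OF is_density_integrable[OF polar_density(1) S, unfolded set_integrable_def]] by simp
  have Sf: "S \<in> sets ?M" "emeasure ?M S < \<infinity>"
    using S nonneg_radon_finite[OF M] by (auto simp: bounded_borel_def)
  have "(\<integral>x. indicator S x * norm (?g x) \<partial>?M) \<le> (\<integral>x. real DIM('b) * indicator S x \<partial>?M)"
  proof (rule integral_mono_AE[OF i])
    show "integrable ?M (\<lambda>x. real DIM('b) * indicator S x)"
      using Sf by (intro integrable_mult_right) (simp add: integrable_indicator_iff)
    show "AE x in ?M. indicator S x * norm (?g x) \<le> real DIM('b) * indicator S x"
      using polar_density(2)[of m] by eventually_elim (auto simp: indicator_def)
  qed
  also have "\<dots> = DIM('b) * measure ?M S"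
    using Sf by simp
  finally show ?thesis
    unfolding radon_integral_def
    using bounded_fn_integrable(2)[OF M polar_density(1) V C] C0
    by (meson mult_left_mono order_trans)
qed

text \<open>The polar density is chosen separately for each parameter, so nothing is known about its
  dependence on the parameter. Approximating V by finite-valued functions leaves finite sums of the
  measurable values \<open>rmeas (m t) B\<close>, which converge pointwise in t.\<close>

lemma radon_integral_measurable:
  fixes m :: "'c \<Rightarrow> ('a::euclidean_space, 'b::euclidean_space) radon"
  assumes m: "\<And>B. bounded_borel B \<Longrightarrow> (\<lambda>t. rmeas (m t) B) \<in> borel_measurable N"
    and V: "bounded_fn S V"
  shows "(\<lambda>t. radon_integral (m t) V) \<in> borel_measurable N"
proof -
  have "\<exists>W. bounded_fn S W \<and> finite (range W) \<and> (\<forall>x. norm (V x - W x) \<le> inverse (real (Suc n)))" for n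
    using simple_bounded_fn_approx[OF V, of "inverse (real (Suc n))"] by auto
  then obtain W where W: "\<And>n. bounded_fn S (W n)" "\<And>n. finite (range (W n))"
    "\<And>n x. norm (V x - W n x) \<le> inverse (real (Suc n))"
    by metis
  show ?thesis
  proof (rule borel_measurable_LIMSEQ_real)
    fix n
    have bb: "bounded_borel (W n -` {c})" if "c \<noteq> 0" for c
    proof (rule bounded_borel_subset)
      show "bounded_borel S" using V by (simp add: bounded_fn_def)
      show "W n -` {c} \<in> sets borel"
        using measurable_sets[of "W n" borel borel "{c}"] W(1)[of n] by (simp add: bounded_fn_def)
      show "W n -` {c} \<subseteq> S" using W(1)[of n] that by (auto simp: bounded_fn_def)
    qed
    show "(\<lambda>t. radon_integral (m t) (W n)) \<in> borel_measurable N"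
      unfolding radon_integral_simple[OF W(1,2)]
      using m bb by (intro borel_measurable_sum borel_measurable_inner) auto
  next
    fix t
    let ?D = "DIM('b) * measure (total_variation (m t)) S"
    show "(\<lambda>n. radon_integral (m t) (W n)) \<longlonglongrightarrow> radon_integral (m t) V"
    proof (rule Lim_transform2)
      show "(\<lambda>n. radon_integral (m t) V) \<longlonglongrightarrow> radon_integral (m t) V" by simp
      show "(\<lambda>n. radon_integral (m t) V - radon_integral (m t) (W n)) \<longlonglongrightarrow> 0"
      proof (rule Lim_null_comparison)
        show "\<forall>\<^sub>F n in sequentially. norm (radon_integral (m t) V - radon_integral (m t) (W n)) \<le> inverse (real (Suc n)) * ?D"
          using radon_integral_bound[OF bounded_fn_diff[OF V W(1)] W(3), of "m t"]
          by (intro always_eventually allI) (simp add: radon_integral_diff[OF V W(1)])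
        show "(\<lambda>n. inverse (real (Suc n)) * ?D) \<longlonglongrightarrow> 0"
          by (rule tendsto_mult_left_zero[OF LIMSEQ_inverse_real_of_nat])
      qed
    qed
  qed
qed

section \<open>Constructions on Radon measures\<close>

lemma rmeas_Abs_radon:
  assumes "\<And>B. \<not> bounded_borel B \<Longrightarrow> f B = 0"
    and "\<And>A :: nat \<Rightarrow> 'a::euclidean_space set. (\<And>i. bounded_borel (A i)) \<Longrightarrow> disjoint_family A \<Longrightarrow>
      bounded_borel (\<Union>i. A i) \<Longrightarrow> (\<lambda>i. f (A i)) sums f (\<Union>i. A i)"
  shows "rmeas (Abs_radon f) = f"
proof (rule Abs_radon_inverse, intro CollectI conjI allI impI)
  fix A :: "nat \<Rightarrow> 'a set"
  assume A: "range A \<subseteq> sets borel" "disjoint_family A" "bounded (\<Union>i. A i)"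
  show "(\<lambda>i. f (A i)) sums f (\<Union>i. A i)"
  proof (rule assms(2))
    show U: "bounded_borel (\<Union>i. A i)"
      using A by (auto simp: bounded_borel_def)
    show "bounded_borel (A i)" for i
      using A(1) by (intro bounded_borel_subset[OF U]) auto
  qed fact
qed (use assms in auto)

lemma rmeas_sums_bounded_borel:
  fixes A :: "nat \<Rightarrow> 'a::euclidean_space set"
  assumes "\<And>i. bounded_borel (A i)" "disjoint_family A" "bounded_borel (\<Union>i. A i)"
  shows "(\<lambda>i. rmeas m (A i)) sums rmeas m (\<Union>i. A i)"
  using assms by (intro rmeas_sums) (auto simp: bounded_borel_def)

definition scale_radon :: "real \<Rightarrow> ('a::euclidean_space, 'b::euclidean_space) radon \<Rightarrow> ('a, 'b) radon" where
  "scale_radon c m = Abs_radon (\<lambda>B. c *\<^sub>R rmeas m B)"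

lemma rmeas_scale_radon [simp]: "rmeas (scale_radon c m) B = c *\<^sub>R rmeas m B"
  unfolding scale_radon_def
  by (subst rmeas_Abs_radon) (auto simp: rmeas_outside intro!: sums_scaleR_right rmeas_sums_bounded_borel)

text \<open>For unbounded B the set B \<inter> N may be bounded with a nonzero value; the case
  distinction keeps the normalisation of the type.\<close>

definition restrict_radon :: "('a::euclidean_space, 'b::euclidean_space) radon \<Rightarrow> 'a set \<Rightarrow> ('a, 'b) radon" where
  "restrict_radon m N = Abs_radon (\<lambda>B. if bounded_borel B then rmeas m (B \<inter> N) else 0)"

lemma rmeas_restrict_radon:
  assumes "N \<in> sets borel" "bounded_borel B"
  shows "rmeas (restrict_radon m N) B = rmeas m (B \<inter> N)"
  unfolding restrict_radon_def
proof (subst rmeas_Abs_radon)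
  fix A :: "nat \<Rightarrow> 'a set"
  assume A: "\<And>i. bounded_borel (A i)" "disjoint_family A" "bounded_borel (\<Union>i. A i)"
  have "(\<lambda>i. rmeas m (A i \<inter> N)) sums rmeas m (\<Union>i. A i \<inter> N)"
  proof (rule rmeas_sums_bounded_borel)
    show "bounded_borel (\<Union>i. A i \<inter> N)"
      using bounded_borel_Int[OF A(3) assms(1)] by simp
  qed (use A assms in \<open>auto simp: disjoint_family_on_def intro: bounded_borel_Int\<close>)
  then show "(\<lambda>i. if bounded_borel (A i) then rmeas m (A i \<inter> N) else 0) sums
      (if bounded_borel (\<Union>i. A i) then rmeas m ((\<Union>i. A i) \<inter> N) else 0)"
    using A by simp
qed (use assms in auto)

lemma total_variation_scale_radon_le:
  assumes "B \<in> sets borel"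
  shows "emeasure (total_variation (scale_radon c m)) B \<le> ennreal \<bar>c\<bar> * emeasure (total_variation m) B"
  using assms
  by (intro total_variation_le nonneg_radon_total_variation) (auto intro!: mult_left_mono norm_rmeas_le)

lemma is_density_scale_radon:
  "is_density M g m \<Longrightarrow> is_density M (\<lambda>x. c *\<^sub>R g x) (scale_radon c m)"
  by (rule is_density_scaleR) auto

lemma radon_integral_scale_radon:
  assumes "bounded_fn S V"
  shows "radon_integral (scale_radon c m) V = c * radon_integral m V"
  unfolding radon_integral_density[OF nonneg_radon_total_variation is_density_scale_radon[OF polar_density(1)] assms]
  by (simp add: radon_integral_def)

lemma sets_measure_sum [simp, measurable_cong]: "sets (measure_sum M N) = sets borel"
  unfolding measure_sum_def using sets.sigma_sets_eq[of borel] by (simp add: sets_measure_of_conv)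

lemma space_measure_sum [simp]: "space (measure_sum M N) = UNIV"
  using sets_eq_imp_space_eq[OF sets_measure_sum] by simp

lemma emeasure_measure_sum:
  assumes s: "sets M = sets borel" "sets N = sets borel" and B: "B \<in> sets borel"
  shows "emeasure (measure_sum M N) B = emeasure M B + emeasure N B"
proof (rule emeasure_measure_of[OF measure_sum_def])
  show "countably_additive (sets (measure_sum M N)) (\<lambda>B. emeasure M B + emeasure N B)"
  proof (rule countably_additiveI)
    fix A :: "nat \<Rightarrow> 'a set" assume A: "range A \<subseteq> sets (measure_sum M N)" "disjoint_family A"
    have "(\<Sum>i. emeasure M (A i) + emeasure N (A i)) = (\<Sum>i. emeasure M (A i)) + (\<Sum>i. emeasure N (A i))"
      by (intro suminf_add[symmetric]) auto
    then show "(\<Sum>i. emeasure M (A i) + emeasure N (A i)) = emeasure M (\<Union>i. A i) + emeasure N (\<Union>i. A i)"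
      using A s by (simp add: suminf_emeasure)
  qed
qed (use B in \<open>auto simp: positive_def\<close>)

lemma nonneg_radon_measure_sum:
  assumes "nonneg_radon M" "nonneg_radon N"
  shows "nonneg_radon (measure_sum M N)"
  using assms unfolding nonneg_radon_def
  by (auto simp: emeasure_measure_sum borel_compact)

lemma measure_measure_sum:
  assumes "nonneg_radon M" "nonneg_radon N" "bounded_borel B"
  shows "measure (measure_sum M N) B = measure M B + measure N B"
proof -
  have "emeasure M B < \<infinity>" "emeasure N B < \<infinity>"
    using assms by (auto intro!: nonneg_radon_finite simp: bounded_borel_def simp del: infinity_ennreal_def)
  then show ?thesis
    using assms by (simp add: measure_def emeasure_measure_sum nonneg_radon_sets bounded_borel_def enn2real_plus)
qed

section \<open>Lebesgue decomposition\<close>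

text \<open>Both measures are written against the sum M of \<gamma> and the total variation of m,
  say \<gamma> = h M and m = g M. Where h vanishes lies the singular part; elsewhere the quotient of
  g by h is the density.\<close>

lemma ex_lebesgue_decomposition:
  fixes m :: "('a::euclidean_space, 'b::euclidean_space) radon"
  assumes \<gamma>: "nonneg_radon \<gamma>"
  obtains d where "is_lebesgue_decomposition \<gamma> m d"
proof -
  define M where "M = measure_sum \<gamma> (total_variation m)"
  have M: "nonneg_radon M"
    unfolding M_def by (intro nonneg_radon_measure_sum \<gamma> nonneg_radon_total_variation)
  interpret M: sigma_finite_measure M by (rule nonneg_radon_sigma_finite[OF M])
  have sM[measurable_cong]: "sets M = sets borel" by (simp add: M_def)
  have "absolutely_continuous M \<gamma>"
    unfolding absolutely_continuous_def
    by (auto simp: null_sets_def M_def emeasure_measure_sum nonneg_radon_sets[OF \<gamma>])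
  then obtain f where f[measurable]: "f \<in> borel_measurable M" and \<gamma>f: "density M f = \<gamma>"
    using M.Radon_Nikodym[of \<gamma>] nonneg_radon_sets[OF \<gamma>] sM by auto
  have "AE x in M. f x \<noteq> \<infinity>"
    using M.sigma_finite_iff_density_finite[OF f] nonneg_radon_sigma_finite[OF \<gamma>] \<gamma>f by simp
  define h where "h x = enn2real (f x)" for x
  have h[measurable]: "h \<in> borel_measurable M" unfolding h_def by measurable
  have h': "h \<in> borel_measurable borel"
    using h sM measurable_cong_sets by blast
  have "AE x in M. f x = ennreal (h x)"
    using \<open>AE x in M. f x \<noteq> \<infinity>\<close> by eventually_elim (auto simp: h_def ennreal_enn2real_if)
  then have \<gamma>h: "\<gamma> = density M (\<lambda>x. ennreal (h x))"
    unfolding \<gamma>f[symmetric] by (intro density_cong) auto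
  have h0: "0 \<le> h x" for x by (simp add: h_def)
  have le: "norm (rmeas m B) \<le> 1 * measure M B" if "bounded_borel B" for B
    using norm_rmeas_le[OF that, of m] measure_nonneg[of \<gamma> B]
    unfolding M_def measure_measure_sum[OF \<gamma> nonneg_radon_total_variation that]
    by (simp add: add_increasing)
  obtain g where g: "is_density M g m"
    by (rule ex_bounded_density[OF M _ le]) auto
  note [measurable] = is_density_measurable[OF g]
  define N where "N = {x. h x = 0}"
  have N: "N \<in> sets borel"
    unfolding N_def using h' by measurable
  define \<rho> where "\<rho> x = (if h x = 0 then 0 else (1 / h x) *\<^sub>R g x)" for x
  have \<rho>: "\<rho> \<in> borel_measurable borel"
    unfolding \<rho>_def using h' by measurable
  define s where "s = restrict_radon m N"
  have "is_lebesgue_decomposition \<gamma> m (\<rho>, s)"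
    unfolding is_lebesgue_decomposition_def prod.case
  proof (intro conjI allI impI)
    show "mutually_singular \<gamma> (total_variation s)"
      unfolding mutually_singular_def
    proof (intro bexI[OF _ N] conjI)
      have "emeasure \<gamma> N = (\<integral>\<^sup>+x. ennreal (h x) * indicator N x \<partial>M)"
        unfolding \<gamma>h using N sM by (subst emeasure_density) auto
      also have "\<dots> = (\<integral>\<^sup>+x. 0 \<partial>M)"
        by (intro nn_integral_cong) (auto simp: N_def indicator_def)
      finally show "emeasure \<gamma> N = 0" by simp
      have "(\<Sum>A\<in>P. ennreal (norm (rmeas s A))) = 0" if "P \<in> subpartitions (- N)" for P
      proof (rule sum.neutral, rule ballI)
        fix A assume "A \<in> P"
        then have A: "bounded_borel A" "A \<inter> N = {}"
          using that by (auto simp: subpartitions_def)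
        then show "ennreal (norm (rmeas s A)) = 0"
          by (simp add: s_def rmeas_restrict_radon[OF N])
      qed
      then have "variation s (- N) = 0"
        unfolding variation_def by (intro antisym SUP_least) auto
      then show "emeasure (total_variation s) (- N) = 0"
        using N by (subst emeasure_total_variation) auto
    qed
    fix B :: "'a set" assume B: "bounded_borel B"
    then have Bb[measurable]: "B \<in> sets borel" by (simp add: bounded_borel_def)
    have BN: "bounded_borel (B - N)" using B N by (rule bounded_borel_Diff)
    have eq: "h x *\<^sub>R (indicator B x *\<^sub>R \<rho> x) = indicator (B - N) x *\<^sub>R g x" for x
      by (auto simp: \<rho>_def N_def indicator_def)
    have meas: "(\<lambda>x. indicator B x *\<^sub>R \<rho> x) \<in> borel_measurable M"
      using \<rho> by measurable
    have "integrable M (\<lambda>x. h x *\<^sub>R (indicator B x *\<^sub>R \<rho> x))"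
      unfolding eq using is_density_integrable[OF g BN] by (simp add: set_integrable_def)
    then show "set_integrable \<gamma> B \<rho>"
      unfolding set_integrable_def \<gamma>h using meas h0 by (subst integrable_density) auto
    have "set_lebesgue_integral \<gamma> B \<rho> = (\<integral>x. h x *\<^sub>R (indicator B x *\<^sub>R \<rho> x) \<partial>M)"
      unfolding set_lebesgue_integral_def \<gamma>h using meas h0 by (subst integral_density) auto
    also have "\<dots> = rmeas m (B - N)"
      unfolding eq using is_density_eq[OF g BN] by (simp add: set_lebesgue_integral_def)
    finally show "rmeas m B = set_lebesgue_integral \<gamma> B \<rho> + rmeas s B"
      using rmeas_Diff[OF B N, of m] by (simp add: s_def rmeas_restrict_radon[OF N B])
  qed (rule \<rho>)
  then show thesis by (rule that)
qed

lemma chosen_lebesgue_decomposition: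
  assumes "nonneg_radon \<gamma>"
  shows "is_lebesgue_decomposition \<gamma> m (ac_density \<gamma> m, singular_part \<gamma> m)"
proof -
  obtain d where "is_lebesgue_decomposition \<gamma> m d"
    using ex_lebesgue_decomposition[OF assms] .
  then have "is_lebesgue_decomposition \<gamma> m (SOME d. is_lebesgue_decomposition \<gamma> m d)"
    by (rule someI)
  then show ?thesis
    unfolding ac_density_def singular_part_def by simp
qed

lemma set_integral_null:
  fixes f :: "'a::euclidean_space \<Rightarrow> 'b::euclidean_space"
  assumes "sets M = sets borel" "f \<in> borel_measurable borel" "B \<in> null_sets M"
  shows "set_lebesgue_integral M B f = 0"
proof -
  have [measurable]: "B \<in> sets M" using assms(3) by auto
  have [measurable]: "f \<in> borel_measurable M" using assms(1,2) measurable_cong_sets by blast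
  have "AE x in M. indicator B x *\<^sub>R f x = 0"
    using AE_not_in[OF assms(3)] by eventually_elim simp
  then have "(\<integral>x. indicator B x *\<^sub>R f x \<partial>M) = (\<integral>x. 0 \<partial>M)"
    by (intro integral_cong_AE) auto
  then show ?thesis
    by (simp add: set_lebesgue_integral_def)
qed

lemma is_density_null:
  assumes "sets M = sets borel" "is_density M g m" "B \<in> null_sets M"
  shows "rmeas m B = 0"
proof (cases "bounded_borel B")
  case True
  then show ?thesis
    using is_density_eq[OF assms(2) True] set_integral_null[OF assms(1) is_density_measurable[OF assms(2)] assms(3)]
    by simp
qed (rule rmeas_outside)

text \<open>Let N be \<gamma>-null and carry s. On N both m and the absolutely continuous part
  vanish, so s does; off N it vanishes by singularity. Whatever decomposition \<open>SOME\<close>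
  picks, an m with a density thus has no singular part.\<close>

lemma singular_part_zero:
  assumes \<gamma>: "nonneg_radon \<gamma>" and d: "is_lebesgue_decomposition \<gamma> m (g, s)" and h: "is_density \<gamma> h m"
  shows "rmeas s B = 0" and "is_density \<gamma> g m"
proof -
  note s = nonneg_radon_sets[OF \<gamma>]
  have g: "g \<in> borel_measurable borel"
    and dec: "\<And>B. bounded_borel B \<Longrightarrow> set_integrable \<gamma> B g \<and> rmeas m B = set_lebesgue_integral \<gamma> B g + rmeas s B"
    using d by (auto simp: is_lebesgue_decomposition_def)
  obtain N where N: "N \<in> sets borel" "emeasure \<gamma> N = 0" "emeasure (total_variation s) (- N) = 0"
    using d by (auto simp: is_lebesgue_decomposition_def mutually_singular_def)
  have zero: "rmeas s B = 0" for B
  proof (cases "bounded_borel B")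
    case B: True
    have BN: "bounded_borel (B \<inter> N)" using B N(1) by (rule bounded_borel_Int)
    have "B \<inter> N \<in> null_sets \<gamma>"
      using B N s by (intro null_set_Int1) (auto simp: null_sets_def bounded_borel_def)
    then have "rmeas m (B \<inter> N) = 0" "set_lebesgue_integral \<gamma> (B \<inter> N) g = 0"
      using is_density_null[OF s h] set_integral_null[OF s g] by auto
    then have "rmeas s (B \<inter> N) = 0"
      using dec[OF BN] by simp
    moreover have "rmeas s (B - N) = 0"
    proof -
      have "emeasure (total_variation s) (B - N) \<le> emeasure (total_variation s) (- N)"
        using N(1) by (intro emeasure_mono) auto
      then have "measure (total_variation s) (B - N) = 0"
        using N(3) by (simp add: measure_def)
      then show ?thesis
        using norm_rmeas_le[OF bounded_borel_Diff[OF B N(1)], of s] by simp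
    qed
    ultimately show ?thesis
      using rmeas_Diff[OF B N(1), of s] by simp
  qed (rule rmeas_outside)
  then show "rmeas s B = 0" .
  show "is_density \<gamma> g m"
    unfolding is_density_def using g dec zero by auto
qed

lemma total_variation_zero:
  assumes "\<And>B. rmeas m B = 0" "B \<in> sets borel"
  shows "emeasure (total_variation m) B = 0"
  unfolding emeasure_total_variation[OF assms(2)] variation_def
  by (intro antisym SUP_least) (auto simp: assms(1))

text \<open>An open set that is null for \<gamma> is null for m. This discharges the support
  condition in \<open>action\<close>.\<close>

lemma msupport_density:
  assumes \<gamma>: "nonneg_radon \<gamma>" and h: "is_density \<gamma> h m"
  shows "msupport (total_variation m) \<subseteq> msupport \<gamma>"
proof (rule subsetI, rule ccontr)
  fix x assume x: "x \<in> msupport (total_variation m)" "x \<notin> msupport \<gamma>"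
  then obtain U where U: "open U" "x \<in> U" "emeasure \<gamma> U = 0"
    by (auto simp: msupport_def zero_less_iff_neq_zero)
  note s = nonneg_radon_sets[OF \<gamma>]
  have "rmeas m A = 0" if "bounded_borel A" "A \<subseteq> U" for A
  proof -
    have "A \<in> null_sets \<gamma>"
      using that U s by - (rule null_sets_subset[of U], auto simp: null_sets_def bounded_borel_def)
    then show ?thesis by (rule is_density_null[OF s h])
  qed
  then have "variation m U = 0"
    unfolding variation_def subpartitions_def by (intro antisym SUP_least) (auto intro!: sum.neutral)
  then have "emeasure (total_variation m) U = 0"
    using U(1) by (simp add: emeasure_total_variation)
  then show False
    using x(1) U by (auto simp: msupport_def)
qed

section \<open>The action of pairs with densities\<close>

text \<open>Here \<sigma> is the zero measure, so the recession integral vanishes whatever densities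
  are chosen with respect to it; in the first integral the chosen densities agree with \<rho> and w
  almost everywhere.\<close>

lemma action_density:
  assumes \<gamma>: "nonneg_radon \<gamma>" and \<rho>: "is_density \<gamma> \<rho> \<mu>" and w: "is_density \<gamma> w \<nu>"
  shows "action \<phi> \<gamma> \<mu> \<nu> = (\<integral>\<^sup>+x. e2ennreal (\<phi> (\<rho> x, w x)) \<partial>\<gamma>)"
proof -
  note d1 = singular_part_zero[OF \<gamma> chosen_lebesgue_decomposition[OF \<gamma>] \<rho>]
  note d2 = singular_part_zero[OF \<gamma> chosen_lebesgue_decomposition[OF \<gamma>] w]
  let ?\<sigma> = "measure_sum (total_variation (singular_part \<gamma> \<mu>)) (total_variation (singular_part \<gamma> \<nu>))"
  have "emeasure ?\<sigma> (space ?\<sigma>) = 0"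
    using d1(1) d2(1) by (subst emeasure_measure_sum) (auto simp: total_variation_zero)
  then have "space ?\<sigma> \<in> null_sets ?\<sigma>"
    by (simp add: null_sets_def)
  then have "AE x in ?\<sigma>. e2ennreal (recession \<phi> (density_wrt ?\<sigma> (singular_part \<gamma> \<mu>) x, density_wrt ?\<sigma> (singular_part \<gamma> \<nu>) x)) = 0"
    by (rule AE_I') auto
  then have 1: "(\<integral>\<^sup>+x. e2ennreal (recession \<phi> (density_wrt ?\<sigma> (singular_part \<gamma> \<mu>) x, density_wrt ?\<sigma> (singular_part \<gamma> \<nu>) x)) \<partial>?\<sigma>) = (\<integral>\<^sup>+x. 0 \<partial>?\<sigma>)"
    by (rule nn_integral_cong_AE)
  have "AE x in \<gamma>. e2ennreal (\<phi> (ac_density \<gamma> \<mu> x, ac_density \<gamma> \<nu> x)) = e2ennreal (\<phi> (\<rho> x, w x))"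
    using is_density_unique[OF \<gamma> d1(2) \<rho>] is_density_unique[OF \<gamma> d2(2) w]
    by eventually_elim simp
  then have 2: "(\<integral>\<^sup>+x. e2ennreal (\<phi> (ac_density \<gamma> \<mu> x, ac_density \<gamma> \<nu> x)) \<partial>\<gamma>) = (\<integral>\<^sup>+x. e2ennreal (\<phi> (\<rho> x, w x)) \<partial>\<gamma>)"
    by (rule nn_integral_cong_AE)
  show ?thesis
    unfolding action_def Let_def 1 2 using msupport_density[OF \<gamma> \<rho>] msupport_density[OF \<gamma> w] by simp
qed

text \<open>Wherever one of the singular densities is nonzero the recession integrand is infinite,
  so this set is \<sigma>-null and both singular parts vanish.\<close>

lemma action_finite_density:
  assumes \<gamma>: "nonneg_radon \<gamma>" and rec: "\<And>y. y \<noteq> 0 \<Longrightarrow> recession \<phi> y = \<infinity>" and fin: "action \<phi> \<gamma> \<mu> \<nu> < \<infinity>"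
  shows "is_density \<gamma> (ac_density \<gamma> \<mu>) \<mu>" "is_density \<gamma> (ac_density \<gamma> \<nu>) \<nu>"
proof -
  let ?\<mu> = "singular_part \<gamma> \<mu>" and ?\<nu> = "singular_part \<gamma> \<nu>"
  define \<sigma> where "\<sigma> = measure_sum (total_variation ?\<mu>) (total_variation ?\<nu>)"
  have \<sigma>: "nonneg_radon \<sigma>"
    unfolding \<sigma>_def by (intro nonneg_radon_measure_sum nonneg_radon_total_variation)
  have s[measurable_cong]: "sets \<sigma> = sets borel" by (simp add: \<sigma>_def)
  have mu: "norm (rmeas ?\<mu> B) \<le> 1 * measure \<sigma> B" and nu: "norm (rmeas ?\<nu> B) \<le> 1 * measure \<sigma> B" if "bounded_borel B" for B
    using norm_rmeas_le[OF that, of ?\<mu>] norm_rmeas_le[OF that, of ?\<nu>]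
      measure_nonneg[of "total_variation ?\<mu>" B] measure_nonneg[of "total_variation ?\<nu>" B]
    unfolding \<sigma>_def measure_measure_sum[OF nonneg_radon_total_variation nonneg_radon_total_variation that]
    by (simp_all add: add_increasing add_increasing2)
  define r where "r = density_wrt \<sigma> ?\<mu>"
  define w where "w = density_wrt \<sigma> ?\<nu>"
  have r: "is_density \<sigma> r ?\<mu>"
    unfolding r_def using ex_bounded_density[OF \<sigma> _ mu] density_wrt_is_density by (metis zero_le_one)
  have w: "is_density \<sigma> w ?\<nu>"
    unfolding w_def using ex_bounded_density[OF \<sigma> _ nu] density_wrt_is_density by (metis zero_le_one)
  note [measurable] = is_density_measurable[OF r] is_density_measurable[OF w]
  define Z where "Z = {x. r x \<noteq> 0 \<or> w x \<noteq> 0}"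
  have Z: "Z \<in> sets \<sigma>"
    unfolding Z_def s by measurable
  \<comment> \<open>In \<open>ennreal\<close>, infinity times 0 is 0, so finiteness of this product
    says exactly that Z is a null set.\<close>
  have "\<infinity> * emeasure \<sigma> Z = (\<integral>\<^sup>+x. \<infinity> * indicator Z x \<partial>\<sigma>)"
    using Z by (simp add: nn_integral_cmult_indicator)
  also have "\<dots> \<le> (\<integral>\<^sup>+x. e2ennreal (recession \<phi> (r x, w x)) \<partial>\<sigma>)"
    by (intro nn_integral_mono) (auto simp: Z_def indicator_def rec zero_prod_def)
  also have "\<dots> < \<infinity>"
    using fin by (auto simp: action_def Let_def r_def w_def \<sigma>_def split: if_splits)
  finally have Z0: "emeasure \<sigma> Z = 0"
    by (auto simp: ennreal_mult_less_top split: if_splits)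
  have AE: "AE x in \<sigma>. r x = 0" "AE x in \<sigma>. w x = 0"
    using AE_not_in[of Z \<sigma>] Z Z0 by (auto simp: null_sets_def Z_def elim!: eventually_mono)
  have mu0: "rmeas ?\<mu> B = 0" if "bounded_borel B" for B
  proof -
    have "B \<in> sets \<sigma>" using that s by (simp add: bounded_borel_def)
    then have "(\<integral>x. indicator B x *\<^sub>R r x \<partial>\<sigma>) = (\<integral>x. 0 \<partial>\<sigma>)"
      using AE(1) by (intro integral_cong_AE) (auto elim!: eventually_mono)
    then show ?thesis
      using is_density_eq[OF r that] by (simp add: set_lebesgue_integral_def)
  qed
  have nu0: "rmeas ?\<nu> B = 0" if "bounded_borel B" for B
  proof -
    have "B \<in> sets \<sigma>" using that s by (simp add: bounded_borel_def)
    then have "(\<integral>x. indicator B x *\<^sub>R w x \<partial>\<sigma>) = (\<integral>x. 0 \<partial>\<sigma>)"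
      using AE(2) by (intro integral_cong_AE) (auto elim!: eventually_mono)
    then show ?thesis
      using is_density_eq[OF w that] by (simp add: set_lebesgue_integral_def)
  qed
  show "is_density \<gamma> (ac_density \<gamma> \<mu>) \<mu>" "is_density \<gamma> (ac_density \<gamma> \<nu>) \<nu>"
    using chosen_lebesgue_decomposition[OF \<gamma>, of \<mu>] chosen_lebesgue_decomposition[OF \<gamma>, of \<nu>] mu0 nu0
    by (auto simp: is_lebesgue_decomposition_def is_density_def)
qed

section \<open>The weak* topology\<close>

lemma compactly_supported_continuous_bounded_fn:
  assumes "compactly_supported_continuous f"
  obtains K where "compact K" "bounded_fn K f"
  using assms bounded_fn_continuous[of _ f] unfolding compactly_supported_continuous_def by blast

text \<open>The space of a generated topology is the union of its subbasis; the zero test function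
  already contributes the whole type.\<close>

lemma topspace_weak_star [simp]: "topspace (weak_star :: 'a::euclidean_space signed_radon topology) = UNIV"
proof -
  have "compactly_supported_continuous (\<lambda>x::'a. 0)"
    unfolding compactly_supported_continuous_def by (intro conjI exI[of _ "{}"]) auto
  then have "(UNIV :: 'a signed_radon set) \<in> {{\<mu>. radon_integral \<mu> f \<in> U} | f U. compactly_supported_continuous f \<and> open U}"
    by (intro CollectI exI[of _ "\<lambda>x. 0"] exI[of _ UNIV]) auto
  then show ?thesis
    unfolding weak_star_def topology_generated_by_topspace by blast
qed

lemma openin_weak_star_integral:
  assumes "compactly_supported_continuous f" "open U"
  shows "openin weak_star {\<mu>. radon_integral \<mu> f \<in> U}"
  unfolding weak_star_def using assms by (intro topology_generated_by_Basis) blast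

lemma continuous_map_weak_starI:
  fixes g :: "'c \<Rightarrow> 'a::euclidean_space signed_radon"
  assumes "\<And>f U. compactly_supported_continuous f \<Longrightarrow> open U \<Longrightarrow> openin X {t \<in> topspace X. radon_integral (g t) f \<in> U}"
  shows "continuous_map X weak_star g"
proof -
  have "continuous_map X (topology_generated_by {{\<mu>. radon_integral \<mu> f \<in> U} | f U. compactly_supported_continuous f \<and> open U}) g"
  proof (rule continuous_on_generated_topo)
    fix S assume "S \<in> {{\<mu>::'a signed_radon. radon_integral \<mu> f \<in> U} | f U. compactly_supported_continuous f \<and> open U}"
    then obtain f U where S: "S = {\<mu>. radon_integral \<mu> f \<in> U}" "compactly_supported_continuous f" "open U"
      by auto
    have "g -` S \<inter> topspace X = {t \<in> topspace X. radon_integral (g t) f \<in> U}"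
      by (auto simp: S)
    then show "openin X (g -` S \<inter> topspace X)"
      using assms[OF S(2,3)] by simp
  next
    show "g ` topspace X \<subseteq> \<Union> {{\<mu>::'a signed_radon. radon_integral \<mu> f \<in> U} | f U. compactly_supported_continuous f \<and> open U}"
      unfolding topology_generated_by_topspace[symmetric] weak_star_def[symmetric] by simp
  qed
  then show ?thesis by (simp add: weak_star_def)
qed

lemma continuous_map_weak_star_iff:
  fixes \<mu> :: "real \<Rightarrow> 'a::euclidean_space signed_radon"
  shows "continuous_map (top_of_set S) weak_star \<mu> \<longleftrightarrow>
    (\<forall>f :: 'a \<Rightarrow> real. compactly_supported_continuous f \<longrightarrow> continuous_on S (\<lambda>t. radon_integral (\<mu> t) f))"
proof (intro iffI allI impI)
  fix f :: "'a \<Rightarrow> real" assume c: "continuous_map (top_of_set S) weak_star \<mu>" and f: "compactly_supported_continuous f"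
  show "continuous_on S (\<lambda>t. radon_integral (\<mu> t) f)"
    unfolding continuous_on_open_gen[where T = UNIV, OF Pi_I[OF UNIV_I]]
  proof (intro allI impI)
    fix U :: "real set" assume "openin (top_of_set UNIV) U"
    then have "openin weak_star {\<mu>. radon_integral \<mu> f \<in> U}"
      using openin_weak_star_integral[OF f] by simp
    from openin_continuous_map_preimage[OF c this]
    have "openin (top_of_set S) {t \<in> S. radon_integral (\<mu> t) f \<in> U}" by simp
    moreover have "{t \<in> S. radon_integral (\<mu> t) f \<in> U} = S \<inter> (\<lambda>t. radon_integral (\<mu> t) f) -` U" by auto
    ultimately show "openin (top_of_set S) (S \<inter> (\<lambda>t. radon_integral (\<mu> t) f) -` U)" by simp
  qed
next
  assume c: "\<forall>f :: 'a \<Rightarrow> real. compactly_supported_continuous f \<longrightarrow> continuous_on S (\<lambda>t. radon_integral (\<mu> t) f)"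
  show "continuous_map (top_of_set S) weak_star \<mu>"
  proof (rule continuous_map_weak_starI)
    fix f U assume f: "compactly_supported_continuous (f :: 'a \<Rightarrow> real)" and U: "open (U :: real set)"
    have "openin (top_of_set S) (S \<inter> (\<lambda>t. radon_integral (\<mu> t) f) -` U)"
      using c f U by (intro continuous_openin_preimage_gen) auto
    moreover have "{t \<in> topspace (top_of_set S). radon_integral (\<mu> t) f \<in> U} = S \<inter> (\<lambda>t. radon_integral (\<mu> t) f) -` U" by auto
    ultimately show "openin (top_of_set S) {t \<in> topspace (top_of_set S). radon_integral (\<mu> t) f \<in> U}" by simp
  qed
qed

text \<open>Regularity places a compact F inside B and an open V around B with V - F of small mass;
  a Urysohn function between them differs from the indicator of B at most on V - F.\<close>

lemma approx_indicator:
  fixes B :: "'a::euclidean_space set"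
  assumes M: "nonneg_radon M" and B: "bounded_borel B" and e: "0 < e"
  obtains f D where "compactly_supported_continuous f" "\<And>x. 0 \<le> f x" "bounded_borel D"
    "emeasure M D < ennreal e" "\<And>x. \<bar>f x - indicator B x\<bar> \<le> indicator D x"
proof -
  obtain r where r: "B \<subseteq> ball 0 r"
    using B bounded_subset_ballD[of B 0] by (auto simp: bounded_borel_def)
  have Bb: "B \<in> sets borel" using B by (simp add: bounded_borel_def)
  \<comment> \<open>The regularity theorems ask for a finite measure, and M is only locally
    finite.\<close>
  define M' where "M' = density M (indicator (ball 0 r))"
  have sM[measurable_cong]: "sets M = sets borel" by (rule nonneg_radon_sets[OF M])
  have s: "sets M' = sets borel" by (simp add: M'_def sM)
  have ball_meas: "(indicator (ball 0 r) :: 'a \<Rightarrow> ennreal) \<in> borel_measurable M"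
    by (rule borel_measurable_indicator) (simp add: sM)
  have em: "emeasure M' A = emeasure M (A \<inter> ball 0 r)" if "A \<in> sets borel" for A
  proof -
    have "emeasure M' A = (\<integral>\<^sup>+x. indicator (ball 0 r) x * indicator A x \<partial>M)"
      unfolding M'_def using that by (subst emeasure_density[OF ball_meas]) (simp_all add: sM)
    also have "\<dots> = (\<integral>\<^sup>+x. indicator (A \<inter> ball 0 r) x \<partial>M)"
      by (intro nn_integral_cong) (auto simp: indicator_def)
    finally show ?thesis using that sM by simp
  qed
  have fin: "emeasure M' A < \<infinity>" if "A \<in> sets borel" for A
    unfolding em[OF that] by (intro nonneg_radon_finite[OF M] bounded_Int) auto
  have fin': "emeasure M' (space M') \<noteq> \<infinity>"
    using fin[of UNIV] sets_eq_imp_space_eq[OF s] by simp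
  have e2: "0 < ennreal (e / 2)" using e by simp
  have "emeasure M' B < emeasure M' B + ennreal (e / 2)"
    using fin[OF Bb] e2 ennreal_add_left_cancel_less[of "emeasure M' B" 0 "ennreal (e / 2)"] by simp
  then have "\<exists>U. B \<subseteq> U \<and> open U \<and> emeasure M' U < emeasure M' B + ennreal (e / 2)"
    using outer_regular[OF s fin' Bb] by (auto simp: INF_less_iff)
  then obtain U where U: "B \<subseteq> U" "open U" "emeasure M' U < emeasure M' B + ennreal (e / 2)"
    by blast
  have "\<exists>F. F \<subseteq> B \<and> compact F \<and> emeasure M' B < emeasure M' F + ennreal (e / 2)"
  \<comment> \<open>Subtraction in \<open>ennreal\<close> is truncated: for a null set,
    \<open>emeasure M' B - ennreal (e / 2)\<close> is not strictly below
    \<open>emeasure M' B\<close>, and the empty set is taken instead.\<close>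
  proof (cases "emeasure M' B = 0")
    case True
    then show ?thesis using e2 by (intro exI[of _ "{}"]) auto
  next
    case False
    have "emeasure M' B - ennreal (e / 2) < emeasure M' B"
      using False e2 fin[OF Bb] by (intro ennreal_between) (auto simp: less_top zero_less_iff_neq_zero)
    then obtain F where F: "F \<subseteq> B" "compact F" "emeasure M' B - ennreal (e / 2) < emeasure M' F"
      using inner_regular[OF s fin' Bb] by (auto simp: less_SUP_iff)
    have "emeasure M' B < emeasure M' F + ennreal (e / 2)"
    proof (rule ccontr)
      assume "\<not> ?thesis"
      then have "emeasure M' F + ennreal (e / 2) - ennreal (e / 2) \<le> emeasure M' B - ennreal (e / 2)"
        by (intro ennreal_minus_mono) auto
      with F(3) show False by (simp add: ennreal_add_diff_cancel_right)
    qed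
    then show ?thesis using F by blast
  qed
  then obtain F where F: "F \<subseteq> B" "compact F" "emeasure M' B < emeasure M' F + ennreal (e / 2)"
    by blast
  define V where "V = U \<inter> ball 0 r"
  have V: "open V" "B \<subseteq> V" "V \<subseteq> ball 0 r" using U r by (auto simp: V_def)
  have cl: "closed F" "closed (- V)" "F \<inter> - V = {}"
    using F V by (auto simp: compact_imp_closed)
  obtain f :: "'a \<Rightarrow> real" where f: "continuous_on UNIV f" "\<And>x. f x \<in> closed_segment 1 0"
    "\<And>x. x \<in> F \<Longrightarrow> f x = 1" "\<And>x. x \<in> - V \<Longrightarrow> f x = 0"
    using Urysohn[OF cl, of 1 0] by blast
  have f01: "0 \<le> f x" "f x \<le> 1" for x
    using f(2)[of x] by (auto simp: closed_segment_eq_real_ivl split: if_splits)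
  show thesis
  proof (rule that)
    show "compactly_supported_continuous f"
      unfolding compactly_supported_continuous_def
    proof (intro conjI exI[of _ "cball 0 r"] allI impI)
      fix x :: 'a assume "x \<notin> cball 0 r"
      then have "x \<notin> V" using V(3) by auto
      then show "f x = 0" using f(4) by simp
    qed (use f(1) in auto)
    show "0 \<le> f x" for x by (rule f01)
    have Fb: "F \<in> sets borel" using F by (simp add: borel_compact)
    show "bounded_borel (V - F)"
      by (rule bounded_borel_subset[of "ball 0 r"]) (use V Fb in auto)
    have "emeasure M (V - F) = emeasure M' (U - F)"
      using U Fb by (subst em) (auto simp: V_def Int_Diff Int_commute intro!: arg_cong[where f = "emeasure M"])
    also have "\<dots> < ennreal e"
    proof -
      have split: "emeasure M' U = emeasure M' F + emeasure M' (U - F)"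
        using plus_emeasure[of F M' "U - F"] Fb U F(1) s by (simp add: Un_absorb1 subset_trans[OF F(1) U(1)])
      have "emeasure M' U < emeasure M' F + ennreal (e / 2) + ennreal (e / 2)"
        using U(3) F(3) by (meson add_right_mono less_imp_le order_less_le_trans)
      also have "\<dots> = emeasure M' F + ennreal e"
        using e by (simp add: add.assoc flip: ennreal_plus)
      finally show ?thesis
        unfolding split ennreal_add_left_cancel_less by simp
    qed
    finally show "emeasure M (V - F) < ennreal e" .
    show "\<bar>f x - indicator B x\<bar> \<le> indicator (V - F) x" for x
      using f01[of x] f(3,4)[of x] F(1) V(2) by (auto simp: indicator_def abs_le_iff)
  qed
qed

text \<open>Passes from test functions to sets. One approximation of the indicator is chosen for
  \<gamma> and both total variations together. The form with c and \<mu>' serves upper bounds, lower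
  bounds and equality of two measures alike.\<close>

lemma rmeas_le_if_integral_le:
  assumes \<gamma>: "nonneg_radon \<gamma>"
    and le: "\<And>f. compactly_supported_continuous f \<Longrightarrow> (\<And>x. 0 \<le> f x) \<Longrightarrow> radon_integral \<mu> f \<le> c * (\<integral>x. f x \<partial>\<gamma>) + radon_integral \<mu>' f"
    and B: "bounded_borel B"
  shows "rmeas \<mu> B \<le> c * measure \<gamma> B + rmeas \<mu>' B"
proof (rule field_le_epsilon)
  fix e :: real assume e: "0 < e"
  \<comment> \<open>One error e' for each of \<mu> and \<mu>', and \<bar>c\<bar> times e' for
    \<gamma>.\<close>
  define e' where "e' = e / (2 + \<bar>c\<bar>)"
  have e': "0 < e'" "e' * (2 + \<bar>c\<bar>) = e" using e by (auto simp: e'_def)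
  define T where "T = measure_sum (total_variation \<mu>) (total_variation \<mu>')"
  have T: "nonneg_radon T" unfolding T_def by (intro nonneg_radon_measure_sum nonneg_radon_total_variation)
  define M where "M = measure_sum \<gamma> T"
  have M: "nonneg_radon M" unfolding M_def by (intro nonneg_radon_measure_sum \<gamma> T)
  obtain f D where f: "compactly_supported_continuous f" "\<And>x. 0 \<le> f x" and D: "bounded_borel D"
    "emeasure M D < ennreal e'" and fD: "\<And>x. \<bar>f x - indicator B x\<bar> \<le> indicator D x"
    using approx_indicator[OF M B e'(1)] by metis
  have "emeasure M D = ennreal (measure M D)"
    using D(2) by (intro emeasure_eq_ennreal_measure) auto
  then have "measure M D < e'" using D(2) e' by (simp add: ennreal_less_iff)
  moreover have "measure M D = measure \<gamma> D + (measure (total_variation \<mu>) D + measure (total_variation \<mu>') D)"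
    unfolding M_def measure_measure_sum[OF \<gamma> T D(1)]
    unfolding T_def measure_measure_sum[OF nonneg_radon_total_variation nonneg_radon_total_variation D(1)] ..
  ultimately have small: "measure \<gamma> D \<le> e'" "measure (total_variation \<mu>) D \<le> e'" "measure (total_variation \<mu>') D \<le> e'"
    using measure_nonneg[of \<gamma> D] measure_nonneg[of "total_variation \<mu>" D] measure_nonneg[of "total_variation \<mu>'" D]
    by linarith+
  obtain K where K: "compact K" "bounded_fn K f"
    using compactly_supported_continuous_bounded_fn[OF f(1)] .
  define S where "S = K \<union> B \<union> D"
  have S: "bounded_borel S" and SD: "bounded_fn S f"
    using K B D by (auto simp: S_def bounded_borel_def bounded_fn_def)
  have Bb: "B \<in> sets borel" "D \<in> sets borel" using B D by (auto simp: bounded_borel_def)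
  have ind: "bounded_fn S (indicator B :: 'a \<Rightarrow> real)"
    by (rule bounded_fnI[where C = 1]) (use S Bb in \<open>auto simp: S_def indicator_def\<close>)
  have [measurable]: "f \<in> borel_measurable borel" using SD by (simp add: bounded_fn_def)
  have d1: "norm (f x - indicator B x) \<le> 1" for x
  proof -
    have "indicator D x \<le> (1::real)" by (simp add: indicator_def)
    then show ?thesis using order_trans[OF fD[of x]] by simp
  qed
  have diff: "bounded_fn D (\<lambda>x. f x - indicator B x :: real)"
  proof (rule bounded_fnI[where C = 1])
    show "norm (f x - indicator B x) \<le> 1" for x by (rule d1)
    show "f x - indicator B x = 0" if "x \<notin> D" for x
      using fD[of x] that by simp
  qed (use D(1) Bb in auto)
  have ind_eq: "radon_integral m (indicator B) = rmeas m B" for m :: "'a signed_radon"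
  proof -
    have "radon_integral m (indicator B) = set_lebesgue_integral (total_variation m) B (density_wrt (total_variation m) m)"
      by (simp add: radon_integral_def set_lebesgue_integral_def)
    also have "\<dots> = rmeas m B"
      by (rule is_density_eq[OF polar_density(1) B, symmetric])
    finally show ?thesis .
  qed
  have near: "\<bar>radon_integral m f - rmeas m B\<bar> \<le> e'" if "measure (total_variation m) D \<le> e'" for m :: "'a signed_radon"
  proof -
    show ?thesis
      using radon_integral_bound[OF diff d1, of m] that by (simp add: radon_integral_diff[OF SD ind] ind_eq)
  qed
  have near_\<gamma>: "\<bar>(\<integral>x. f x \<partial>\<gamma>) - measure \<gamma> B\<bar> \<le> e'"
  proof -
    note [measurable_cong] = nonneg_radon_sets[OF \<gamma>]
    have fin: "emeasure \<gamma> A < \<infinity>" if "bounded_borel A" for A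
      using that nonneg_radon_finite[OF \<gamma>] by (simp add: bounded_borel_def)
    have iB: "integrable \<gamma> (indicator A :: 'a \<Rightarrow> real)" if "bounded_borel A" for A
      using that fin[OF that] nonneg_radon_sets[OF \<gamma>] by (auto simp: integrable_indicator_iff bounded_borel_def)
    have "\<bar>f x - indicator B x\<bar> \<le> \<bar>indicator D x\<bar>" for x
      using fD[of x] by simp
    then have id: "integrable \<gamma> (\<lambda>x. f x - indicator B x)"
      using Bb by (intro Bochner_Integration.integrable_bound[OF iB[OF D(1)]]) auto
    from Bochner_Integration.integrable_add[OF this iB[OF B]] have if': "integrable \<gamma> f" by simp
    have "(\<integral>x. f x - indicator B x \<partial>\<gamma>) = (\<integral>x. f x \<partial>\<gamma>) - measure \<gamma> B"
      using if' iB[OF B] Bb nonneg_radon_space[OF \<gamma>] by simp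
    moreover have "\<bar>\<integral>x. f x - indicator B x \<partial>\<gamma>\<bar> \<le> (\<integral>x. \<bar>f x - indicator B x\<bar> \<partial>\<gamma>)"
      by (rule integral_abs_bound)
    moreover have "\<dots> \<le> (\<integral>x. indicator D x \<partial>\<gamma>)"
      using id iB[OF D(1)] fD by (intro integral_mono) auto
    moreover have "(\<integral>x. indicator D x \<partial>\<gamma>) = measure \<gamma> D"
      using Bb nonneg_radon_space[OF \<gamma>] by simp
    ultimately show ?thesis using small by linarith
  qed
  have "c * (\<integral>x. f x \<partial>\<gamma>) - c * measure \<gamma> B \<le> \<bar>c\<bar> * e'"
    using near_\<gamma> by (metis abs_ge_self abs_mult abs_ge_zero mult_left_mono order_trans right_diff_distrib)
  then have "rmeas \<mu> B \<le> c * measure \<gamma> B + rmeas \<mu>' B + (2 * e' + \<bar>c\<bar> * e')"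
    using le[OF f] near[OF small(2)] near[OF small(3)] by linarith
  then show "rmeas \<mu> B \<le> c * measure \<gamma> B + rmeas \<mu>' B + e"
    using e'(2) by (simp add: algebra_simps)
qed

section \<open>Measures between two multiples of a reference measure\<close>

text \<open>The relation a \<gamma> \<le> \<mu> \<le> b \<gamma>, expressed by values on sets and
  not by densities: each condition concerns a single coordinate of the set function, which is what a
  product of intervals can encode.\<close>

definition between :: "'a::euclidean_space measure \<Rightarrow> real \<Rightarrow> real \<Rightarrow> 'a signed_radon set" where
  "between \<gamma> a b = {\<mu>. \<forall>B. bounded_borel B \<longrightarrow> a * measure \<gamma> B \<le> rmeas \<mu> B \<and> rmeas \<mu> B \<le> b * measure \<gamma> B}"

lemma betweenD:
  assumes "\<mu> \<in> between \<gamma> a b" "bounded_borel B"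
  shows "a * measure \<gamma> B \<le> rmeas \<mu> B" "rmeas \<mu> B \<le> b * measure \<gamma> B"
  using assms by (auto simp: between_def)

lemma between_abs_le:
  assumes "\<mu> \<in> between \<gamma> a b" "bounded_borel B"
  shows "\<bar>rmeas \<mu> B\<bar> \<le> max \<bar>a\<bar> \<bar>b\<bar> * measure \<gamma> B"
proof -
  have "b \<le> max \<bar>a\<bar> \<bar>b\<bar>" "- a \<le> max \<bar>a\<bar> \<bar>b\<bar>" by linarith+
  from this[THEN mult_right_mono[OF _ measure_nonneg[of \<gamma> B]]] show ?thesis
    using betweenD[OF assms] by (simp add: abs_le_iff)
qed

lemma nonneg_radon_measure_sums:
  fixes A :: "nat \<Rightarrow> 'a::euclidean_space set"
  assumes "nonneg_radon \<gamma>" "range A \<subseteq> sets borel" "disjoint_family A" "bounded (\<Union>i. A i)"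
  shows "(\<lambda>i. measure \<gamma> (A i)) sums measure \<gamma> (\<Union>i. A i)"
  using assms nonneg_radon_finite[OF assms(1,4)] nonneg_radon_sets[OF assms(1)]
  by (intro measure_UNION) auto

lemma set_integral_const:
  assumes "nonneg_radon \<gamma>" "bounded_borel B"
  shows "set_integrable \<gamma> B (\<lambda>x. c::real)" "set_lebesgue_integral \<gamma> B (\<lambda>x. c) = c * measure \<gamma> B"
  using assms nonneg_radon_finite[OF assms(1), of B] nonneg_radon_sets[OF assms(1)]
  by (auto simp: set_integrable_def set_lebesgue_integral_def bounded_borel_def less_top)

text \<open>Subtracting the midpoint c times \<gamma> turns the two bounds into the symmetric bound
  with constant C, half the length of the interval. The density then lies in the interval at every
  point, not only almost everywhere.\<close>

lemma between_density:
  assumes \<gamma>: "nonneg_radon \<gamma>" and ab: "a \<le> b" and \<mu>: "\<mu> \<in> between \<gamma> a b"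
  obtains \<rho> where "is_density \<gamma> \<rho> \<mu>" "\<And>x. a \<le> \<rho> x" "\<And>x. \<rho> x \<le> b"
proof -
  define c where "c = (a + b) / 2"
  define C where "C = (b - a) / 2"
  have le: "\<bar>rmeas \<mu> B - c * measure \<gamma> B\<bar> \<le> C * measure \<gamma> B" if "bounded_borel B" for B
    using betweenD[OF \<mu> that] unfolding c_def C_def abs_le_iff by (simp add: field_simps)
  have sums: "(\<lambda>i. rmeas \<mu> (A i) - c * measure \<gamma> (A i)) sums (rmeas \<mu> (\<Union>i. A i) - c * measure \<gamma> (\<Union>i. A i))"
    if "range A \<subseteq> sets borel" "disjoint_family A" "bounded (\<Union>i. A i)" for A :: "nat \<Rightarrow> 'a set"
    by (intro sums_diff sums_mult rmeas_sums nonneg_radon_measure_sums \<gamma> that)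
  have C0: "0 \<le> C" using ab by (simp add: C_def)
  obtain g where g: "g \<in> borel_measurable borel" "\<And>x. \<bar>g x\<bar> \<le> C"
    "\<And>B. bounded_borel B \<Longrightarrow> set_integrable \<gamma> B g \<and> rmeas \<mu> B - c * measure \<gamma> B = set_lebesgue_integral \<gamma> B g"
    using ex_bounded_real_density[OF \<gamma> sums le C0] by blast
  show thesis
  proof (rule that)
    show "is_density \<gamma> (\<lambda>x. g x + c) \<mu>"
      unfolding is_density_def
    proof (intro conjI allI impI)
      show "(\<lambda>x. g x + c) \<in> borel_measurable borel" using g(1) by measurable
      fix B :: "'a set" assume B: "bounded_borel B"
      show "set_integrable \<gamma> B (\<lambda>x. g x + c)" "rmeas \<mu> B = set_lebesgue_integral \<gamma> B (\<lambda>x. g x + c)"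
        using g(3)[OF B] set_integral_const[OF \<gamma> B, of c] by (auto simp: set_integral_add)
    qed
    show "a \<le> g x + c" "g x + c \<le> b" for x
      using g(2)[of x] by (auto simp: c_def C_def abs_le_iff field_simps)
  qed
qed

lemma density_between:
  assumes \<gamma>: "nonneg_radon \<gamma>" and \<rho>: "is_density \<gamma> \<rho> \<mu>" and le: "AE x in \<gamma>. a \<le> \<rho> x \<and> \<rho> x \<le> b"
  shows "\<mu> \<in> between \<gamma> a b"
  unfolding between_def
proof (intro CollectI allI impI)
  fix B :: "'a set" assume B: "bounded_borel B"
  have AE: "AE x in \<gamma>. indicator B x *\<^sub>R a \<le> indicator B x *\<^sub>R \<rho> x" "AE x in \<gamma>. indicator B x *\<^sub>R \<rho> x \<le> indicator B x *\<^sub>R b"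
    by (rule eventually_mono[OF le], simp add: indicator_def)+
  have 1: "set_lebesgue_integral \<gamma> B (\<lambda>x. a) \<le> set_lebesgue_integral \<gamma> B \<rho>"
    using set_integral_const(1)[OF \<gamma> B] is_density_integrable[OF \<rho> B] AE
    unfolding set_integrable_def set_lebesgue_integral_def
    by (intro integral_mono_AE)
  have 2: "set_lebesgue_integral \<gamma> B \<rho> \<le> set_lebesgue_integral \<gamma> B (\<lambda>x. b)"
    using set_integral_const(1)[OF \<gamma> B] is_density_integrable[OF \<rho> B] AE
    unfolding set_integrable_def set_lebesgue_integral_def
    by (intro integral_mono_AE)
  show "a * measure \<gamma> B \<le> rmeas \<mu> B \<and> rmeas \<mu> B \<le> b * measure \<gamma> B"
    using 1 2 is_density_eq[OF \<rho> B] by (simp add: set_integral_const(2)[OF \<gamma> B])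
qed

lemma bounded_fn_integrable_nonneg_radon:
  fixes f :: "'a::euclidean_space \<Rightarrow> real"
  assumes \<gamma>: "nonneg_radon \<gamma>" and f: "bounded_fn S f"
  shows "integrable \<gamma> f"
proof -
  note [measurable_cong] = nonneg_radon_sets[OF \<gamma>]
  have S: "bounded_borel S" "\<And>x. x \<notin> S \<Longrightarrow> f x = 0" and [measurable]: "f \<in> borel_measurable borel"
    using f by (auto simp: bounded_fn_def)
  obtain C where C: "0 < C" "\<And>x. norm (f x) \<le> C" using bounded_fn_bound[OF f] by blast
  have i: "integrable \<gamma> (\<lambda>x. indicator S x *\<^sub>R C)"
    using set_integral_const(1)[OF \<gamma> S(1)] by (simp add: set_integrable_def)
  show ?thesis
  proof (rule Bochner_Integration.integrable_bound[OF i])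
    show "AE x in \<gamma>. norm (f x) \<le> norm (indicator S x *\<^sub>R C)"
      using C S(2) by (intro AE_I2) (auto simp: indicator_def)
  qed measurable
qed

lemma between_integral:
  assumes \<gamma>: "nonneg_radon \<gamma>" and ab: "a \<le> b" and \<mu>: "\<mu> \<in> between \<gamma> a b"
    and f: "bounded_fn S f" "\<And>x. 0 \<le> f x"
  shows "a * (\<integral>x. f x \<partial>\<gamma>) \<le> radon_integral \<mu> f" "radon_integral \<mu> f \<le> b * (\<integral>x. f x \<partial>\<gamma>)"
proof -
  obtain \<rho> where \<rho>: "is_density \<gamma> \<rho> \<mu>" "\<And>x. a \<le> \<rho> x" "\<And>x. \<rho> x \<le> b"
    using between_density[OF \<gamma> ab \<mu>] by metis
  have i: "integrable \<gamma> (\<lambda>x. f x * \<rho> x)" and e: "radon_integral \<mu> f = (\<integral>x. f x * \<rho> x \<partial>\<gamma>)"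
    using bounded_fn_integrable(1)[OF \<gamma> \<rho>(1) f(1)] radon_integral_density[OF \<gamma> \<rho>(1) f(1)] by auto
  have i': "integrable \<gamma> f" by (rule bounded_fn_integrable_nonneg_radon[OF \<gamma> f(1)])
  have "(\<integral>x. a * f x \<partial>\<gamma>) \<le> (\<integral>x. f x * \<rho> x \<partial>\<gamma>)"
    using i i' \<rho> f(2) by (intro integral_mono) (auto simp: mult.commute intro: mult_right_mono)
  moreover have "(\<integral>x. f x * \<rho> x \<partial>\<gamma>) \<le> (\<integral>x. b * f x \<partial>\<gamma>)"
    using i i' \<rho> f(2) by (intro integral_mono) (auto simp: mult.commute intro: mult_right_mono)
  ultimately show "a * (\<integral>x. f x \<partial>\<gamma>) \<le> radon_integral \<mu> f" "radon_integral \<mu> f \<le> b * (\<integral>x. f x \<partial>\<gamma>)"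
    using e by simp_all
qed

text \<open>Both bounds are instances of the comparison on sets: \<open>scale_radon 0 \<mu>\<close>
  plays the zero measure, and \<open>scale_radon (-1) \<mu>\<close> turns the lower bound into an
  upper one.\<close>

lemma betweenI:
  assumes \<gamma>: "nonneg_radon \<gamma>"
    and le: "\<And>f. compactly_supported_continuous f \<Longrightarrow> (\<And>x. 0 \<le> f x) \<Longrightarrow>
      a * (\<integral>x. f x \<partial>\<gamma>) \<le> radon_integral \<mu> f \<and> radon_integral \<mu> f \<le> b * (\<integral>x. f x \<partial>\<gamma>)"
  shows "\<mu> \<in> between \<gamma> a b"
proof -
  have sc: "radon_integral (scale_radon c \<mu>) f = c * radon_integral \<mu> f" if f: "compactly_supported_continuous f" for f c
  proof -
    obtain K where "bounded_fn K f" using compactly_supported_continuous_bounded_fn[OF f] by metis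
    then show ?thesis by (rule radon_integral_scale_radon)
  qed
  have "a * measure \<gamma> B \<le> rmeas \<mu> B \<and> rmeas \<mu> B \<le> b * measure \<gamma> B" if B: "bounded_borel B" for B
  proof
    have "rmeas \<mu> B \<le> b * measure \<gamma> B + rmeas (scale_radon 0 \<mu>) B"
      using le by (intro rmeas_le_if_integral_le[OF \<gamma> _ B]) (simp add: sc)
    then show "rmeas \<mu> B \<le> b * measure \<gamma> B" by simp
    have "rmeas (scale_radon (-1) \<mu>) B \<le> (- a) * measure \<gamma> B + rmeas (scale_radon 0 \<mu>) B"
      using le by (intro rmeas_le_if_integral_le[OF \<gamma> _ B]) (simp add: sc)
    then show "a * measure \<gamma> B \<le> rmeas \<mu> B" by simp
  qed
  then show ?thesis by (simp add: between_def)
qed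

section \<open>Closedness and compactness in the weak* topology\<close>

lemma closedin_weak_star_integral:
  assumes "compactly_supported_continuous f" "closed C"
  shows "closedin weak_star {\<mu>. radon_integral \<mu> f \<in> C}"
proof -
  have "UNIV - {\<mu>. radon_integral \<mu> f \<in> C} = {\<mu>. radon_integral \<mu> f \<in> - C}" by auto
  then show ?thesis
    using openin_weak_star_integral[OF assms(1), of "- C"] assms(2) by (simp add: closedin_def open_Compl)
qed

text \<open>Membership is equivalent to two-sided bounds on the integrals of all nonnegative test
  functions, and each of these is a closed condition. The zero function makes the intersection range
  over a nonempty family.\<close>

lemma closedin_between:
  fixes \<gamma> :: "'a::euclidean_space measure"
  assumes \<gamma>: "nonneg_radon \<gamma>" and ab: "a \<le> b"
  shows "closedin weak_star (between \<gamma> a b)"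
proof -
  let ?F = "{f :: 'a \<Rightarrow> real. compactly_supported_continuous f \<and> (\<forall>x. 0 \<le> f x)}"
  have zero: "(\<lambda>x. 0) \<in> ?F"
    unfolding compactly_supported_continuous_def by (intro CollectI conjI exI[of _ "{}"]) auto
  have "between \<gamma> a b = (\<Inter>f\<in>?F. {\<mu>. radon_integral \<mu> f \<in> {a * (\<integral>x. f x \<partial>\<gamma>)..b * (\<integral>x. f x \<partial>\<gamma>)}})"
  proof (intro subset_antisym subsetI)
    fix \<mu> assume \<mu>: "\<mu> \<in> between \<gamma> a b"
    have "radon_integral \<mu> f \<in> {a * (\<integral>x. f x \<partial>\<gamma>)..b * (\<integral>x. f x \<partial>\<gamma>)}" if f: "f \<in> ?F" for f
    proof -
      obtain K where "bounded_fn K f" using f compactly_supported_continuous_bounded_fn by blast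
      then show ?thesis using between_integral[OF \<gamma> ab \<mu>] f by simp
    qed
    then show "\<mu> \<in> (\<Inter>f\<in>?F. {\<mu>. radon_integral \<mu> f \<in> {a * (\<integral>x. f x \<partial>\<gamma>)..b * (\<integral>x. f x \<partial>\<gamma>)}})" by blast
  next
    fix \<mu> assume "\<mu> \<in> (\<Inter>f\<in>?F. {\<mu>. radon_integral \<mu> f \<in> {a * (\<integral>x. f x \<partial>\<gamma>)..b * (\<integral>x. f x \<partial>\<gamma>)}})"
    then show "\<mu> \<in> between \<gamma> a b" by (intro betweenI[OF \<gamma>]) auto
  qed
  also have "closedin weak_star \<dots>"
    using zero by (intro closedin_Inter) (auto intro!: closedin_weak_star_integral simp del: atLeastAtMost_iff)
  finally show ?thesis .
qed

text \<open>Finite additivity leaves a remainder on the tail of the union, which is at most C times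
  the \<gamma>-mass of that tail and hence tends to 0.\<close>

lemma additive_between_radon:
  fixes m :: "'a::euclidean_space set \<Rightarrow> real"
  assumes \<gamma>: "nonneg_radon \<gamma>"
    and out: "\<And>B. \<not> bounded_borel B \<Longrightarrow> m B = 0"
    and le: "\<And>B. bounded_borel B \<Longrightarrow> \<bar>m B\<bar> \<le> C * measure \<gamma> B"
    and add: "\<And>A B. bounded_borel A \<Longrightarrow> bounded_borel B \<Longrightarrow> A \<inter> B = {} \<Longrightarrow> m (A \<union> B) = m A + m B"
  shows "rmeas (Abs_radon m) = m"
proof (rule rmeas_Abs_radon[OF out])
  fix A :: "nat \<Rightarrow> 'a set"
  assume A: "\<And>i. bounded_borel (A i)" "disjoint_family A" and U: "bounded_borel (\<Union>i. A i)"
  let ?U = "\<Union>i. A i" and ?P = "\<lambda>n. \<Union>i<n. A i"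
  have Ab: "A i \<in> sets borel" "bounded ?U" for i using A(1)[of i] U by (auto simp: bounded_borel_def)
  have P: "bounded_borel (?P n)" for n using A(1) by (intro bounded_borel_UN) auto
  have m0: "m {} = 0" using le[of "{}"] by simp
  have sum: "m (?P n) = (\<Sum>i<n. m (A i))" for n
  proof (induction n)
    case (Suc n)
    have "A n \<inter> A i = {}" if "i < n" for i
      using A(2) that by (auto simp: disjoint_family_on_def)
    then have "A n \<inter> ?P n = {}" by auto
    from add[OF A(1) P this] show ?case using Suc by (simp add: lessThan_Suc add.commute)
  qed (simp add: m0)
  have msum: "(\<lambda>n. \<Sum>i<n. measure \<gamma> (A i)) \<longlonglongrightarrow> measure \<gamma> ?U"
    using nonneg_radon_measure_sums[OF \<gamma>, of A] Ab A(2) unfolding sums_def by auto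
  have le_diff: "\<bar>m ?U - (\<Sum>i<n. m (A i))\<bar> \<le> C * (measure \<gamma> ?U - (\<Sum>i<n. measure \<gamma> (A i)))" for n
  proof -
    have R: "bounded_borel (?U - ?P n)" using P[of n] by (intro bounded_borel_Diff[OF U]) (simp add: bounded_borel_def)
    have eq: "?P n \<union> (?U - ?P n) = ?U" by auto
    have "m ?U = m (?P n) + m (?U - ?P n)"
      using add[OF P[of n] R] unfolding eq by auto
    moreover have "measure \<gamma> ?U = measure \<gamma> (?P n) + measure \<gamma> (?U - ?P n)"
    proof -
      have "emeasure \<gamma> (?P n) \<noteq> \<infinity>" "emeasure \<gamma> (?U - ?P n) \<noteq> \<infinity>"
        using nonneg_radon_finite[OF \<gamma>, of "?P n"] nonneg_radon_finite[OF \<gamma>, of "?U - ?P n"] P[of n] R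
        by (auto simp: bounded_borel_def)
      then have "measure \<gamma> (?P n \<union> (?U - ?P n)) = measure \<gamma> (?P n) + measure \<gamma> (?U - ?P n)"
        using P[of n] R nonneg_radon_sets[OF \<gamma>] by (intro measure_Union) (auto simp: bounded_borel_def)
      then show ?thesis unfolding eq .
    qed
    moreover have "measure \<gamma> (?P n) = (\<Sum>i<n. measure \<gamma> (A i))"
    proof (rule measure_finite_Union)
      show "disjoint_family_on A {..<n}" using A(2) by (rule disjoint_family_on_mono[rotated]) auto
      show "emeasure \<gamma> (A i) \<noteq> \<infinity>" for i
        using nonneg_radon_finite[OF \<gamma>, of "A i"] A(1)[of i] by (auto simp: bounded_borel_def)
    qed (use Ab nonneg_radon_sets[OF \<gamma>] in auto)
    ultimately show ?thesis using le[OF R] sum[of n] by simp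
  qed
  have "(\<lambda>n. m ?U - (\<Sum>i<n. m (A i))) \<longlonglongrightarrow> 0"
  proof (rule Lim_null_comparison)
    show "\<forall>\<^sub>F n in sequentially. norm (m ?U - (\<Sum>i<n. m (A i))) \<le> C * (measure \<gamma> ?U - (\<Sum>i<n. measure \<gamma> (A i)))"
      using le_diff by simp
    show "(\<lambda>n. C * (measure \<gamma> ?U - (\<Sum>i<n. measure \<gamma> (A i)))) \<longlonglongrightarrow> 0"
      using tendsto_mult[OF tendsto_const tendsto_diff[OF tendsto_const msum], of C "measure \<gamma> ?U"] by simp
  qed
  from tendsto_diff[OF tendsto_const[of "m ?U"] this] show "(\<lambda>i. m (A i)) sums m ?U"
    unfolding sums_def by simp
qed

lemma between_total_variation_le:
  assumes \<gamma>: "nonneg_radon \<gamma>" and \<mu>: "\<mu> \<in> between \<gamma> a b"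
  shows "B \<in> sets borel \<Longrightarrow> emeasure (total_variation \<mu>) B \<le> ennreal (max \<bar>a\<bar> \<bar>b\<bar>) * emeasure \<gamma> B"
    and "bounded_borel B \<Longrightarrow> measure (total_variation \<mu>) B \<le> max \<bar>a\<bar> \<bar>b\<bar> * measure \<gamma> B"
proof -
  let ?C = "max \<bar>a\<bar> \<bar>b\<bar>"
  have C0: "0 \<le> ?C" by simp
  show le: "emeasure (total_variation \<mu>) B \<le> ennreal ?C * emeasure \<gamma> B" if "B \<in> sets borel" for B
    using between_abs_le[OF \<mu>] that by (intro total_variation_le[OF \<gamma> C0]) auto
  assume B: "bounded_borel B"
  have "emeasure \<gamma> B < \<infinity>" using B nonneg_radon_finite[OF \<gamma>] by (simp add: bounded_borel_def)
  then have "enn2real (emeasure (total_variation \<mu>) B) \<le> enn2real (ennreal ?C * emeasure \<gamma> B)"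
    using le[of B] B by (intro enn2real_mono) (auto simp: ennreal_mult_less_top bounded_borel_def)
  then show "measure (total_variation \<mu>) B \<le> ?C * measure \<gamma> B"
    using C0 by (simp add: measure_def enn2real_mult)
qed

text \<open>The set functions between \<open>a \<gamma>\<close> and \<open>b \<gamma>\<close> that are additive form a closed subset of a
  product of compact intervals; the bounds make them countably additive.\<close>

lemma compactin_between:
  fixes \<gamma> :: "'a::euclidean_space measure"
  assumes \<gamma>: "nonneg_radon \<gamma>"
  shows "compactin weak_star (between \<gamma> a b)"
proof -
  \<comment> \<open>The factor for a set that is not bounded Borel is the single point 0: it encodes
    the normalisation and keeps the factor compact.\<close>
  define J where "J B = (if bounded_borel B then {a * measure \<gamma> B..b * measure \<gamma> B} else {0::real})" for B
  define P where "P = (\<Pi>\<^sub>E B\<in>UNIV. J B)"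
  define E where "E A B = {m :: 'a set \<Rightarrow> real. m (A \<union> B) = m A + m B}" for A B
  define Q where "Q = P \<inter> (\<Inter>(A, B) \<in> {(A, B). bounded_borel A \<and> bounded_borel B \<and> A \<inter> B = {}}. E A B)"
  have "compact P"
    unfolding P_def euclidean_product_topology[symmetric] compactin_euclidean_iff[symmetric]
    by (subst compactin_PiE) (auto simp: J_def)
  moreover have "closed (E A B)" for A B
    unfolding E_def by (intro closed_Collect_eq continuous_intros) auto
  ultimately have Q: "compact Q"
    unfolding Q_def by (intro compact_Int_closed closed_INT) auto
  define C where "C = max \<bar>a\<bar> \<bar>b\<bar>"
  have QD: "rmeas (Abs_radon m) = m \<and> Abs_radon m \<in> between \<gamma> a b" if m: "m \<in> Q" for m
  proof -
    have J: "m B \<in> J B" for B using m by (auto simp: Q_def P_def)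
    have in': "a * measure \<gamma> B \<le> m B" "m B \<le> b * measure \<gamma> B" if "bounded_borel B" for B
      using J[of B] that by (auto simp: J_def)
    have 1: "rmeas (Abs_radon m) = m"
    proof (rule additive_between_radon[OF \<gamma>])
      show "m B = 0" if "\<not> bounded_borel B" for B using J[of B] that by (simp add: J_def)
      show "\<bar>m B\<bar> \<le> C * measure \<gamma> B" if B: "bounded_borel B" for B
      proof -
        have "b \<le> C" "- a \<le> C" unfolding C_def by linarith+
        from this[THEN mult_right_mono[OF _ measure_nonneg[of \<gamma> B]]] show ?thesis
          using in'[OF B] by (simp add: abs_le_iff)
      qed
      show "m (A \<union> B) = m A + m B" if "bounded_borel A" "bounded_borel B" "A \<inter> B = {}" for A B
        using m that by (auto simp: Q_def E_def)
    qed
    then show ?thesis using in' by (simp add: between_def)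
  qed
  have "Abs_radon ` Q = between \<gamma> a b"
  proof (intro subset_antisym subsetI)
    fix \<mu> assume \<mu>: "\<mu> \<in> between \<gamma> a b"
    have "rmeas \<mu> \<in> Q"
      unfolding Q_def P_def E_def J_def
      using betweenD[OF \<mu>] by (auto simp: rmeas_outside rmeas_Un)
    then show "\<mu> \<in> Abs_radon ` Q"
      by (intro image_eqI[of _ _ "rmeas \<mu>"]) (simp_all add: rmeas_inverse)
  qed (use QD in auto)
  moreover have "continuous_map (top_of_set Q) weak_star Abs_radon"
  proof (rule continuous_map_weak_starI)
    fix f :: "'a \<Rightarrow> real" and U :: "real set" assume f: "compactly_supported_continuous f" and U: "open U"
    obtain K where K: "bounded_fn K f" using compactly_supported_continuous_bounded_fn[OF f] by metis
    have Kb: "bounded_borel K" using K by (simp add: bounded_fn_def)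
    have "\<exists>W. bounded_fn K W \<and> finite (range W) \<and> (\<forall>x. norm (f x - W x) \<le> inverse (real (Suc n)))" for n
      using simple_bounded_fn_approx[OF K, of "inverse (real (Suc n))"] by auto
    then obtain W where W: "\<And>n. bounded_fn K (W n)" "\<And>n. finite (range (W n))"
      "\<And>n x. norm (f x - W n x) \<le> inverse (real (Suc n))"
      by metis
    let ?s = "\<lambda>n m. \<Sum>c\<in>range (W n) - {0}. c * m (W n -` {c})"
    \<comment> \<open>Each \<open>?s n\<close> is a combination of finitely many coordinates of m,
      hence continuous in the product topology. The error is at most a multiple of the mass of K,
      which is bounded uniformly on Q, so the limit is continuous as well.\<close>
    have "uniform_limit Q ?s (\<lambda>m. radon_integral (Abs_radon m) f) sequentially"
    proof (rule uniform_limitI)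
      fix e :: real assume e: "0 < e"
      let ?D = "C * measure \<gamma> K"
      have "(\<lambda>n. inverse (real (Suc n)) * ?D) \<longlonglongrightarrow> 0"
        by (rule tendsto_mult_left_zero[OF LIMSEQ_inverse_real_of_nat])
      then have "\<forall>\<^sub>F n in sequentially. inverse (real (Suc n)) * ?D < e"
        using e by (rule order_tendstoD)
      then show "\<forall>\<^sub>F n in sequentially. \<forall>m\<in>Q. dist (?s n m) (radon_integral (Abs_radon m) f) < e"
      proof eventually_elim
        case (elim n)
        show ?case
        proof
          fix m assume m: "m \<in> Q"
          let ?\<mu> = "Abs_radon m"
          have "measure (total_variation ?\<mu>) K \<le> ?D"
            using between_total_variation_le(2)[OF \<gamma> _ Kb] QD[OF m] by (simp add: C_def)
          then have D: "inverse (real (Suc n)) * measure (total_variation ?\<mu>) K \<le> inverse (real (Suc n)) * ?D"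
            by (intro mult_left_mono) auto
          have "radon_integral ?\<mu> (W n) = ?s n m"
            using radon_integral_simple[OF W(1)[of n] W(2)[of n], of ?\<mu>] QD[OF m] by simp
          then have "dist (?s n m) (radon_integral ?\<mu> f) = \<bar>radon_integral ?\<mu> (\<lambda>x. f x - W n x)\<bar>"
            by (simp add: radon_integral_diff[OF K W(1)] dist_real_def)
          also have "\<dots> \<le> inverse (real (Suc n)) * (DIM(real) * measure (total_variation ?\<mu>) K)"
            by (rule radon_integral_bound[OF bounded_fn_diff[OF K W(1)] W(3)])
          also have "\<dots> = inverse (real (Suc n)) * measure (total_variation ?\<mu>) K" by simp
          also have "\<dots> < e" using D elim by (rule order_le_less_trans)
          finally show "dist (?s n m) (radon_integral ?\<mu> f) < e" .
        qed
      qed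
    qed
    moreover have "continuous_on Q (?s n)" for n
      by (intro continuous_intros continuous_on_coordinatewise_then_product) 
        (auto intro!: continuous_on_product_coordinates[THEN continuous_on_subset])
    ultimately have "continuous_on Q (\<lambda>m. radon_integral (Abs_radon m) f)"
      by (intro uniform_limit_theorem[where F = sequentially]) auto
    then have "openin (top_of_set Q) (Q \<inter> (\<lambda>m. radon_integral (Abs_radon m) f) -` U)"
      using U by (intro continuous_openin_preimage_gen) auto
    moreover have "{t \<in> topspace (top_of_set Q). radon_integral (Abs_radon t) f \<in> U} = Q \<inter> (\<lambda>m. radon_integral (Abs_radon m) f) -` U"
      by auto
    ultimately show "openin (top_of_set Q) {t \<in> topspace (top_of_set Q). radon_integral (Abs_radon t) f \<in> U}"
      by simp
  qed
  moreover have "compactin (top_of_set Q) Q"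
    using Q by (simp add: compactin_subtopology)
  ultimately show ?thesis
    using image_compactin by metis
qed

section \<open>Admissible densities\<close>

text \<open>\<open>lsc\<close> speaks of the punctured neighbourhood filter, so the point itself is
  added by hand. Lower semicontinuity is used below only in this form.\<close>

lemma lsc_open_superlevel:
  assumes "lsc \<phi>"
  shows "open {x. c < \<phi> x}"
proof (subst open_subopen, intro ballI)
  fix x assume "x \<in> {x. c < \<phi> x}"
  then have "c < Liminf (at x) \<phi>"
    using assms by (auto simp: lsc_def intro: order_less_le_trans)
  then have "\<forall>\<^sub>F y in at x. c < \<phi> y"
    by (rule less_LiminfD)
  then obtain S where "open S" "x \<in> S" "\<And>y. y \<in> S \<Longrightarrow> y \<noteq> x \<Longrightarrow> c < \<phi> y"
    unfolding eventually_at_topological by auto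
  then show "\<exists>T. open T \<and> x \<in> T \<and> T \<subseteq> {x. c < \<phi> x}"
    using \<open>x \<in> {x. c < \<phi> x}\<close> by (intro exI[of _ S]) auto
qed

locale admissible_density =
  fixes p a b :: real and \<phi> :: "real \<times> 'a::euclidean_space \<Rightarrow> ereal"
  assumes p: "1 < p" and ab: "a < b" and adm: "admissible_on p a b \<phi>"
begin

lemma phi_nonneg [simp]: "0 \<le> \<phi> x"
  and phi_lsc: "lsc \<phi>"
  and phi_interior: "interior (edom \<phi>) = {a<..<b} \<times> UNIV"
  using adm unfolding admissible_on_def admissible_def by blast+

lemma in_edom: "x \<in> edom \<phi> \<longleftrightarrow> \<phi> x < \<infinity>"
  by (simp add: edom_def)

lemma phi_convex: "0 < t \<Longrightarrow> t < 1 \<Longrightarrow> \<phi> ((1 - t) *\<^sub>R x + t *\<^sub>R y) \<le> ereal (1 - t) * \<phi> x + ereal t * \<phi> y"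
  using adm unfolding admissible_on_def admissible_def econvex_def by blast

lemma phi_homogeneous:
  "\<phi> (\<rho>, v) < \<infinity> \<Longrightarrow> c \<noteq> 0 \<Longrightarrow> \<phi> (\<rho>, c *\<^sub>R w) = ereal (\<bar>c\<bar> powr p) * \<phi> (\<rho>, w)"
  and phi_fiber_zero: "\<phi> (\<rho>, v) < \<infinity> \<Longrightarrow> \<phi> (\<rho>, 0) = 0"
proof -
  assume "\<phi> (\<rho>, v) < \<infinity>"
  then have "({\<rho>} \<times> UNIV) \<inter> edom \<phi> \<noteq> {}" by (auto simp: edom_def)
  then show "c \<noteq> 0 \<Longrightarrow> \<phi> (\<rho>, c *\<^sub>R w) = ereal (\<bar>c\<bar> powr p) * \<phi> (\<rho>, w)" "\<phi> (\<rho>, 0) = 0"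
    using adm unfolding admissible_on_def admissible_def by blast+
qed

lemma phi_finite: "a < \<rho> \<Longrightarrow> \<rho> < b \<Longrightarrow> \<phi> (\<rho>, w) < \<infinity>"
  using interior_subset[of "edom \<phi>"] unfolding phi_interior in_edom[symmetric] by auto

lemma phi_convex_dom: "convex (edom \<phi>)"
  unfolding convex_alt
proof (intro ballI allI impI)
  fix x y and u :: real assume xy: "x \<in> edom \<phi>" "y \<in> edom \<phi>" and u: "0 \<le> u \<and> u \<le> 1"
  consider "u = 0" | "u = 1" | "0 < u" "u < 1" using u by linarith
  then show "(1 - u) *\<^sub>R x + u *\<^sub>R y \<in> edom \<phi>"
  proof cases
    case 3
    have "ereal (1 - u) * \<phi> x + ereal u * \<phi> y < \<infinity>"
      using xy u phi_nonneg[of x] phi_nonneg[of y] unfolding edom_def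
      by (cases "\<phi> x"; cases "\<phi> y") auto
    with phi_convex[OF 3, of x y] show ?thesis by (auto simp: edom_def)
  qed (use xy in auto)
qed

text \<open>A point of a convex set, moved slightly towards an interior point, becomes interior.
  Letting the shift e tend to 0 leaves the closed strip.\<close>

lemma phi_dom_bounds:
  assumes "\<phi> (\<rho>, w) < \<infinity>"
  shows "a \<le> \<rho>" "\<rho> \<le> b"
proof -
  define m where "m = (a + b) / 2"
  have c: "(m, 0) \<in> interior (edom \<phi>)"
    using ab by (simp add: phi_interior m_def)
  have "a < \<rho> - e * (\<rho> - m) \<and> \<rho> - e * (\<rho> - m) < b" if "0 < e" "e \<le> 1" for e
    using mem_interior_convex_shrink[OF phi_convex_dom c _ that, of "(\<rho>, w)"] assms
    by (simp add: phi_interior in_edom)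
  note e = this
  show "a \<le> \<rho>"
  proof (rule tendsto_lowerbound)
    show "((\<lambda>e. \<rho> - e * (\<rho> - m)) \<longlongrightarrow> \<rho>) (at_right 0)"
      by (auto intro!: tendsto_eq_intros)
    show "\<forall>\<^sub>F e in at_right 0. a \<le> \<rho> - e * (\<rho> - m)"
      using e by (intro eventually_at_rightI[of 0 1]) (auto intro: less_imp_le)
  qed simp
  show "\<rho> \<le> b"
  proof (rule tendsto_upperbound)
    show "((\<lambda>e. \<rho> - e * (\<rho> - m)) \<longlongrightarrow> \<rho>) (at_right 0)"
      by (auto intro!: tendsto_eq_intros)
    show "\<forall>\<^sub>F e in at_right 0. \<rho> - e * (\<rho> - m) \<le> b"
      using e by (intro eventually_at_rightI[of 0 1]) (auto intro: less_imp_le)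
  qed simp
qed

lemma phi_measurable [measurable]: "\<phi> \<in> borel_measurable borel"
proof (rule borel_measurableI_greater)
  show "{x \<in> space borel. c < \<phi> x} \<in> sets borel" for c
    using lsc_open_superlevel[OF phi_lsc, of c] by simp
qed

text \<open>By lower semicontinuity a positive value at x would persist at nearby points of the
  ray.\<close>

lemma phi_zero_limit:
  assumes ev: "\<forall>\<^sub>F t in at_right (0::real). \<phi> (x + t *\<^sub>R y) = 0"
  shows "\<phi> x = 0"
proof (rule ccontr)
  assume "\<phi> x \<noteq> 0"
  then have x: "x \<in> {x. 0 < \<phi> x}" using phi_nonneg[of x] by (auto simp: less_le simp del: phi_nonneg)
  have "((\<lambda>t. x + t *\<^sub>R y) \<longlongrightarrow> x) (at_right 0)"
    by (auto intro!: tendsto_eq_intros)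
  then have "\<forall>\<^sub>F t in at_right 0. x + t *\<^sub>R y \<in> {x. 0 < \<phi> x}"
    using lsc_open_superlevel[OF phi_lsc, of 0] x by (auto simp: tendsto_def)
  with ev have "\<forall>\<^sub>F t in at_right (0::real). False"
    by eventually_elim simp
  then show False by simp
qed

text \<open>Inside the interval this is the homogeneity axiom. The fibres over a and b are not known
  beforehand to meet the domain, so there the value is obtained as a limit from the
  interior.\<close>

lemma phi_zero:
  assumes "a \<le> \<rho>" "\<rho> \<le> b"
  shows "\<phi> (\<rho>, 0) = 0"
proof -
  have int: "\<phi> (r, 0) = 0" if "a < r" "r < b" for r
    using phi_fiber_zero[OF phi_finite[OF that]] .
  define m where "m = (a + b) / 2"
  have m: "a < m" "m < b" using ab by (auto simp: m_def)
  show ?thesis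
  proof (rule phi_zero_limit[of _ "(m - \<rho>, 0)"])
    have "a < \<rho> + t * (m - \<rho>) \<and> \<rho> + t * (m - \<rho>) < b" if "0 < t" "t < 1" for t
    proof -
      have "t * a < t * m" "t * m < t * b" using m that by auto
      moreover have "(1 - t) * a \<le> (1 - t) * \<rho>" "(1 - t) * \<rho> \<le> (1 - t) * b"
        using assms that by (auto intro: mult_left_mono)
      ultimately show ?thesis by (simp add: algebra_simps)
    qed
    then show "\<forall>\<^sub>F t in at_right 0. \<phi> ((\<rho>, 0) + t *\<^sub>R (m - \<rho>, 0)) = 0"
      by (intro eventually_at_rightI[of 0 1]) (auto intro: int)
  qed
qed

section \<open>Positivity, coercivity and recession of the density\<close>

definition mid :: real where "mid = (a + b) / 2"

lemma mid: "a < mid" "mid < b"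
  using ab by (auto simp: mid_def)

text \<open>The axiom gives positivity only over \<rho>0, which may be an end point. If
  \<open>\<phi> (mid, w) = 0\<close>, then all multiples of w give 0 over \<open>mid\<close> by
  homogeneity. The point (\<rho>0, w) is approached along convex combinations of (\<rho>0, 0) and
  (\<open>mid\<close>, w / t), where the value is 0, and the limit contradicts positivity over
  \<rho>0.\<close>

lemma phi_mid_pos:
  assumes "w \<noteq> 0"
  shows "0 < \<phi> (mid, w)"
proof (rule ccontr)
  assume "\<not> ?thesis"
  then have z: "\<phi> (mid, w) = 0" using phi_nonneg[of "(mid, w)"] by (auto simp: less_le simp del: phi_nonneg)
  obtain \<rho>0 where \<rho>0: "{\<rho>0} \<times> UNIV \<subseteq> edom \<phi>" "\<And>w. w \<noteq> 0 \<Longrightarrow> \<phi> (\<rho>0, w) > 0"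
    using adm by (auto simp: admissible_on_def admissible_def)
  have fin0: "\<phi> (\<rho>0, 0) < \<infinity>" using \<rho>0(1) by (auto simp: edom_def)
  have "\<phi> (\<rho>0, w) = 0"
  proof (rule phi_zero_limit[of _ "(mid - \<rho>0, 0)"])
    have "\<phi> ((\<rho>0, w) + t *\<^sub>R (mid - \<rho>0, 0)) = 0" if t: "0 < t" "t < 1" for t
    proof -
      have "(\<rho>0, w) + t *\<^sub>R (mid - \<rho>0, 0) = (1 - t) *\<^sub>R (\<rho>0, 0) + t *\<^sub>R (mid, (1 / t) *\<^sub>R w)"
        using t by (simp add: algebra_simps)
      moreover have "\<phi> (mid, (1 / t) *\<^sub>R w) = 0"
        using phi_homogeneous[OF phi_finite[OF mid], of "1 / t" w] t z by simp
      ultimately have "\<phi> ((\<rho>0, w) + t *\<^sub>R (mid - \<rho>0, 0)) \<le> 0"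
        using phi_convex[OF t, of "(\<rho>0, 0)" "(mid, (1 / t) *\<^sub>R w)"] phi_fiber_zero[OF fin0] by simp
      then show ?thesis by (intro antisym) auto
    qed
    then show "\<forall>\<^sub>F t in at_right 0. \<phi> ((\<rho>0, w) + t *\<^sub>R (mid - \<rho>0, 0)) = 0"
      by (intro eventually_at_rightI[of 0 1]) auto
  qed
  then show False using \<rho>0(2)[OF assms] by simp
qed

text \<open>Over \<open>mid\<close>, positivity, lower semicontinuity and compactness of the sphere
  give a lower bound c0 on unit vectors, and homogeneity extends it to all vectors. Convexity moves
  it to every other \<rho>.\<close>

lemma phi_coercive:
  obtains c where "0 < c" "\<And>\<rho> w. ereal (c * norm w powr p) \<le> \<phi> (\<rho>, w)"
proof -
  define U where "U n = {w. ereal (inverse (real (Suc n))) < \<phi> (mid, w)}" for n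
  have op: "open (U n)" for n
  proof -
    have "open ((\<lambda>w. (mid, w)) -` {x. ereal (inverse (real (Suc n))) < \<phi> x})"
      by (intro open_vimage lsc_open_superlevel phi_lsc continuous_intros)
    then show ?thesis by (simp add: U_def vimage_def)
  qed
  have "sphere 0 1 \<subseteq> (\<Union>n. U n)"
  proof
    fix w :: 'a assume "w \<in> sphere 0 1"
    then have "w \<noteq> 0" by auto
    then obtain r where r: "\<phi> (mid, w) = ereal r" "0 < r"
      using phi_mid_pos[of w] phi_finite[OF mid, of w] by (cases "\<phi> (mid, w)") auto
    then obtain n where "inverse (real (Suc n)) < r" using reals_Archimedean by blast
    then show "w \<in> (\<Union>n. U n)" using r by (auto simp: U_def intro!: exI[of _ n])
  qed
  then obtain I where I: "finite I" "sphere 0 1 \<subseteq> (\<Union>n\<in>I. U n)"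
    using compactE_image[of "sphere 0 1" UNIV U] op by (metis compact_sphere)
  \<comment> \<open>The sets \<open>U n\<close> grow with n, so the largest index of the finite
    subcover gives a bound valid on the whole sphere; inserting 0 keeps \<open>Max\<close>
    defined.\<close>
  define N where "N = Max (insert 0 I)"
  define c0 where "c0 = inverse (real (Suc N))"
  have c0: "0 < c0" by (simp add: c0_def)
  have sph: "ereal c0 \<le> \<phi> (mid, u)" if u: "norm u = 1" for u
  proof -
    obtain n where n: "n \<in> I" "u \<in> U n" using I(2) u by auto
    then have "n \<le> N" using I(1) by (auto simp: N_def)
    then have "c0 \<le> inverse (real (Suc n))" by (simp add: c0_def field_simps)
    then have "ereal c0 \<le> ereal (inverse (real (Suc n)))" by simp
    also have "\<dots> < \<phi> (mid, u)" using n(2) by (simp add: U_def)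
    finally show ?thesis by simp
  qed
  have mid_le: "ereal (c0 * norm w powr p) \<le> \<phi> (mid, w)" for w
  proof (cases "w = 0")
    case False
    define u where "u = (1 / norm w) *\<^sub>R w"
    have u: "norm u = 1" "w = norm w *\<^sub>R u" using False by (auto simp: u_def)
    have "\<phi> (mid, w) = ereal (norm w powr p) * \<phi> (mid, u)"
      using phi_homogeneous[OF phi_finite[OF mid], of "norm w" u] False u(2) by simp
    also have "\<dots> \<ge> ereal (norm w powr p) * ereal c0"
      by (intro ereal_mult_left_mono sph u) auto
    finally show ?thesis by (simp add: mult.commute)
  qed (simp flip: zero_ereal_def)
  show thesis
  proof (rule that)
    show "0 < 3 * (c0 / 3 powr p)" using c0 by simp
    fix \<rho> w
    show "ereal (3 * (c0 / 3 powr p) * norm w powr p) \<le> \<phi> (\<rho>, w)"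
    proof (cases "\<phi> (\<rho>, w) < \<infinity>")
      case True
      then obtain r where r: "\<phi> (\<rho>, w) = ereal r" using phi_nonneg[of "(\<rho>, w)"] by (cases "\<phi> (\<rho>, w)") auto
      \<comment> \<open>The reflection of \<rho> at \<open>mid\<close>, at half the distance, hence
        strictly inside the interval. Then \<open>mid\<close> is one third of \<rho> plus two thirds
        of \<rho>', and the flux w becomes w / 3; this is the origin of the constant
        \<open>3 * (c0 / 3 powr p)\<close>.\<close>
      define \<rho>' where "\<rho>' = mid + (mid - \<rho>) / 2"
      have "a < \<rho>'" "\<rho>' < b"
        using phi_dom_bounds[OF True] ab by (auto simp: \<rho>'_def mid_def field_simps)
      then have z: "\<phi> (\<rho>', 0) = 0" by (intro phi_zero) auto
      have "(mid, (1/3) *\<^sub>R w) = (1 - 2/3) *\<^sub>R (\<rho>, w) + (2/3) *\<^sub>R (\<rho>', 0)"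
        by (simp add: \<rho>'_def field_simps)
      then have "\<phi> (mid, (1/3) *\<^sub>R w) \<le> ereal (1 - 2/3) * \<phi> (\<rho>, w) + ereal (2/3) * \<phi> (\<rho>', 0)"
        using phi_convex[of "2/3" "(\<rho>, w)" "(\<rho>', 0)"] by simp
      also have "\<dots> = ereal (r / 3)" by (simp add: r z)
      finally have "ereal (c0 * norm ((1/3) *\<^sub>R w) powr p) \<le> ereal (r / 3)"
        by (rule order_trans[OF mid_le])
      then have "c0 * (norm w / 3) powr p \<le> r / 3" by simp
      then have "c0 * (norm w powr p / 3 powr p) \<le> r / 3" by (simp add: powr_divide)
      moreover have "3 * (c0 / 3 powr p) * norm w powr p = 3 * (c0 * (norm w powr p / 3 powr p))" by simp
      ultimately have "3 * (c0 / 3 powr p) * norm w powr p \<le> r" by linarith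
      then show ?thesis unfolding r by (simp only: ereal_less_eq)
    qed (auto simp: less_top)
  qed
qed

text \<open>If the first component of y is nonzero, some translate leaves the strip. Otherwise the
  increments along multiples of v over \<open>mid\<close> telescope: a finite recession value s
  would give \<open>real n powr p * k \<le> real n * s\<close> for all n, which p > 1
  forbids.\<close>

lemma phi_recession:
  assumes "y \<noteq> 0"
  shows "recession \<phi> y = \<infinity>"
proof -
  obtain r v where y: "y = (r, v)" by (cases y)
  show ?thesis
  proof (cases "r = 0")
    case False
    have "\<exists>x. a < x \<and> x < b \<and> \<not> (a \<le> x + r \<and> x + r \<le> b)"
    proof (cases "0 < r")
      case True
      \<comment> \<open>The point is within r / 2 of b, so adding r passes b; the second entry of
        the minimum keeps it above a. The other case mirrors this at a.\<close>
      then show ?thesis using ab by (intro exI[of _ "b - min (r / 2) ((b - a) / 2)"]) (auto simp: min_def field_simps)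
    next
      case f: False
      then show ?thesis using ab False by (intro exI[of _ "a + min (- r / 2) ((b - a) / 2)"]) (auto simp: min_def field_simps)
    qed
    then obtain x where x: "a < x" "x < b" "\<not> (a \<le> x + r \<and> x + r \<le> b)" by blast
    have "\<phi> ((x, 0) + y) = \<infinity>"
      using phi_dom_bounds[of "x + r" v] x(3) by (auto simp: y less_top)
    moreover have "\<phi> (x, 0) = 0" using x by (intro phi_zero) auto
    moreover have "(x, 0) \<in> edom \<phi>" using phi_finite[OF x(1,2)] by (simp add: edom_def)
    ultimately have "\<infinity> \<le> recession \<phi> y"
      unfolding recession_def by (intro SUP_upper2[of "(x, 0)"]) auto
    then show ?thesis by simp
  next
    case True
    then have v: "v \<noteq> 0" using assms y by (auto simp: zero_prod_def)
    obtain k where k: "\<phi> (mid, v) = ereal k" "0 < k"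
      using phi_mid_pos[OF v] phi_finite[OF mid, of v] by (cases "\<phi> (mid, v)") auto
    have n: "\<phi> (mid, real n *\<^sub>R v) = ereal (real n powr p * k)" for n
    proof (cases "n = 0")
      case True
      then show ?thesis using phi_fiber_zero[OF phi_finite[OF mid]] by (simp add: zero_ereal_def)
    next
      case False
      then show ?thesis using phi_homogeneous[OF phi_finite[OF mid], of "real n" v] k by simp
    qed
    have diff: "ereal (real (Suc n) powr p * k - real n powr p * k) \<le> recession \<phi> y" for n
    proof -
      have "\<phi> ((mid, real n *\<^sub>R v) + y) - \<phi> (mid, real n *\<^sub>R v) \<le> recession \<phi> y"
        unfolding recession_def by (intro SUP_upper) (use phi_finite[OF mid] in \<open>auto simp: edom_def\<close>)
      moreover have "(mid, real n *\<^sub>R v) + y = (mid, real (Suc n) *\<^sub>R v)"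
        using True y by (simp add: algebra_simps)
      ultimately show ?thesis by (simp only: n ereal_minus)
    qed
    show ?thesis
    proof (rule ccontr)
      assume ninf: "recession \<phi> y \<noteq> \<infinity>"
      have "0 \<le> recession \<phi> y" using diff[of 0] k(2) by (auto intro: order_trans[rotated])
      then obtain s where s: "recession \<phi> y = ereal s" using ninf by (cases "recession \<phi> y") auto
      have le: "real n powr p * k \<le> real n * s" for n
      proof (induction n)
        case (Suc n)
        then show ?case using diff[of n] by (simp add: s algebra_simps)
      qed simp
      \<comment> \<open>Chosen so that \<open>x powr (p - 1) * k\<close> equals \<bar>s\<bar> + k,
        which exceeds s.\<close>
      define x where "x = (\<bar>s\<bar> / k + 1) powr (1 / (p - 1))"
      define n where "n = nat \<lceil>x\<rceil>"
      have sk: "0 < \<bar>s\<bar> / k + 1" using k(2) by (simp add: add_nonneg_pos)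
      then have x: "0 < x" by (simp add: x_def)
      then have n: "x \<le> real n" "0 < real n" unfolding n_def by linarith+
      have "x powr (p - 1) = \<bar>s\<bar> / k + 1"
        using p sk by (simp add: x_def powr_powr)
      then have "\<bar>s\<bar> / k + 1 \<le> real n powr (p - 1)"
        using powr_mono2[of "p - 1" x "real n"] x n p by simp
      moreover have "real n powr p = real n * real n powr (p - 1)"
        using n(2) by (simp add: powr_diff)
      ultimately have "real n * (real n powr (p - 1) * k) \<le> real n * s"
        using le[of n] by (simp add: mult.assoc)
      then have "real n powr (p - 1) * k \<le> s" using n(2) by simp
      moreover have "(\<bar>s\<bar> / k + 1) * k \<le> real n powr (p - 1) * k"
        using \<open>\<bar>s\<bar> / k + 1 \<le> real n powr (p - 1)\<close> k(2) by (intro mult_right_mono) auto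
      moreover have "(\<bar>s\<bar> / k + 1) * k = \<bar>s\<bar> + k" using k(2) by (simp add: field_simps)
      ultimately show False using k(2) by linarith
    qed
  qed
qed

end

section \<open>Integrals of functions that need not be measurable\<close>

text \<open>The action of a curve is not known to be measurable in time, so \<open>nn_integral\<close> is used as a
  lower integral.\<close>

lemma nn_integral_affine_le:
  fixes f :: "real \<Rightarrow> ennreal"
  assumes c: "c \<noteq> 0" and k: "0 < k"
  shows "(\<integral>\<^sup>+x. ennreal k * f (t + c * x) \<partial>lborel) \<le> ennreal (k / \<bar>c\<bar>) * (\<integral>\<^sup>+x. f x \<partial>lborel)"
  unfolding nn_integral_def[of lborel "\<lambda>x. ennreal k * f (t + c * x)"]
proof (rule SUP_least)
  fix g :: "real \<Rightarrow> ennreal"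
  assume "g \<in> {g. simple_function lborel g \<and> g \<le> (\<lambda>x. ennreal k * f (t + c * x))}"
  then have g: "simple_function lborel g" "\<And>x. g x \<le> ennreal k * f (t + c * x)"
    by (auto simp: le_fun_def)
  have [measurable]: "g \<in> borel_measurable borel"
    using borel_measurable_simple_function[OF g(1)] by simp
  \<comment> \<open>The simple function g is transported back through the substitution. Being
    measurable and below f, it can stand in for f in the change of variables.\<close>
  define h where "h y = ennreal (1 / k) * g ((y - t) / c)" for y
  have [measurable]: "h \<in> borel_measurable borel" unfolding h_def by measurable
  have h: "h (t + c * x) = ennreal (1 / k) * g x" for x
    using c by (simp add: h_def)
  have "h y \<le> f y" for y
  proof -
    have "h y \<le> ennreal (1 / k) * (ennreal k * f (t + c * ((y - t) / c)))"
      unfolding h_def by (intro mult_left_mono g) auto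
    also have "\<dots> = f y"
      using k c by (simp add: mult.assoc[symmetric] ennreal_mult[symmetric])
    finally show ?thesis .
  qed
  then have le: "(\<integral>\<^sup>+x. h x \<partial>lborel) \<le> (\<integral>\<^sup>+x. f x \<partial>lborel)"
    by (intro nn_integral_mono) auto
  have "integral\<^sup>S lborel g = (\<integral>\<^sup>+x. g x \<partial>lborel)"
    using g(1) by (simp add: nn_integral_eq_simple_integral)
  also have "\<dots> = ennreal (k / \<bar>c\<bar>) * (ennreal \<bar>c\<bar> * (\<integral>\<^sup>+x. h (t + c * x) \<partial>lborel))"
    unfolding h using c k by (simp add: nn_integral_cmult mult.assoc[symmetric] ennreal_mult[symmetric])
  also have "ennreal \<bar>c\<bar> * (\<integral>\<^sup>+x. h (t + c * x) \<partial>lborel) = (\<integral>\<^sup>+x. h x \<partial>lborel)"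
    using c by (intro nn_integral_real_affine[symmetric]) auto
  also have "ennreal (k / \<bar>c\<bar>) * \<dots> \<le> ennreal (k / \<bar>c\<bar>) * (\<integral>\<^sup>+x. f x \<partial>lborel)"
    by (intro mult_left_mono le) auto
  finally show "integral\<^sup>S lborel g \<le> ennreal (k / \<bar>c\<bar>) * (\<integral>\<^sup>+x. f x \<partial>lborel)" .
qed

lemma nn_integral_cmult_le:
  fixes f :: "real \<Rightarrow> ennreal"
  assumes "0 < k"
  shows "(\<integral>\<^sup>+x. ennreal k * f x \<partial>lborel) \<le> ennreal k * (\<integral>\<^sup>+x. f x \<partial>lborel)"
  using nn_integral_affine_le[of 1 k f 0] assms by simp

text \<open>Lower integrals are not subadditive in general, but every simple function below f can be
  cut along a measurable set.\<close>

lemma nn_integral_split_le: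
  fixes f :: "'b \<Rightarrow> ennreal"
  assumes A[measurable]: "A \<in> sets M"
  shows "(\<integral>\<^sup>+x. f x \<partial>M) \<le> (\<integral>\<^sup>+x. f x * indicator A x \<partial>M) + (\<integral>\<^sup>+x. f x * indicator (- A) x \<partial>M)"
  unfolding nn_integral_def[of M f]
proof (rule SUP_least)
  fix g assume "g \<in> {g. simple_function M g \<and> g \<le> f}"
  then have g: "simple_function M g" "\<And>x. g x \<le> f x"
    by (auto simp: le_fun_def)
  have [measurable]: "g \<in> borel_measurable M"
    by (rule borel_measurable_simple_function[OF g(1)])
  have "integral\<^sup>S M g = (\<integral>\<^sup>+x. g x \<partial>M)"
    using g(1) by (simp add: nn_integral_eq_simple_integral)
  also have "\<dots> = (\<integral>\<^sup>+x. g x * indicator A x + g x * indicator (space M - A) x \<partial>M)"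
    by (intro nn_integral_cong) (auto simp: indicator_def)
  also have "\<dots> = (\<integral>\<^sup>+x. g x * indicator A x \<partial>M) + (\<integral>\<^sup>+x. g x * indicator (space M - A) x \<partial>M)"
    by (intro nn_integral_add) measurable
  also have "\<dots> \<le> (\<integral>\<^sup>+x. f x * indicator A x \<partial>M) + (\<integral>\<^sup>+x. f x * indicator (- A) x \<partial>M)"
    by (intro add_mono nn_integral_mono) (auto simp: indicator_def g(2))
  finally show "integral\<^sup>S M g \<le> (\<integral>\<^sup>+x. f x * indicator A x \<partial>M) + (\<integral>\<^sup>+x. f x * indicator (- A) x \<partial>M)" .
qed

text \<open>If f were infinite on an interval, infinity times the indicator of that interval would
  be a measurable minorant of infinite integral. Density of the times with a finite value is all
  that is used later.\<close>

lemma ex_finite_point: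
  fixes f :: "real \<Rightarrow> ennreal"
  assumes fin: "(\<integral>\<^sup>+t\<in>{0..1}. f t \<partial>lborel) < \<infinity>" and uv: "0 \<le> u" "u < v" "v \<le> 1"
  shows "\<exists>t\<in>{u<..<v}. f t < \<infinity>"
proof (rule ccontr)
  assume "\<not> ?thesis"
  then have inf: "f t = \<infinity>" if "u < t" "t < v" for t
    using that by (metis greaterThanLessThan_iff infinity_ennreal_def less_top)
  have "\<infinity> * emeasure lborel {u<..<v} = (\<integral>\<^sup>+t. \<infinity> * indicator {u<..<v} t \<partial>lborel)"
    by (simp add: nn_integral_cmult_indicator)
  also have "\<dots> \<le> (\<integral>\<^sup>+t\<in>{0..1}. f t \<partial>lborel)"
    using uv inf by (intro nn_integral_mono) (auto simp: indicator_def)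
  finally have "\<infinity> * ennreal (v - u) < \<infinity>"
    using fin uv by (auto simp: less_top[symmetric] top_unique)
  then show False using uv by (simp add: ennreal_mult_eq_top_iff)
qed

section \<open>Pairs of finite action\<close>

definition zero_radon :: "('a::euclidean_space, 'b::euclidean_space) radon" where
  "zero_radon = Abs_radon (\<lambda>B. 0)"

lemma rmeas_zero_radon [simp]: "rmeas zero_radon B = 0"
  unfolding zero_radon_def by (subst rmeas_Abs_radon) auto

lemma is_density_zero_radon: "is_density M (\<lambda>x. 0) zero_radon"
  by (simp add: is_density_def set_integrable_def set_lebesgue_integral_def)

lemma radon_integral_zero_radon [simp]: "radon_integral zero_radon V = 0"
proof -
  have "emeasure (total_variation (zero_radon :: ('a, 'b) radon)) UNIV = 0"
    by (rule total_variation_zero) auto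
  then have "AE x in total_variation (zero_radon :: ('a, 'b) radon). False"
    by (intro AE_I[of _ _ UNIV]) auto
  then have "AE x in total_variation (zero_radon :: ('a, 'b) radon). V x \<bullet> density_wrt (total_variation zero_radon) zero_radon x = 0"
    by eventually_elim simp
  then show ?thesis
    unfolding radon_integral_def by (rule integral_eq_zero_AE)
qed

text \<open>For x above s the power of x with exponent 1 - p is at most that of s. The right side is
  linear in \<open>x powr p\<close>, so it can be integrated against the action; the free s is later
  taken small, at the price of the large coefficient \<open>s powr (1 - p)\<close>.\<close>

lemma young_powr:
  fixes x s p :: real
  assumes p: "1 < p" and s: "0 < s" and x: "0 \<le> x"
  shows "x \<le> s + s powr (1 - p) * x powr p"
proof (cases "x \<le> s")
  case False
  then have "s powr (p - 1) \<le> x powr (p - 1)" using p s by (intro powr_mono2) auto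
  then have "s powr (1 - p) * s powr (p - 1) \<le> s powr (1 - p) * x powr (p - 1)"
    by (rule mult_left_mono) simp
  then have "1 \<le> s powr (1 - p) * x powr (p - 1)"
    using s by (simp flip: powr_add)
  then have "x * 1 \<le> x * (s powr (1 - p) * x powr (p - 1))"
    using x by (rule mult_left_mono)
  also have "\<dots> = s powr (1 - p) * x powr p"
    using False s by (simp add: powr_diff)
  finally show ?thesis using s by simp
qed (use s in \<open>simp add: add_increasing2\<close>)

locale admissible_action = admissible_density p a b \<phi>
  for p a b :: real and \<phi> :: "real \<times> 'a::euclidean_space \<Rightarrow> ereal" +
  fixes \<gamma> :: "'a measure"
  assumes gamma: "nonneg_radon \<gamma>"
begin

lemma sets_gamma [measurable_cong]: "sets \<gamma> = sets borel"
  by (rule nonneg_radon_sets[OF gamma])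

lemma finite_action_densities:
  assumes fin: "action \<phi> \<gamma> \<mu> \<nu> < \<infinity>"
  obtains \<rho> w where "is_density \<gamma> \<rho> \<mu>" "is_density \<gamma> w \<nu>" "AE x in \<gamma>. \<phi> (\<rho> x, w x) < \<infinity>"
    "action \<phi> \<gamma> \<mu> \<nu> = (\<integral>\<^sup>+x. e2ennreal (\<phi> (\<rho> x, w x)) \<partial>\<gamma>)"
proof -
  let ?\<rho> = "ac_density \<gamma> \<mu>" and ?w = "ac_density \<gamma> \<nu>"
  have d: "is_density \<gamma> ?\<rho> \<mu>" "is_density \<gamma> ?w \<nu>"
    using action_finite_density[OF gamma phi_recession fin] by blast+
  note act = action_density[OF gamma d, of \<phi>]
  note [measurable] = is_density_measurable[OF d(1)] is_density_measurable[OF d(2)]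
  have [measurable]: "(\<lambda>x. e2ennreal (\<phi> (?\<rho> x, ?w x))) \<in> borel_measurable \<gamma>" by measurable
  have "AE x in \<gamma>. e2ennreal (\<phi> (?\<rho> x, ?w x)) \<noteq> \<infinity>"
    using fin act by (intro nn_integral_PInf_AE) auto
  then have "AE x in \<gamma>. \<phi> (?\<rho> x, ?w x) < \<infinity>"
    by eventually_elim (auto simp: less_top[symmetric])
  from that[OF d this act] show thesis .
qed

lemma finite_action_between:
  assumes "action \<phi> \<gamma> \<mu> \<nu> < \<infinity>"
  shows "\<mu> \<in> between \<gamma> a b"
proof (rule finite_action_densities[OF assms])
  fix \<rho> w assume "is_density \<gamma> \<rho> \<mu>" and fin: "AE x in \<gamma>. \<phi> (\<rho> x, w x) < \<infinity>"
  from this(1) show ?thesis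
    by (rule density_between[OF gamma]) (rule eventually_mono[OF fin], use phi_dom_bounds in blast)
qed

lemma action_zero_radon:
  assumes "\<mu> \<in> between \<gamma> a b"
  shows "action \<phi> \<gamma> \<mu> zero_radon = 0"
proof -
  obtain \<rho> where \<rho>: "is_density \<gamma> \<rho> \<mu>" "\<And>x. a \<le> \<rho> x" "\<And>x. \<rho> x \<le> b"
    using between_density[OF gamma _ assms] ab by (metis less_imp_le)
  show ?thesis
    unfolding action_density[OF gamma \<rho>(1) is_density_zero_radon] using \<rho>(2,3)
    by (simp add: phi_zero e2ennreal_neg)
qed

text \<open>The zero flux shows that every measure in this set has finite action with some flux.
  Hence the diagonal exception allowed by \<open>pseudo_distance\<close> concerns exactly the
  measures outside it.\<close>

lemma action_domain_eq: "action_domain \<phi> \<gamma> = between \<gamma> a b"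
  unfolding action_domain_def using finite_action_between action_zero_radon
  by (auto intro: exI[of _ zero_radon])

text \<open>Homogeneity of \<phi> under the integral. As an inequality the statement is immediate
  when the action is infinite.\<close>

lemma action_scale_radon_le:
  assumes c: "c \<noteq> 0"
  shows "action \<phi> \<gamma> \<mu> (scale_radon c \<nu>) \<le> ennreal (\<bar>c\<bar> powr p) * action \<phi> \<gamma> \<mu> \<nu>"
proof (cases "action \<phi> \<gamma> \<mu> \<nu> < \<infinity>")
  case True
  then show ?thesis
  proof (rule finite_action_densities)
    fix \<rho> w assume d: "is_density \<gamma> \<rho> \<mu>" "is_density \<gamma> w \<nu>" and fin: "AE x in \<gamma>. \<phi> (\<rho> x, w x) < \<infinity>"
      and act: "action \<phi> \<gamma> \<mu> \<nu> = (\<integral>\<^sup>+x. e2ennreal (\<phi> (\<rho> x, w x)) \<partial>\<gamma>)"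
    note [measurable] = is_density_measurable[OF d(1)] is_density_measurable[OF d(2)]
    have "action \<phi> \<gamma> \<mu> (scale_radon c \<nu>) = (\<integral>\<^sup>+x. e2ennreal (\<phi> (\<rho> x, c *\<^sub>R w x)) \<partial>\<gamma>)"
      by (rule action_density[OF gamma d(1) is_density_scale_radon[OF d(2)]])
    also have "\<dots> = (\<integral>\<^sup>+x. ennreal (\<bar>c\<bar> powr p) * e2ennreal (\<phi> (\<rho> x, w x)) \<partial>\<gamma>)"
    proof (rule nn_integral_cong_AE, rule eventually_mono[OF fin])
      fix x assume x: "\<phi> (\<rho> x, w x) < \<infinity>"
      then obtain r where r: "\<phi> (\<rho> x, w x) = ereal r" "0 \<le> r"
        using phi_nonneg[of "(\<rho> x, w x)"] by (cases "\<phi> (\<rho> x, w x)") auto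
      then show "e2ennreal (\<phi> (\<rho> x, c *\<^sub>R w x)) = ennreal (\<bar>c\<bar> powr p) * e2ennreal (\<phi> (\<rho> x, w x))"
        using phi_homogeneous[OF x c, of "w x"] by (simp add: ennreal_mult)
    qed
    also have "\<dots> = ennreal (\<bar>c\<bar> powr p) * action \<phi> \<gamma> \<mu> \<nu>"
      unfolding act by (rule nn_integral_cmult) measurable
    finally show ?thesis by simp
  qed
next
  case False
  then show ?thesis using c by (simp add: less_top[symmetric] ennreal_mult_top)
qed

text \<open>The Young inequality is applied pointwise to the norm of the flux density, its power
  term is absorbed by coercivity, and the constant term is integrated over S only. The constant c
  depends on \<phi> and p alone.\<close>

lemma action_coercive:
  obtains c where "0 < c" "\<And>\<mu> \<nu> S V L s. bounded_fn S V \<Longrightarrow> (\<And>x. norm (V x) \<le> L) \<Longrightarrow> 0 < L \<Longrightarrow> 0 < s \<Longrightarrow>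
    ennreal \<bar>radon_integral \<nu> V\<bar> \<le> ennreal (L * s * measure \<gamma> S) + ennreal (L * s powr (1 - p) / c) * action \<phi> \<gamma> \<mu> \<nu>"
proof -
  obtain c where c: "0 < c" "\<And>\<rho> w. ereal (c * norm w powr p) \<le> \<phi> (\<rho>, w)"
    using phi_coercive by blast
  show thesis
  proof (rule that[OF c(1)])
    fix \<mu> and \<nu> :: "('a, 'a) radon" and S and V :: "'a \<Rightarrow> 'a" and L s :: real
    assume V: "bounded_fn S V" and L: "\<And>x. norm (V x) \<le> L" "0 < L" and s: "0 < s"
    let ?k = "L * s powr (1 - p) / c"
    have k: "0 < ?k" using L s c by simp
    have S: "bounded_borel S" "\<And>x. x \<notin> S \<Longrightarrow> V x = 0" and [measurable]: "V \<in> borel_measurable borel"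
      using V by (auto simp: bounded_fn_def)
    have [measurable]: "S \<in> sets \<gamma>" using S by (simp add: sets_gamma bounded_borel_def)
    have Sf: "emeasure \<gamma> S = ennreal (measure \<gamma> S)"
      using nonneg_radon_finite[OF gamma, of S] S(1) by (intro emeasure_eq_ennreal_measure) (auto simp: bounded_borel_def)
    show "ennreal \<bar>radon_integral \<nu> V\<bar> \<le> ennreal (L * s * measure \<gamma> S) + ennreal ?k * action \<phi> \<gamma> \<mu> \<nu>"
    proof (cases "action \<phi> \<gamma> \<mu> \<nu> < \<infinity>")
      case True
      then show ?thesis
      proof (rule finite_action_densities)
        fix \<rho> w assume d: "is_density \<gamma> \<rho> \<mu>" "is_density \<gamma> w \<nu>"
          and act: "action \<phi> \<gamma> \<mu> \<nu> = (\<integral>\<^sup>+x. e2ennreal (\<phi> (\<rho> x, w x)) \<partial>\<gamma>)"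
        note [measurable] = is_density_measurable[OF d(1)] is_density_measurable[OF d(2)]
        have "norm (V x \<bullet> w x) \<le> L * s * indicator S x + ?k * (c * norm (w x) powr p)" for x
        proof (cases "x \<in> S")
          case True
          have "norm (V x \<bullet> w x) \<le> norm (V x) * norm (w x)"
            using Cauchy_Schwarz_ineq2 by simp
          also have "\<dots> \<le> L * (s + s powr (1 - p) * norm (w x) powr p)"
            using L by (intro mult_mono young_powr p s) auto
          also have "\<dots> = L * s * indicator S x + ?k * (c * norm (w x) powr p)"
            using True c by (simp add: algebra_simps)
          finally show ?thesis .
        next
          case False
          have "0 \<le> ?k * (c * norm (w x) powr p)" using k c by (intro mult_nonneg_nonneg) auto
          then show ?thesis using S(2)[OF False] False by simp
        qed
        note bound = this
        have le: "ennreal (norm (V x \<bullet> w x)) \<le> ennreal (L * s) * indicator S x + ennreal ?k * e2ennreal (\<phi> (\<rho> x, w x))" for x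
        proof -
          have y: "0 \<le> c * norm (w x) powr p" using c by simp
          have "ennreal (norm (V x \<bullet> w x)) \<le> ennreal (L * s * indicator S x + ?k * (c * norm (w x) powr p))"
            by (rule ennreal_leI[OF bound])
          also have "\<dots> = ennreal (L * s * indicator S x) + ennreal (?k * (c * norm (w x) powr p))"
            using L s by (intro ennreal_plus mult_nonneg_nonneg[OF less_imp_le[OF k] y]) simp
          also have "ennreal (L * s * indicator S x) = ennreal (L * s) * indicator S x"
            by (auto simp: indicator_def)
          also have "ennreal (?k * (c * norm (w x) powr p)) = ennreal ?k * ennreal (c * norm (w x) powr p)"
            by (rule ennreal_mult[OF less_imp_le[OF k] y])
          also have "ennreal (L * s) * indicator S x + \<dots> \<le> ennreal (L * s) * indicator S x + ennreal ?k * e2ennreal (\<phi> (\<rho> x, w x))"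
            using e2ennreal_mono[OF c(2)[of "w x" "\<rho> x"]] by (intro add_left_mono mult_left_mono) auto
          finally show ?thesis .
        qed
        have "ennreal \<bar>radon_integral \<nu> V\<bar> = ennreal (norm (\<integral>x. V x \<bullet> w x \<partial>\<gamma>))"
          by (simp add: radon_integral_density[OF gamma d(2) V])
        also have "\<dots> \<le> (\<integral>\<^sup>+x. ennreal (norm (V x \<bullet> w x)) \<partial>\<gamma>)"
          by (rule integral_norm_bound_ennreal[OF bounded_fn_integrable(1)[OF gamma d(2) V]])
        also have "\<dots> \<le> (\<integral>\<^sup>+x. ennreal (L * s) * indicator S x + ennreal ?k * e2ennreal (\<phi> (\<rho> x, w x)) \<partial>\<gamma>)"
          by (intro nn_integral_mono le)
        also have "\<dots> = (\<integral>\<^sup>+x. ennreal (L * s) * indicator S x \<partial>\<gamma>) + (\<integral>\<^sup>+x. ennreal ?k * e2ennreal (\<phi> (\<rho> x, w x)) \<partial>\<gamma>)"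
          by (intro nn_integral_add) measurable
        also have "(\<integral>\<^sup>+x. ennreal (L * s) * indicator S x \<partial>\<gamma>) = ennreal (L * s * measure \<gamma> S)"
          using L s by (simp add: nn_integral_cmult_indicator Sf ennreal_mult)
        also have "(\<integral>\<^sup>+x. ennreal ?k * e2ennreal (\<phi> (\<rho> x, w x)) \<partial>\<gamma>) = ennreal ?k * action \<phi> \<gamma> \<mu> \<nu>"
          unfolding act by (rule nn_integral_cmult) measurable
        finally show ?thesis .
      qed
    next
      case False
      then show ?thesis using L(2) s c(1) by (simp add: less_top[symmetric] ennreal_mult_top)
    qed
  qed
qed

end

section \<open>Time-dependent test functions\<close>

text \<open>The support is compact in space, uniformly in time, while time itself is
  unrestricted.\<close>

definition slice_fn :: "'a::euclidean_space set \<Rightarrow> ('a \<times> real \<Rightarrow> 'b::euclidean_space) \<Rightarrow> bool" where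
  "slice_fn K q \<longleftrightarrow> compact K \<and> continuous_on UNIV q \<and> (\<forall>x t. x \<notin> K \<longrightarrow> q (x, t) = 0)"

lemma slice_fn_continuous:
  assumes "slice_fn K q"
  shows "continuous_on UNIV (\<lambda>x. q (x, t))"
proof (rule continuous_on_compose2[of UNIV q])
  show "continuous_on UNIV (\<lambda>x. (x, t))" by (intro continuous_intros)
qed (use assms in \<open>auto simp: slice_fn_def\<close>)

lemma slice_fn_bounded_fn: "slice_fn K q \<Longrightarrow> bounded_fn K (\<lambda>x. q (x, t))"
  using slice_fn_continuous[of K q t] by (auto simp: slice_fn_def intro: bounded_fn_continuous)

text \<open>Uniform continuity on a compact time interval. The margin of 1 around the unit interval
  leaves room for sampled times and for difference quotients at the end points.\<close>

lemma slice_fn_uniform: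
  assumes q: "slice_fn K q" and e: "0 < e"
  obtains d where "0 < d" "\<And>s t x. s \<in> {-1..2} \<Longrightarrow> t \<in> {-1..2} \<Longrightarrow> \<bar>s - t\<bar> < d \<Longrightarrow> norm (q (x, s) - q (x, t)) \<le> e"
proof -
  have "compact (K \<times> {-1..2::real})" "continuous_on (K \<times> {-1..2}) q"
    using q by (auto simp: slice_fn_def intro: compact_Times continuous_on_subset)
  then have "uniformly_continuous_on (K \<times> {-1..2}) q"
    by (intro compact_uniformly_continuous)
  then obtain d where d: "0 < d" "\<And>z z'. z \<in> K \<times> {-1..2} \<Longrightarrow> z' \<in> K \<times> {-1..2} \<Longrightarrow> dist z' z < d \<Longrightarrow> dist (q z') (q z) < e"
    using e unfolding uniformly_continuous_on_def by metis
  show thesis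
  proof (rule that[OF d(1)])
    fix s t :: real and x assume st: "s \<in> {-1..2}" "t \<in> {-1..2}" "\<bar>s - t\<bar> < d"
    show "norm (q (x, s) - q (x, t)) \<le> e"
    proof (cases "x \<in> K")
      case True
      have "dist (x, s) (x, t) < d" using st by (simp add: dist_Pair_Pair dist_real_def)
      then have "dist (q (x, s)) (q (x, t)) < e" using True st by (intro d(2)) auto
      then show ?thesis by (simp add: dist_norm)
    next
      case False
      then have "q (x, s) = 0" "q (x, t) = 0" using q by (auto simp: slice_fn_def)
      then show ?thesis using e by simp
    qed
  qed
qed

lemma slice_fn_bound:
  assumes q: "slice_fn K q"
  obtains L where "0 < L" "\<And>t x. t \<in> {0..1} \<Longrightarrow> norm (q (x, t)) \<le> L"
proof -
  have "bounded (q ` (K \<times> {0..1}))"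
    using q by (intro compact_imp_bounded compact_continuous_image compact_Times) (auto simp: slice_fn_def intro: continuous_on_subset)
  then obtain L where L: "0 < L" "\<And>z. z \<in> K \<times> {0..1} \<Longrightarrow> norm (q z) \<le> L"
    unfolding bounded_pos by blast
  have "norm (q (x, t)) \<le> L" if "t \<in> {0..1}" for t x
  proof (cases "x \<in> K")
    case False
    then have "q (x, t) = 0" using q by (auto simp: slice_fn_def)
    then show ?thesis using L by simp
  qed (use L that in auto)
  with L(1) show thesis by (rule that)
qed

text \<open>Time is rounded down to a grid inside q only. For each of the countably many grid values
  the integrand is fixed and the previous measurability result applies; uniform continuity of q in
  time gives the limit.\<close>

lemma slice_measurable:
  fixes \<nu> :: "real \<Rightarrow> ('a::euclidean_space, 'b::euclidean_space) radon"
  assumes meas: "\<And>B. bounded_borel B \<Longrightarrow> (\<lambda>t. rmeas (\<nu> t) B) \<in> borel_measurable (restrict_space borel {0..1})"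
    and q: "slice_fn K q"
  shows "(\<lambda>t. radon_integral (\<nu> t) (\<lambda>x. q (x, t))) \<in> borel_measurable (restrict_space borel {0..1})"
proof (rule borel_measurable_LIMSEQ_real)
  let ?s = "\<lambda>n t. of_int \<lfloor>real (Suc n) * t\<rfloor> / real (Suc n)"
  fix n :: nat
  show "(\<lambda>t. radon_integral (\<nu> t) (\<lambda>x. q (x, ?s n t))) \<in> borel_measurable (restrict_space borel {0..1})"
  proof (rule measurable_compose_countable[where g = "\<lambda>t. \<lfloor>real (Suc n) * t\<rfloor>"])
    show "(\<lambda>t. radon_integral (\<nu> t) (\<lambda>x. q (x, of_int i / real (Suc n)))) \<in> borel_measurable (restrict_space borel {0..1})" for i :: int
      by (rule radon_integral_measurable[OF meas slice_fn_bounded_fn[OF q]])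
    have "(\<lambda>t. \<lfloor>real (Suc n) * t\<rfloor>) \<in> measurable borel (count_space UNIV)" by measurable
    then show "(\<lambda>t. \<lfloor>real (Suc n) * t\<rfloor>) \<in> measurable (restrict_space borel {0..1}) (count_space UNIV)"
      by (rule measurable_restrict_space1)
  qed
next
  let ?s = "\<lambda>n t. of_int \<lfloor>real (Suc n) * t\<rfloor> / real (Suc n)"
  fix t :: real assume "t \<in> space (restrict_space borel {0..1})"
  then have t: "t \<in> {0..1}" by (simp add: space_restrict_space)
  let ?D = "DIM('b) * measure (total_variation (\<nu> t)) K"
  have D: "0 \<le> ?D" by simp
  show "(\<lambda>n. radon_integral (\<nu> t) (\<lambda>x. q (x, ?s n t))) \<longlonglongrightarrow> radon_integral (\<nu> t) (\<lambda>x. q (x, t))"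
  proof (rule LIMSEQ_I)
    fix e :: real assume e: "0 < e"
    define e' where "e' = e / (?D + 1)"
    have e': "0 < e'" using e D by (simp add: e'_def add_nonneg_pos)
    obtain d where d: "0 < d" "\<And>s t x. s \<in> {-1..2} \<Longrightarrow> t \<in> {-1..2} \<Longrightarrow> \<bar>s - t\<bar> < d \<Longrightarrow> norm (q (x, s) - q (x, t)) \<le> e'"
      using slice_fn_uniform[OF q e'] by metis
    obtain N where N: "inverse (real (Suc N)) < d" using reals_Archimedean[OF d(1)] by blast
    show "\<exists>no. \<forall>n\<ge>no. norm (radon_integral (\<nu> t) (\<lambda>x. q (x, ?s n t)) - radon_integral (\<nu> t) (\<lambda>x. q (x, t))) < e"
    proof (intro exI[of _ N] allI impI)
      fix n assume "N \<le> n"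
      then have "inverse (real (Suc n)) \<le> inverse (real (Suc N))" by simp
      moreover have sl: "?s n t \<le> t" "t \<le> ?s n t + inverse (real (Suc n))"
      proof -
        have "of_int \<lfloor>real (Suc n) * t\<rfloor> \<le> real (Suc n) * t" "real (Suc n) * t \<le> of_int \<lfloor>real (Suc n) * t\<rfloor> + 1" by linarith+
        then show "?s n t \<le> t" "t \<le> ?s n t + inverse (real (Suc n))" by (auto simp: field_simps)
      qed
      ultimately have "\<bar>?s n t - t\<bar> < d" using N by linarith
      moreover have "inverse (real (Suc n)) \<le> 1" by (simp add: inverse_le_1_iff)
      then have "?s n t \<in> {-1..2}" using sl t by auto
      ultimately have le: "norm (q (x, ?s n t) - q (x, t)) \<le> e'" for x using t by (intro d(2)) auto
      have "\<bar>radon_integral (\<nu> t) (\<lambda>x. q (x, ?s n t) - q (x, t))\<bar> \<le> e' * ?D"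
        by (rule radon_integral_bound[OF bounded_fn_diff[OF slice_fn_bounded_fn[OF q] slice_fn_bounded_fn[OF q]] le])
      also have "e' * ?D < e' * (?D + 1)" using e' by (intro mult_strict_left_mono) auto
      also have "\<dots> = e"
      proof -
        have "?D + 1 \<noteq> 0" using D by linarith
        then show ?thesis by (simp add: e'_def)
      qed
      finally show "norm (radon_integral (\<nu> t) (\<lambda>x. q (x, ?s n t)) - radon_integral (\<nu> t) (\<lambda>x. q (x, t))) < e"
        by (simp add: radon_integral_diff[OF slice_fn_bounded_fn[OF q] slice_fn_bounded_fn[OF q]])
    qed
  qed
qed

lemma slice_integrable:
  fixes \<nu> :: "real \<Rightarrow> ('a::euclidean_space, 'b::euclidean_space) radon"
  assumes meas: "\<And>B. bounded_borel B \<Longrightarrow> (\<lambda>t. rmeas (\<nu> t) B) \<in> borel_measurable (restrict_space borel {0..1})"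
    and fin: "\<And>R. 0 < R \<Longrightarrow> (\<integral>\<^sup>+t\<in>{0..1}. emeasure (total_variation (\<nu> t)) (ball 0 R) \<partial>lborel) < \<infinity>"
    and q: "slice_fn K q"
  shows "set_integrable lborel {0..1} (\<lambda>t. radon_integral (\<nu> t) (\<lambda>x. q (x, t)))"
proof -
  let ?u = "\<lambda>t. radon_integral (\<nu> t) (\<lambda>x. q (x, t))"
  obtain L where L: "0 < L" "\<And>t x. t \<in> {0..1} \<Longrightarrow> norm (q (x, t)) \<le> L" using slice_fn_bound[OF q] by metis
  have "bounded K" using q by (auto simp: slice_fn_def compact_imp_bounded)
  then obtain R where R: "0 < R" "K \<subseteq> ball 0 R" using bounded_subset_ballD by blast
  have bd: "ennreal (norm (?u t)) \<le> ennreal (L * DIM('b)) * emeasure (total_variation (\<nu> t)) (ball 0 R)" if t: "t \<in> {0..1}" for t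
  proof -
    have fin': "emeasure (total_variation (\<nu> t)) (ball 0 R) < \<infinity>"
      by (rule nonneg_radon_finite[OF nonneg_radon_total_variation]) simp
    have "norm (?u t) \<le> L * (DIM('b) * measure (total_variation (\<nu> t)) (ball 0 R))"
      using radon_integral_bound[OF bounded_fn_mono[OF slice_fn_bounded_fn[OF q] R(2)] L(2)[OF t]] by simp
    then have "ennreal (norm (?u t)) \<le> ennreal ((L * DIM('b)) * measure (total_variation (\<nu> t)) (ball 0 R))"
      by (intro ennreal_leI) (simp add: mult.assoc)
    also have "\<dots> = ennreal (L * DIM('b)) * emeasure (total_variation (\<nu> t)) (ball 0 R)"
      using L(1) fin' by (subst ennreal_mult) (auto simp: emeasure_eq_ennreal_measure)
    finally show ?thesis .
  qed
  have m: "(\<lambda>t. indicator {0..1} t *\<^sub>R ?u t) \<in> borel_measurable borel"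
    using slice_measurable[OF meas q] by (subst borel_measurable_restrict_space_iff[symmetric]) auto
  have "(\<integral>\<^sup>+t. ennreal (norm (indicator {0..1} t *\<^sub>R ?u t)) \<partial>lborel) \<le>
      (\<integral>\<^sup>+t. ennreal (L * DIM('b)) * (emeasure (total_variation (\<nu> t)) (ball 0 R) * indicator {0..1} t) \<partial>lborel)"
    using bd by (intro nn_integral_mono) (auto simp: indicator_def)
  also have "\<dots> \<le> ennreal (L * DIM('b)) * (\<integral>\<^sup>+t. emeasure (total_variation (\<nu> t)) (ball 0 R) * indicator {0..1} t \<partial>lborel)"
    using L(1) by (intro nn_integral_cmult_le) simp
  also have "\<dots> < \<infinity>"
    using fin[OF R(1)] by (simp add: ennreal_mult_less_top)
  finally show ?thesis
    unfolding set_integrable_def using m by (intro integrableI_bounded) auto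
qed

text \<open>Unlike in \<open>C1c_test\<close>, nothing is required near the ends of the time
  interval. The class is stable under affine changes of time and contains functions constant in
  time.\<close>

definition spatial_test :: "'a::euclidean_space set \<Rightarrow> ('a \<times> real \<Rightarrow> real) \<Rightarrow> ('a \<times> real \<Rightarrow> 'a \<times> real) \<Rightarrow> bool" where
  "spatial_test K \<zeta> g \<longleftrightarrow> compact K \<and> (\<forall>z. GDERIV \<zeta> z :> g z) \<and> continuous_on UNIV g \<and> (\<forall>x t. x \<notin> K \<longrightarrow> \<zeta> (x, t) = 0)"

lemma spatial_test_slices:
  assumes "spatial_test K \<zeta> g"
  shows "slice_fn K \<zeta>" "slice_fn K (\<lambda>z. snd (g z))" "slice_fn K (\<lambda>z. fst (g z))"
proof -
  have K: "compact K" and d: "\<And>z. GDERIV \<zeta> z :> g z" and g: "continuous_on UNIV g"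
    and z: "\<And>x t. x \<notin> K \<Longrightarrow> \<zeta> (x, t) = 0"
    using assms by (auto simp: spatial_test_def)
  have "continuous_on UNIV \<zeta>"
    using d unfolding gderiv_def by (intro continuous_at_imp_continuous_on ballI has_derivative_continuous)
  then show "slice_fn K \<zeta>" using K z by (simp add: slice_fn_def)
  \<comment> \<open>The complement of K is open and \<zeta> vanishes on it, so its gradient vanishes
    there by uniqueness of the derivative.\<close>
  have g0: "g (x, t) = 0" if x: "x \<notin> K" for x t
  proof -
    have "((\<lambda>z. 0) has_derivative (\<lambda>h. h \<bullet> g (x, t))) (at (x, t))"
    proof (rule has_derivative_transform_within_open)
      show "(\<zeta> has_derivative (\<lambda>h. h \<bullet> g (x, t))) (at (x, t))" using d by (simp add: gderiv_def)
      show "open ((- K) \<times> (UNIV :: real set))" using K by (intro open_Times) (auto simp: compact_imp_closed open_Compl)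
      show "(x, t) \<in> (- K) \<times> UNIV" using x by simp
      show "\<zeta> y = 0" if "y \<in> (- K) \<times> UNIV" for y using that z by (cases y) auto
    qed
    from has_derivative_unique[OF this has_derivative_const] have "g (x, t) \<bullet> g (x, t) = 0" by metis
    then show ?thesis by simp
  qed
  show "slice_fn K (\<lambda>z. snd (g z))" "slice_fn K (\<lambda>z. fst (g z))"
    using K g g0 by (auto simp: slice_fn_def intro: continuous_intros)
qed

section \<open>Cutoff functions\<close>

lemma DERIV_max_0_square: "((\<lambda>x::real. (max 0 x)\<^sup>2) has_real_derivative 2 * max 0 x) (at x)"
proof -
  consider "x < 0" | "x > 0" | "x = 0" by linarith
  then show ?thesis
  proof cases
    case 1
    have "((\<lambda>x::real. 0) has_real_derivative 2 * max 0 x) (at x)" using 1 by simp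
    then show ?thesis
      by (rule has_field_derivative_transform_within_open[of _ _ _ "{..<0}"]) (use 1 in auto)
  next
    case 2
    have "((\<lambda>x::real. x\<^sup>2) has_real_derivative 2 * max 0 x) (at x)"
      using 2 by (auto intro!: derivative_eq_intros)
    then show ?thesis
      by (rule has_field_derivative_transform_within_open[of _ _ _ "{0<..}"]) (use 2 in auto)
  next
    case 3
    have "((\<lambda>h::real. (max 0 h)\<^sup>2 / h) \<longlongrightarrow> 0) (at 0)"
    proof (rule Lim_null_comparison)
      show "\<forall>\<^sub>F h in at 0. norm ((max 0 h)\<^sup>2 / h) \<le> \<bar>h::real\<bar>"
        by (intro always_eventually allI) (auto simp: max_def power2_eq_square)
      show "((\<lambda>h. \<bar>h::real\<bar>) \<longlongrightarrow> 0) (at 0)" by (auto intro!: tendsto_eq_intros)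
    qed
    then show ?thesis using 3 by (simp add: DERIV_def)
  qed
qed

text \<open>A quadratic spline that is continuously differentiable and rises from 0 to 1 on the unit
  interval: convex on the first half, concave on the second.\<close>

definition step :: "real \<Rightarrow> real" where
  "step s = 2 * (max 0 s)\<^sup>2 - 4 * (max 0 (s - 1/2))\<^sup>2 + 2 * (max 0 (s - 1))\<^sup>2"

text \<open>The hat function of height 2 over the unit interval, of total mass 1.\<close>

definition step' :: "real \<Rightarrow> real" where
  "step' s = 4 * max 0 s - 8 * max 0 (s - 1/2) + 4 * max 0 (s - 1)"

lemma step_0: "s \<le> 0 \<Longrightarrow> step s = 0" by (simp add: step_def)

lemma step_1: "1 \<le> s \<Longrightarrow> step s = 1"
  by (simp add: step_def max_def power2_eq_square algebra_simps)

lemma step'_nonneg: "0 \<le> step' s" by (simp add: step'_def max_def)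

lemma step'_0: "s \<le> 0 \<or> 1 \<le> s \<Longrightarrow> step' s = 0" by (auto simp: step'_def max_def)

lemma step_DERIV: "(step has_real_derivative step' s) (at s)"
proof -
  have *: "((\<lambda>s::real. (max 0 (s - c))\<^sup>2) has_real_derivative 2 * max 0 (s - c)) (at s)" for c
  proof -
    have "((\<lambda>s::real. s - c) has_real_derivative 1) (at s)" by (auto intro!: derivative_eq_intros)
    from DERIV_chain2[OF DERIV_max_0_square this] show ?thesis by simp
  qed
  have "((\<lambda>s. 2 * (max 0 (s - 0))\<^sup>2 - 4 * (max 0 (s - 1/2))\<^sup>2 + 2 * (max 0 (s - 1))\<^sup>2) has_real_derivative
      2 * (2 * max 0 (s - 0)) - 4 * (2 * max 0 (s - 1/2)) + 2 * (2 * max 0 (s - 1))) (at s)"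
    by (intro DERIV_add DERIV_diff DERIV_cmult *)
  then show ?thesis by (simp add: step_def[abs_def] step'_def)
qed

lemma step'_continuous: "continuous_on S step'"
  unfolding step'_def[abs_def] by (intro continuous_intros)

lemma step_bounds: "0 \<le> step s" "step s \<le> 1"
proof -
  have mono: "step x \<le> step y" if "x \<le> y" for x y
    using DERIV_nonneg_imp_nondecreasing[OF that, of step] step_DERIV step'_nonneg by blast
  show "0 \<le> step s" using mono[of "min s 0" s] step_0[of "min s 0"] by simp
  show "step s \<le> 1" using mono[of s "max s 1"] step_1[of "max s 1"] by simp
qed

text \<open>The kernel is nonnegative, has mass 1 and lives between 1 / n and 2 / n, so it
  concentrates at the left end point.\<close>

lemma step_delta:
  assumes F: "continuous_on {0..1} F"
  shows "(\<lambda>n. LBINT t:{0..1}. (real n * step' (real n * t - 1)) * F t) \<longlonglongrightarrow> F 0"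
proof (rule LIMSEQ_I)
  fix e :: real assume e: "0 < e"
  have "0 \<in> {0..1::real}" by simp
  then obtain d where d: "0 < d" "\<And>t. t \<in> {0..1} \<Longrightarrow> dist t 0 < d \<Longrightarrow> dist (F t) (F 0) < e / 2"
    using F e unfolding continuous_on_iff by (metis half_gt_zero)
  \<comment> \<open>The bound n > 2 puts the support of the kernel inside the unit interval, and n >
    2 / d puts it where F is close to \<open>F 0\<close>.\<close>
  obtain N where N: "2 / d + 2 < real N" using reals_Archimedean2 by blast
  show "\<exists>no. \<forall>n\<ge>no. norm ((LBINT t:{0..1}. (real n * step' (real n * t - 1)) * F t) - F 0) < e"
  proof (intro exI[of _ N] allI impI)
    fix n assume "N \<le> n"
    then have n: "2 / d + 2 < real n" using N by linarith
    have n2: "2 < real n" "2 < real n * d"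
    proof -
      show "2 < real n" using n d(1) by (smt (verit) divide_pos_pos)
      have "2 / d < real n" using n by linarith
      then show "2 < real n * d" using d(1) by (simp add: field_simps)
    qed
    let ?k = "\<lambda>t. real n * step' (real n * t - 1)"
    have ck: "continuous_on S ?k" for S
      by (intro continuous_intros continuous_on_compose2[OF step'_continuous[of UNIV]]) auto
    have k0: "0 \<le> ?k t" for t using step'_nonneg by simp
    have ik: "set_integrable lborel {0..1} ?k" by (rule borel_integrable_atLeastAtMost'[OF ck])
    have iF: "set_integrable lborel {0..1} (\<lambda>t. ?k t * F t)"
      by (intro borel_integrable_atLeastAtMost' continuous_on_mult ck F)
    have "((\<lambda>t. step (real n * t - 1)) has_real_derivative ?k t) (at t)" for t
    proof -
      have "((\<lambda>t. real n * t - 1) has_real_derivative real n) (at t)" by (auto intro!: derivative_eq_intros)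
      from DERIV_chain2[OF step_DERIV this] show ?thesis by (simp add: mult.commute)
    qed
    then have "(\<integral>t. ?k t * indicator {0..1} t \<partial>lborel) = step (real n * 1 - 1) - step (real n * 0 - 1)"
      by (intro integral_FTC_Icc_real continuous_on_imp_continuous_within[OF ck[of UNIV]]) auto
    then have k1: "(LBINT t:{0..1}. ?k t) = 1"
      unfolding set_lebesgue_integral_def real_scaleR_def
      using step_1[of "real n * 1 - 1"] step_0[of "real n * 0 - 1"] n2(1) by (simp only: mult.commute)
    have "(LBINT t:{0..1}. ?k t * F t) - F 0 = (LBINT t:{0..1}. ?k t * F t) - (LBINT t:{0..1}. ?k t * F 0)"
      using k1 by simp
    also have "\<dots> = (LBINT t:{0..1}. ?k t * (F t - F 0))"
      using ik iF by (subst set_integral_diff(2)[symmetric]) (auto simp: algebra_simps)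
    finally have eq: "(LBINT t:{0..1}. ?k t * F t) - F 0 = (LBINT t:{0..1}. ?k t * (F t - F 0))" .
    have iD: "set_integrable lborel {0..1} (\<lambda>t. ?k t * (F t - F 0))"
      by (intro borel_integrable_atLeastAtMost' continuous_on_mult continuous_on_diff continuous_on_const ck F)
    have le: "\<bar>?k t * (F t - F 0)\<bar> \<le> ?k t * (e / 2)" if t: "t \<in> {0..1}" for t
    proof (cases "t < d")
      case True
      then have "\<bar>F t - F 0\<bar> \<le> e / 2" using d(2)[OF t] t by (simp add: dist_real_def)
      then show ?thesis
        unfolding abs_mult[of "?k t"] abs_of_nonneg[OF k0] by (rule mult_left_mono[OF _ k0])
    next
      case False
      then have "real n * d \<le> real n * t" by (intro mult_left_mono) auto
      then have "1 \<le> real n * t - 1" using n2 by linarith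
      then have "?k t = 0" by (simp add: step'_0)
      then show ?thesis by (simp only: mult_zero_left abs_zero order_refl)
    qed
    have "\<bar>LBINT t:{0..1}. ?k t * (F t - F 0)\<bar> \<le> (LBINT t:{0..1}. \<bar>?k t * (F t - F 0)\<bar>)"
      using set_integral_norm_bound[OF iD] by simp
    also have "\<dots> \<le> (LBINT t:{0..1}. ?k t * (e / 2))"
      using le iD ik by (intro set_integral_mono) (auto simp: set_integrable_abs)
    also have "\<dots> = e / 2" using k1 by simp
    finally show "norm ((LBINT t:{0..1}. ?k t * F t) - F 0) < e"
      using eq e by simp
  qed
qed

lemma set_integral_reflect:
  fixes f :: "real \<Rightarrow> real"
  shows "(LBINT t:{0..1}. f (1 - t)) = (LBINT t:{0..1}. f t)"
proof -
  have "(LBINT t:{0..1}. f t) = (\<integral>t. indicator {0..1} (1 + (-1) * t) *\<^sub>R f (1 + (-1) * t) \<partial>lborel)"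
    unfolding set_lebesgue_integral_def
    using lborel_integral_real_affine[of "-1" "\<lambda>t. indicator {0..1} t *\<^sub>R f t" 1] by simp
  also have "\<dots> = (LBINT t:{0..1}. f (1 - t))"
    unfolding set_lebesgue_integral_def by (intro Bochner_Integration.integral_cong) (auto simp: indicator_def)
  finally show ?thesis by simp
qed

lemma step_delta_right:
  assumes F: "continuous_on {0..1} F"
  shows "(\<lambda>n. LBINT t:{0..1}. (real n * step' (real n * (1 - t) - 1)) * F t) \<longlonglongrightarrow> F 1"
proof -
  have "continuous_on {0..1} (\<lambda>t. F (1 - t))"
    by (intro continuous_on_compose2[OF F] continuous_intros) auto
  from step_delta[OF this] show ?thesis
    using set_integral_reflect[of "\<lambda>t. (real n * step' (real n * (1 - t) - 1)) * F t" for n] by simp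
qed

text \<open>Rises from 0 to 1 between 1 / n and 2 / n and falls symmetrically at the other end. For
  n at least 4 one of the two steps always equals 1, so the sum minus 1 agrees with the product,
  while its derivative is just a difference of two kernels.\<close>

definition cutoff :: "nat \<Rightarrow> real \<Rightarrow> real" where
  "cutoff n t = step (real n * t - 1) + step (real n * (1 - t) - 1) - 1"

definition cutoff' :: "nat \<Rightarrow> real \<Rightarrow> real" where
  "cutoff' n t = real n * step' (real n * t - 1) - real n * step' (real n * (1 - t) - 1)"

lemma cutoff_DERIV: "(cutoff n has_real_derivative cutoff' n t) (at t)"
proof -
  have 1: "((\<lambda>t. step (real n * t - 1)) has_real_derivative step' (real n * t - 1) * real n) (at t)"
    by (rule DERIV_chain2[OF step_DERIV]) (auto intro!: derivative_eq_intros)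
  have 2: "((\<lambda>t. step (real n * (1 - t) - 1)) has_real_derivative step' (real n * (1 - t) - 1) * (- real n)) (at t)"
    by (rule DERIV_chain2[OF step_DERIV]) (auto intro!: derivative_eq_intros)
  show ?thesis
    unfolding cutoff_def[abs_def] cutoff'_def
    by (rule DERIV_cong[OF DERIV_diff[OF DERIV_add[OF 1 2] DERIV_const]]) simp
qed

lemma cutoff_bounds: "\<bar>cutoff n t\<bar> \<le> 1"
  unfolding cutoff_def using step_bounds[of "real n * t - 1"] step_bounds[of "real n * (1 - t) - 1"] by linarith

lemma cutoff_outside:
  assumes n: "4 \<le> n" and t: "t < 1 / real n \<or> 1 - 1 / real n < t"
  shows "cutoff n t = 0"
proof -
  have n0: "4 \<le> real n" "0 < real n" using n by auto
  from t show ?thesis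
  proof
    assume "t < 1 / real n"
    then have "real n * t < 1" using n0 by (simp add: field_simps)
    then show ?thesis unfolding cutoff_def using n0 by (simp add: step_0 step_1 algebra_simps)
  next
    assume "1 - 1 / real n < t"
    then have "real n - 1 < real n * t" using n0 by (simp add: field_simps)
    then show ?thesis unfolding cutoff_def using n0 by (simp add: step_0 step_1 algebra_simps)
  qed
qed

lemma cutoff_tendsto:
  assumes "0 < t" "t < 1"
  shows "(\<lambda>n. cutoff n t) \<longlonglongrightarrow> 1"
proof (rule tendsto_eventually)
  have "\<forall>\<^sub>F n in sequentially. 2 / t < real n" "\<forall>\<^sub>F n in sequentially. 2 / (1 - t) < real n"
    by (rule eventually_compose_filterlim[OF eventually_gt_at_top filterlim_real_sequentially])+
  then show "\<forall>\<^sub>F n in sequentially. cutoff n t = 1"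
  proof eventually_elim
    case (elim n)
    then have "2 < real n * t" "2 < real n * (1 - t)" using assms by (simp_all add: field_simps)
    then show ?case by (simp add: cutoff_def step_1)
  qed
qed

section \<open>Curves of finite action\<close>

lemma finite_action_curvesD:
  assumes "(\<mu>, \<nu>) \<in> finite_action_curves \<phi> \<gamma> x y"
  shows "\<mu> 0 = x" "\<mu> 1 = y" "continuous_map (top_of_set {0..1}) weak_star \<mu>"
    "\<And>B. bounded_borel B \<Longrightarrow> (\<lambda>t. rmeas (\<nu> t) B) \<in> borel_measurable (restrict_space borel {0..1})"
    "\<And>R. 0 < R \<Longrightarrow> (\<integral>\<^sup>+t\<in>{0..1}. emeasure (total_variation (\<nu> t)) (ball 0 R) \<partial>lborel) < \<infinity>"
    "(\<integral>\<^sup>+t\<in>{0..1}. action \<phi> \<gamma> (\<mu> t) (\<nu> t) \<partial>lborel) < \<infinity>"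
    "\<And>\<zeta> g. C1c_test 1 \<zeta> g \<Longrightarrow>
        (LBINT t:{0..1}. radon_integral (\<mu> t) (\<lambda>x. snd (g (x, t)))) +
        (LBINT t:{0..1}. radon_integral (\<nu> t) (\<lambda>x. fst (g (x, t)))) = 0"
  using assms unfolding finite_action_curves_def continuity_equation_def total_action_def by auto

lemma C1c_test_cutoff:
  assumes \<zeta>: "spatial_test K \<zeta> g" and n: "4 \<le> n"
  shows "C1c_test 1 (\<lambda>z. cutoff n (snd z) * \<zeta> z)
    (\<lambda>z. cutoff n (snd z) *\<^sub>R g z + \<zeta> z *\<^sub>R (cutoff' n (snd z) *\<^sub>R (0, 1)))"
  unfolding C1c_test_def
proof (intro conjI allI exI[of _ "K \<times> {1 / real n..1 - 1 / real n}"] impI)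
  have K: "compact K" and d: "\<And>z. GDERIV \<zeta> z :> g z" and g: "continuous_on UNIV g"
    and z: "\<And>x t. x \<notin> K \<Longrightarrow> \<zeta> (x, t) = 0"
    using \<zeta> by (auto simp: spatial_test_def)
  have n0: "0 < 1 / real n" "1 / real n < 1" using n by auto
  fix z :: "'a \<times> real"
  have "GDERIV snd z :> (0 :: 'a, 1)"
    unfolding gderiv_def using bounded_linear_imp_has_derivative[OF bounded_linear_snd]
    by (simp add: inner_prod_def)
  from GDERIV_DERIV_compose[OF this cutoff_DERIV]
  show "GDERIV (\<lambda>z. cutoff n (snd z) * \<zeta> z) z :> cutoff n (snd z) *\<^sub>R g z + \<zeta> z *\<^sub>R (cutoff' n (snd z) *\<^sub>R (0, 1))"
    by (rule GDERIV_mult[OF _ d])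
  have c: "continuous_on UNIV (cutoff n)"
    using cutoff_DERIV[of n] by (intro continuous_at_imp_continuous_on ballI) (auto intro: DERIV_isCont)
  have c': "continuous_on UNIV (cutoff' n)"
    unfolding cutoff'_def[abs_def]
    by (intro continuous_intros continuous_on_compose2[OF step'_continuous[of UNIV]]) auto
  have s: "continuous_on UNIV \<zeta>"
    using spatial_test_slices(1)[OF \<zeta>] by (simp add: slice_fn_def)
  show "continuous_on UNIV (\<lambda>z. cutoff n (snd z) *\<^sub>R g z + \<zeta> z *\<^sub>R (cutoff' n (snd z) *\<^sub>R (0, 1)))"
    by (intro continuous_intros g s continuous_on_compose2[OF c] continuous_on_compose2[OF c']) auto
  show "compact (K \<times> {1 / real n..1 - 1 / real n})"
    using K by (intro compact_Times) auto
  show "K \<times> {1 / real n..1 - 1 / real n} \<subseteq> UNIV \<times> {0<..<1}"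
  proof -
    have "{1 / real n..1 - 1 / real n} \<subseteq> {0<..<1}"
      using n0 by (intro subsetI) (simp only: atLeastAtMost_iff greaterThanLessThan_iff, linarith)
    then show ?thesis by blast
  qed
  assume "z \<notin> K \<times> {1 / real n..1 - 1 / real n}"
  then consider "fst z \<notin> K" | "snd z < 1 / real n \<or> 1 - 1 / real n < snd z"
    by (cases z) (auto simp: not_le)
  then show "cutoff n (snd z) * \<zeta> z = 0"
    using z[of "fst z" "snd z"] cutoff_outside[OF n, of "snd z"] by cases auto
qed

context admissible_action
begin

text \<open>Finite total action gives finite action only on a dense set of times. The times at which
  the curve lies in the closed set form a closed set by weak* continuity, so they fill the interval
  including both ends.\<close>

lemma curve_between:
  assumes c: "(\<mu>, \<nu>) \<in> finite_action_curves \<phi> \<gamma> x y" and t: "t \<in> {0..1}"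
  shows "\<mu> t \<in> between \<gamma> a b"
proof -
  let ?T = "{t \<in> {0..1}. \<mu> t \<in> between \<gamma> a b}"
  have "closedin (top_of_set {0..1}) {t \<in> topspace (top_of_set {0..1}). \<mu> t \<in> between \<gamma> a b}"
    by (rule closedin_continuous_map_preimage[OF finite_action_curvesD(3)[OF c] closedin_between[OF gamma less_imp_le[OF ab]]])
  then have "closedin (top_of_set {0..1}) ?T" by simp
  then have "closed ?T" by (rule closedin_closed_trans) simp
  moreover have "t \<in> closure ?T"
    unfolding closure_approachable
  proof (intro allI impI)
    fix e :: real assume e: "0 < e"
    have "max 0 (t - e) < min 1 (t + e)" using t e by auto
    from ex_finite_point[OF finite_action_curvesD(6)[OF c] _ this]
    obtain s where s: "max 0 (t - e) < s" "s < min 1 (t + e)" "action \<phi> \<gamma> (\<mu> s) (\<nu> s) < \<infinity>"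
      by auto
    then show "\<exists>s\<in>?T. dist s t < e"
      using finite_action_between[OF s(3)] by (intro bexI[of _ s]) (auto simp: dist_real_def abs_less_iff)
  qed
  ultimately show ?thesis by (simp add: closure_closed)
qed

lemma between_slice_continuous:
  assumes cont: "continuous_map (top_of_set {0..1}) weak_star \<mu>"
    and btw: "\<And>t. t \<in> {0..1} \<Longrightarrow> \<mu> t \<in> between \<gamma> a b"
    and q: "slice_fn K q"
  shows "continuous_on {0..1} (\<lambda>t. radon_integral (\<mu> t) (\<lambda>x. q (x, t)))"
  unfolding continuous_on_iff
proof (intro ballI allI impI)
  fix t0 e :: real assume t0: "t0 \<in> {0..1}" and e: "0 < e"
  have K: "compact K" using q by (simp add: slice_fn_def)
  then have Kb: "bounded_borel K" by (auto simp: bounded_borel_def borel_compact compact_imp_bounded)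
  define D where "D = max \<bar>a\<bar> \<bar>b\<bar> * measure \<gamma> K"
  have D: "0 \<le> D" by (auto simp: D_def)
  define e' where "e' = (e / 2) / (D + 1)"
  have e': "0 < e'" "e' * D < e / 2"
  proof -
    have D1: "0 < D + 1" using D by linarith
    then show "0 < e'" using e by (simp add: e'_def)
    then have "e' * D < e' * (D + 1)" by (intro mult_strict_left_mono) auto
    also have "\<dots> = e / 2"
      unfolding e'_def using D1 by (metis less_irrefl nonzero_eq_divide_eq)
    finally show "e' * D < e / 2" .
  qed
  obtain d1 where d1: "0 < d1" "\<And>s t x. s \<in> {-1..2} \<Longrightarrow> t \<in> {-1..2} \<Longrightarrow> \<bar>s - t\<bar> < d1 \<Longrightarrow> norm (q (x, s) - q (x, t)) \<le> e'"
    using slice_fn_uniform[OF q e'(1)] by metis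
  have "compactly_supported_continuous (\<lambda>x. q (x, t0))"
    unfolding compactly_supported_continuous_def using q slice_fn_continuous[OF q, of t0]
    by (auto simp: slice_fn_def)
  then have "continuous_on {0..1} (\<lambda>t. radon_integral (\<mu> t) (\<lambda>x. q (x, t0)))"
    using cont by (simp add: continuous_map_weak_star_iff)
  then obtain d2 where d2: "0 < d2" "\<And>t. t \<in> {0..1} \<Longrightarrow> dist t t0 < d2 \<Longrightarrow>
      dist (radon_integral (\<mu> t) (\<lambda>x. q (x, t0))) (radon_integral (\<mu> t0) (\<lambda>x. q (x, t0))) < e / 2"
    using t0 e unfolding continuous_on_iff by (metis half_gt_zero)
  show "\<exists>d>0. \<forall>t\<in>{0..1}. dist t t0 < d \<longrightarrow>
      dist (radon_integral (\<mu> t) (\<lambda>x. q (x, t))) (radon_integral (\<mu> t0) (\<lambda>x. q (x, t0))) < e"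
  proof (intro exI[of _ "min d1 d2"] conjI ballI impI)
    fix t assume t: "t \<in> {0..1}" "dist t t0 < min d1 d2"
    have le: "norm (q (x, t) - q (x, t0)) \<le> e'" for x
      using t t0 by (intro d1(2)) (auto simp: dist_real_def)
    have "\<bar>radon_integral (\<mu> t) (\<lambda>x. q (x, t) - q (x, t0))\<bar> \<le> e' * (DIM(real) * measure (total_variation (\<mu> t)) K)"
      by (rule radon_integral_bound[OF bounded_fn_diff[OF slice_fn_bounded_fn[OF q] slice_fn_bounded_fn[OF q]] le])
    also have "\<dots> \<le> e' * D"
      using between_total_variation_le(2)[OF gamma btw[OF t(1)] Kb] e'(1)
      by (intro mult_left_mono) (auto simp: D_def)
    also have "\<dots> < e / 2" by (rule e')
    finally have "\<bar>radon_integral (\<mu> t) (\<lambda>x. q (x, t)) - radon_integral (\<mu> t) (\<lambda>x. q (x, t0))\<bar> < e / 2"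
      by (simp add: radon_integral_diff[OF slice_fn_bounded_fn[OF q] slice_fn_bounded_fn[OF q]])
    moreover have "\<bar>radon_integral (\<mu> t) (\<lambda>x. q (x, t0)) - radon_integral (\<mu> t0) (\<lambda>x. q (x, t0))\<bar> < e / 2"
      using d2(2)[OF t(1)] t(2) by (simp add: dist_real_def)
    ultimately show "dist (radon_integral (\<mu> t) (\<lambda>x. q (x, t))) (radon_integral (\<mu> t0) (\<lambda>x. q (x, t0))) < e"
      unfolding dist_real_def by linarith
  qed (use d1 d2 in auto)
qed

text \<open>The test function is multiplied by \<^const>\<open>cutoff\<close> in time; in the limit, the derivatives
  of the cutoffs become the two boundary terms.\<close>

lemma curve_boundary:
  assumes c: "(\<mu>, \<nu>) \<in> finite_action_curves \<phi> \<gamma> x y" and \<zeta>: "spatial_test K \<zeta> g"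
  shows "set_integrable lborel {0..1} (\<lambda>t. radon_integral (\<mu> t) (\<lambda>x. snd (g (x, t))))" (is "set_integrable _ _ ?P")
    and "set_integrable lborel {0..1} (\<lambda>t. radon_integral (\<nu> t) (\<lambda>x. fst (g (x, t))))" (is "set_integrable _ _ ?N")
    and "(LBINT t:{0..1}. radon_integral (\<mu> t) (\<lambda>x. snd (g (x, t)))) + (LBINT t:{0..1}. radon_integral (\<nu> t) (\<lambda>x. fst (g (x, t))))
      = radon_integral y (\<lambda>x. \<zeta> (x, 1)) - radon_integral x (\<lambda>x. \<zeta> (x, 0))"
proof -
  note C = finite_action_curvesD[OF c]
  note sl = spatial_test_slices[OF \<zeta>]
  let ?F = "\<lambda>t. radon_integral (\<mu> t) (\<lambda>x. \<zeta> (x, t))"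
  have F: "continuous_on {0..1} ?F"
    by (rule between_slice_continuous[OF C(3) curve_between[OF c] sl(1)])
  have P: "continuous_on {0..1} ?P"
    by (rule between_slice_continuous[OF C(3) curve_between[OF c] sl(2)])
  show iP: "set_integrable lborel {0..1} ?P"
    by (rule borel_integrable_atLeastAtMost'[OF P])
  show iN: "set_integrable lborel {0..1} ?N"
    by (rule slice_integrable[OF C(4,5) sl(3)])
  let ?I = "\<lambda>t. ?P t + ?N t"
  have iI: "set_integrable lborel {0..1} ?I"
    by (rule set_integral_add(1)[OF iP iN])
  have cc: "continuous_on UNIV (cutoff n)" for n
    using cutoff_DERIV[of n] by (intro continuous_at_imp_continuous_on ballI) (auto intro: DERIV_isCont)
  have cm[measurable]: "cutoff n \<in> borel_measurable borel" for n
    by (rule borel_measurable_continuous_onI[OF cc])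
  have cI: "set_integrable lborel {0..1} (\<lambda>t. cutoff n t * u t)" if u: "set_integrable lborel {0..1} u" for n and u :: "real \<Rightarrow> real"
    unfolding set_integrable_def
  proof (rule Bochner_Integration.integrable_bound[OF u[unfolded set_integrable_def]])
    have "(\<lambda>t. indicator {0..1} t *\<^sub>R u t) \<in> borel_measurable lborel"
      using u unfolding set_integrable_def by (rule borel_measurable_integrable)
    then have "(\<lambda>t. cutoff n t * (indicator {0..1} t *\<^sub>R u t)) \<in> borel_measurable lborel"
      by measurable
    then show "(\<lambda>t. indicator {0..1} t *\<^sub>R (cutoff n t * u t)) \<in> borel_measurable lborel"
      by (simp add: mult.left_commute)
    show "AE t in lborel. norm (indicator {0..1} t *\<^sub>R (cutoff n t * u t)) \<le> norm (indicator {0..1} t *\<^sub>R u t)"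
      using cutoff_bounds[of n] by (intro AE_I2) (auto simp: indicator_def abs_mult intro: mult_left_le_one_le)
  qed
  let ?A = "\<lambda>n. LBINT t:{0..1}. (real n * step' (real n * t - 1)) * ?F t"
  let ?B = "\<lambda>n. LBINT t:{0..1}. (real n * step' (real n * (1 - t) - 1)) * ?F t"
  have ev: "(LBINT t:{0..1}. cutoff n t * ?I t) = ?B n - ?A n" if n: "4 \<le> n" for n
  proof -
    let ?\<zeta> = "\<lambda>z. cutoff n (snd z) *\<^sub>R g z + \<zeta> z *\<^sub>R (cutoff' n (snd z) *\<^sub>R (0, 1))"
    have 1: "radon_integral (\<mu> t) (\<lambda>x. snd (?\<zeta> (x, t))) = cutoff n t * ?P t + cutoff' n t * ?F t" for t
    proof -
      have "radon_integral (\<mu> t) (\<lambda>x. snd (?\<zeta> (x, t))) = radon_integral (\<mu> t) (\<lambda>x. cutoff n t *\<^sub>R snd (g (x, t)) + cutoff' n t *\<^sub>R \<zeta> (x, t))"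
        by (simp add: mult.commute)
      also have "\<dots> = cutoff n t * ?P t + cutoff' n t * ?F t"
        unfolding radon_integral_add[OF bounded_fn_scaleR[OF slice_fn_bounded_fn[OF sl(2)]] bounded_fn_scaleR[OF slice_fn_bounded_fn[OF sl(1)]]]
          radon_integral_scaleR ..
      finally show ?thesis .
    qed
    have 2: "radon_integral (\<nu> t) (\<lambda>x. fst (?\<zeta> (x, t))) = cutoff n t * ?N t" for t
      by (simp add: radon_integral_scaleR)
    have iA: "set_integrable lborel {0..1} (\<lambda>t. (real n * step' (real n * t - 1)) * ?F t)"
      and iB: "set_integrable lborel {0..1} (\<lambda>t. (real n * step' (real n * (1 - t) - 1)) * ?F t)"
      by (intro borel_integrable_atLeastAtMost' continuous_on_mult F continuous_intros continuous_on_compose2[OF step'_continuous[of UNIV]]; simp)+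
    have 3: "cutoff' n t * ?F t = (real n * step' (real n * t - 1)) * ?F t - (real n * step' (real n * (1 - t) - 1)) * ?F t" for t
      by (simp add: cutoff'_def algebra_simps)
    have "(LBINT t:{0..1}. cutoff n t * ?P t + cutoff' n t * ?F t) + (LBINT t:{0..1}. cutoff n t * ?N t) = 0"
      using C(7)[OF C1c_test_cutoff[OF \<zeta> n]] unfolding 1 2 .
    also have "(LBINT t:{0..1}. cutoff n t * ?P t + cutoff' n t * ?F t) = (LBINT t:{0..1}. cutoff n t * ?P t) + (?A n - ?B n)"
      unfolding 3 using cI[OF iP] iA iB by (simp only: set_integral_add set_integral_diff)
    finally have "(LBINT t:{0..1}. cutoff n t * ?P t) + (LBINT t:{0..1}. cutoff n t * ?N t) = ?B n - ?A n" by simp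
    moreover have "(LBINT t:{0..1}. cutoff n t * ?I t) = (LBINT t:{0..1}. cutoff n t * ?P t) + (LBINT t:{0..1}. cutoff n t * ?N t)"
      using cI[OF iP] cI[OF iN] by (simp only: distrib_left set_integral_add)
    ultimately show ?thesis by simp
  qed
  have "(\<lambda>n. LBINT t:{0..1}. cutoff n t * ?I t) \<longlonglongrightarrow> (LBINT t:{0..1}. ?I t)"
    unfolding set_lebesgue_integral_def
  proof (rule integral_dominated_convergence)
    show "(\<lambda>t. indicator {0..1} t *\<^sub>R ?I t) \<in> borel_measurable lborel"
      using iI unfolding set_integrable_def by (rule borel_measurable_integrable)
    show "(\<lambda>t. indicator {0..1} t *\<^sub>R (cutoff n t * ?I t)) \<in> borel_measurable lborel" for n
      using cI[OF iI, of n] unfolding set_integrable_def by (rule borel_measurable_integrable)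
    show "integrable lborel (\<lambda>t. norm (indicator {0..1} t *\<^sub>R ?I t))"
      using iI unfolding set_integrable_def by (rule integrable_norm)
    show "AE t in lborel. norm (indicator {0..1} t *\<^sub>R (cutoff n t * ?I t)) \<le> norm (indicator {0..1} t *\<^sub>R ?I t)" for n
      using cutoff_bounds[of n] by (intro AE_I2) (auto simp: indicator_def abs_mult intro: mult_left_le_one_le)
    \<comment> \<open>The cutoffs converge to 1 only at interior times; the two end points are
      null.\<close>
    have "AE t in lborel. t \<noteq> (0::real)" "AE t in lborel. t \<noteq> (1::real)" by (rule AE_lborel_singleton)+
    then show "AE t in lborel. (\<lambda>n. indicator {0..1} t *\<^sub>R (cutoff n t * ?I t)) \<longlonglongrightarrow> indicator {0..1} t *\<^sub>R ?I t"
    proof eventually_elim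
      case (elim t)
      show ?case
      proof (cases "t \<in> {0..1}")
        case True
        then have "(\<lambda>n. cutoff n t) \<longlonglongrightarrow> 1" using elim by (intro cutoff_tendsto) auto
        then have "(\<lambda>n. indicator {0..1} t *\<^sub>R (cutoff n t * ?I t)) \<longlonglongrightarrow> indicator {0..1} t *\<^sub>R (1 * ?I t)"
          by (intro tendsto_intros)
        then show ?thesis by simp
      qed simp
    qed
  qed
  moreover have "(\<lambda>n. LBINT t:{0..1}. cutoff n t * ?I t) \<longlonglongrightarrow> ?F 1 - ?F 0"
  proof (rule Lim_transform_eventually)
    show "(\<lambda>n. ?B n - ?A n) \<longlonglongrightarrow> ?F 1 - ?F 0"
      by (intro tendsto_diff step_delta[OF F] step_delta_right[OF F])
    show "\<forall>\<^sub>F n in sequentially. ?B n - ?A n = (LBINT t:{0..1}. cutoff n t * ?I t)"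
      using eventually_ge_at_top[of 4] by eventually_elim (simp add: ev)
  qed
  ultimately have "(LBINT t:{0..1}. ?I t) = ?F 1 - ?F 0"
    by (rule LIMSEQ_unique)
  moreover have "(LBINT t:{0..1}. ?I t) = (LBINT t:{0..1}. ?P t) + (LBINT t:{0..1}. ?N t)"
    by (rule set_integral_add(2)[OF iP iN])
  ultimately show "(LBINT t:{0..1}. ?P t) + (LBINT t:{0..1}. ?N t) = radon_integral y (\<lambda>x. \<zeta> (x, 1)) - radon_integral x (\<lambda>x. \<zeta> (x, 0))"
    by (simp add: C(1,2))
qed

end

section \<open>Approximation by continuously differentiable functions\<close>

definition static_test :: "'a::euclidean_space set \<Rightarrow> ('a \<Rightarrow> real) \<Rightarrow> ('a \<Rightarrow> 'a) \<Rightarrow> bool" where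
  "static_test K h G \<longleftrightarrow> compact K \<and> (\<forall>x. GDERIV h x :> G x) \<and> continuous_on UNIV G \<and> (\<forall>x. x \<notin> K \<longrightarrow> h x = 0)"

lemma static_test_spatial_test:
  assumes "static_test K h G"
  shows "spatial_test K (\<lambda>z. h (fst z)) (\<lambda>z. (G (fst z), 0))"
  unfolding spatial_test_def
proof (intro conjI allI impI)
  have d: "(h has_derivative (\<lambda>v. v \<bullet> G x)) (at x)" for x
    using assms by (simp add: static_test_def gderiv_def)
  show "GDERIV (\<lambda>z. h (fst z)) z :> (G (fst z), 0)" for z
    unfolding gderiv_def
    using has_derivative_compose[OF bounded_linear_imp_has_derivative[OF bounded_linear_fst] d, of z UNIV]
    by (simp add: inner_prod_def)
  have G: "continuous_on UNIV G" using assms by (simp add: static_test_def)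
  show "continuous_on UNIV (\<lambda>z. (G (fst z), 0))"
    by (intro continuous_on_Pair continuous_on_const continuous_on_compose2[OF G] continuous_on_fst continuous_on_id) simp
qed (use assms in \<open>auto simp: static_test_def\<close>)

lemma static_test_bounded_fn:
  assumes "static_test K h G"
  shows "bounded_fn K h" "bounded_fn K G"
  using slice_fn_bounded_fn[OF spatial_test_slices(1)[OF static_test_spatial_test[OF assms]]]
    slice_fn_bounded_fn[OF spatial_test_slices(3)[OF static_test_spatial_test[OF assms]]]
  by simp_all

text \<open>Induction over the generation of polynomials. A linear form is the inner product with
  the vector of its values on the basis, which is its constant gradient.\<close>

lemma real_polynomial_function_GDERIV:
  fixes f :: "'a::euclidean_space \<Rightarrow> real"
  assumes "real_polynomial_function f"
  shows "\<exists>G. continuous_on UNIV G \<and> (\<forall>x. GDERIV f x :> G x)"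
  using assms
proof induction
  case (linear f)
  have "f v = v \<bullet> (\<Sum>b\<in>Basis. f b *\<^sub>R b)" for v
  proof -
    have "f v = f (\<Sum>b\<in>Basis. (v \<bullet> b) *\<^sub>R b)" by (simp add: euclidean_representation)
    also have "\<dots> = (\<Sum>b\<in>Basis. (v \<bullet> b) * f b)"
      using linear by (simp add: bounded_linear.linear linear_sum linear_scale)
    finally show ?thesis by (simp add: inner_sum_right mult.commute)
  qed
  then have "f = (\<lambda>v. v \<bullet> (\<Sum>b\<in>Basis. f b *\<^sub>R b))" by (rule ext)
  then have "GDERIV f x :> (\<Sum>b\<in>Basis. f b *\<^sub>R b)" for x
    unfolding gderiv_def using bounded_linear_imp_has_derivative[OF linear, of "at x"] by simp
  then show ?case by (intro exI[of _ "\<lambda>_. \<Sum>b\<in>Basis. f b *\<^sub>R b"]) auto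
next
  case (const c)
  then show ?case by (intro exI[of _ "\<lambda>_. 0"]) (auto intro: GDERIV_const)
next
  case (add f g)
  then obtain F G where "continuous_on UNIV F" "continuous_on UNIV G" "\<And>x. GDERIV f x :> F x" "\<And>x. GDERIV g x :> G x"
    by blast
  then show ?case
    by (intro exI[of _ "\<lambda>x. F x + G x"] conjI allI continuous_on_add GDERIV_add)
next
  case (mult f g)
  then obtain F G where FG: "continuous_on UNIV F" "continuous_on UNIV G" "\<And>x. GDERIV f x :> F x" "\<And>x. GDERIV g x :> G x"
    by blast
  have "continuous_on UNIV f" "continuous_on UNIV g"
    using FG(3,4) unfolding gderiv_def by (auto intro!: continuous_at_imp_continuous_on has_derivative_continuous)
  with FG show ?case
    by (intro exI[of _ "\<lambda>x. f x *\<^sub>R G x + g x *\<^sub>R F x"] conjI allI continuous_on_add continuous_on_scaleR GDERIV_mult)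
qed

text \<open>The step is composed with an affine function of the squared norm, equal to 1 at radius R
  and to 0 at radius R + 1. The square avoids the singularity of the norm at the origin.\<close>

lemma ex_static_cutoff:
  fixes R :: real
  assumes R: "0 < R"
  obtains \<theta> :: "'a::euclidean_space \<Rightarrow> real" and H where "static_test (cball 0 (R + 1)) \<theta> H"
    "\<And>x. norm x \<le> R \<Longrightarrow> \<theta> x = 1" "\<And>x. 0 \<le> \<theta> x" "\<And>x. \<theta> x \<le> 1"
proof -
  define k where "k = (R + 1)\<^sup>2 - R\<^sup>2"
  have k: "0 < k" using R by (simp add: k_def power2_eq_square algebra_simps)
  define u where "u x = ((R + 1)\<^sup>2 - x \<bullet> x) / k" for x :: 'a
  have "GDERIV u x :> (- 2 / k) *\<^sub>R x" for x
    unfolding gderiv_def u_def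
    using k by (auto intro!: derivative_eq_intros simp: inner_commute fun_eq_iff)
  from GDERIV_DERIV_compose[OF this step_DERIV]
  have d: "GDERIV (\<lambda>x. step (u x)) x :> step' (u x) *\<^sub>R (- 2 / k) *\<^sub>R x" for x .
  have cu: "continuous_on UNIV u" unfolding u_def using k by (intro continuous_intros) auto
  show thesis
  proof (rule that[of "\<lambda>x. step (u x)"])
    show "static_test (cball 0 (R + 1)) (\<lambda>x. step (u x)) (\<lambda>x. step' (u x) *\<^sub>R (- 2 / k) *\<^sub>R x)"
      unfolding static_test_def
    proof (intro conjI allI impI d)
      show "continuous_on UNIV (\<lambda>x. step' (u x) *\<^sub>R (- 2 / k) *\<^sub>R x)"
        by (intro continuous_intros continuous_on_compose2[OF step'_continuous[of UNIV] cu]) auto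
      fix x :: 'a assume "x \<notin> cball 0 (R + 1)"
      then have "(R + 1)\<^sup>2 \<le> (norm x)\<^sup>2" using R by (intro power_mono) auto
      then have "u x \<le> 0" using k by (simp add: u_def dot_square_norm divide_nonpos_pos)
      then show "step (u x) = 0" by (rule step_0)
    qed simp
    show "step (u x) = 1" if "norm x \<le> R" for x
    proof (rule step_1)
      have "(norm x)\<^sup>2 \<le> R\<^sup>2" using that by (intro power_mono) auto
      then show "1 \<le> u x" using k by (simp add: u_def dot_square_norm k_def)
    qed
  qed (rule step_bounds)+
qed

text \<open>A polynomial approximation on a ball, multiplied by a smooth cutoff. The set K is chosen
  before e: error bounds then involve one fixed mass.\<close>

lemma static_test_approx:
  assumes f: "compactly_supported_continuous f"
  obtains K where "compact K" "bounded_fn K f"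
    "\<And>e. 0 < e \<Longrightarrow> \<exists>h G. static_test K h G \<and> (\<forall>x. \<bar>f x - h x\<bar> \<le> e)"
proof -
  obtain K0 where K0: "compact K0" "\<And>x. x \<notin> K0 \<Longrightarrow> f x = 0" and cf: "continuous_on UNIV f"
    using f by (auto simp: compactly_supported_continuous_def)
  obtain R where R: "0 < R" "K0 \<subseteq> ball 0 R"
    using bounded_subset_ballD[OF compact_imp_bounded[OF K0(1)], of 0] by blast
  let ?K = "cball (0::'a) (R + 1)"
  have f0: "f x = 0" if "R < norm x" for x
    using K0(2)[of x] R(2) that by (force simp: subset_iff)
  obtain \<theta> :: "'a \<Rightarrow> real" and H where \<theta>: "static_test ?K \<theta> H" "\<And>x. norm x \<le> R \<Longrightarrow> \<theta> x = 1" "\<And>x. 0 \<le> \<theta> x" "\<And>x. \<theta> x \<le> 1"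
    using ex_static_cutoff[OF R(1)] by metis
  show thesis
  proof (rule that[of ?K])
    show "compact ?K" by simp
    show "bounded_fn ?K f"
      using f0 R(1) by (intro bounded_fn_continuous cf) auto
    fix e :: real assume e: "0 < e"
    obtain g where g: "real_polynomial_function g" "\<And>x. x \<in> ?K \<Longrightarrow> \<bar>f x - g x\<bar> < e"
      using Stone_Weierstrass_real_polynomial_function[of ?K f e] cf e continuous_on_subset by (metis compact_cball subset_UNIV)
    obtain G where G: "continuous_on UNIV G" "\<And>x. GDERIV g x :> G x"
      using real_polynomial_function_GDERIV[OF g(1)] by blast
    have H: "continuous_on UNIV H" "\<And>x. GDERIV \<theta> x :> H x" "\<And>x. x \<notin> ?K \<Longrightarrow> \<theta> x = 0"
      using \<theta>(1) by (auto simp: static_test_def)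
    have c: "continuous_on UNIV g" "continuous_on UNIV \<theta>"
      using G(2) H(2) unfolding gderiv_def by (auto intro!: continuous_at_imp_continuous_on has_derivative_continuous)
    have "static_test ?K (\<lambda>x. \<theta> x * g x) (\<lambda>x. \<theta> x *\<^sub>R G x + g x *\<^sub>R H x)"
      unfolding static_test_def
      by (intro conjI allI impI GDERIV_mult G H continuous_on_add continuous_on_scaleR c) (auto simp: H(3))
    moreover have "\<bar>f x - \<theta> x * g x\<bar> \<le> e" for x
    proof (cases "x \<in> ?K")
      case True
      \<comment> \<open>The cutoff is 1 wherever f is nonzero, so the product is as close to f as
        the polynomial was.\<close>
      have "f x = \<theta> x * f x"
        using \<theta>(2)[of x] f0[of x] by (cases "norm x \<le> R") auto
      then have "f x - \<theta> x * g x = \<theta> x * (f x - g x)" by (simp add: algebra_simps)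
      then have "\<bar>f x - \<theta> x * g x\<bar> = \<theta> x * \<bar>f x - g x\<bar>"
        using \<theta>(3) by (simp add: abs_mult)
      also have "\<dots> \<le> 1 * e" using \<theta>(3,4) g(2)[OF True] by (intro mult_mono) auto
      finally show ?thesis by simp
    next
      case False
      then have "f x = 0" using f0[of x] R(1) by auto
      then show ?thesis using H(3)[OF False] e by simp
    qed
    ultimately show "\<exists>h G. static_test ?K h G \<and> (\<forall>x. \<bar>f x - h x\<bar> \<le> e)" by blast
  qed
qed

section \<open>The distance controls integrals of continuous functions\<close>

context admissible_action
begin

text \<open>For a test function constant in time, the boundary formula expresses the change of the
  integral by the flux alone, and coercivity bounds the flux at each time.\<close>

lemma curve_estimate:
  obtains c where "0 < c" "\<And>\<mu> \<nu> x y K h G L s. (\<mu>, \<nu>) \<in> finite_action_curves \<phi> \<gamma> x y \<Longrightarrow> static_test K h G \<Longrightarrow>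
    (\<And>x. norm (G x) \<le> L) \<Longrightarrow> 0 < L \<Longrightarrow> 0 < s \<Longrightarrow>
    \<bar>radon_integral y h - radon_integral x h\<bar> \<le> L * s * measure \<gamma> K + L * s powr (1 - p) / c * enn2real (total_action \<phi> \<gamma> \<mu> \<nu>)"
proof -
  obtain c where c: "0 < c" "\<And>\<mu> \<nu> S V L s. bounded_fn S V \<Longrightarrow> (\<And>x. norm (V x) \<le> L) \<Longrightarrow> 0 < L \<Longrightarrow> 0 < s \<Longrightarrow>
    ennreal \<bar>radon_integral \<nu> V\<bar> \<le> ennreal (L * s * measure \<gamma> S) + ennreal (L * s powr (1 - p) / c) * action \<phi> \<gamma> \<mu> \<nu>"
    using action_coercive by blast
  show thesis
  proof (rule that[OF c(1)])
    fix \<mu> \<nu> x y and K :: "'a set" and h G and L s :: real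
    assume cur: "(\<mu>, \<nu>) \<in> finite_action_curves \<phi> \<gamma> x y" and h: "static_test K h G"
      and G: "\<And>x. norm (G x) \<le> L" and L: "0 < L" and s: "0 < s"
    define m where "m = L * s * measure \<gamma> K"
    define k where "k = L * s powr (1 - p) / c"
    have m: "0 \<le> m" and k: "0 < k" using L s c(1) by (auto simp: m_def k_def)
    define A where "A = total_action \<phi> \<gamma> \<mu> \<nu>"
    have A: "A = (\<integral>\<^sup>+t. action \<phi> \<gamma> (\<mu> t) (\<nu> t) * indicator {0..1} t \<partial>lborel)" "A < \<infinity>"
      using finite_action_curvesD(6)[OF cur] by (auto simp: A_def total_action_def)
    let ?N = "\<lambda>t. radon_integral (\<nu> t) G"
    note B = curve_boundary[OF cur static_test_spatial_test[OF h]]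
    have iN: "set_integrable lborel {0..1} ?N" and eq: "(LBINT t:{0..1}. ?N t) = radon_integral y h - radon_integral x h"
      using B by simp_all
    have aN: "set_integrable lborel {0..1} (\<lambda>t. \<bar>?N t\<bar>)" using iN by (rule set_integrable_abs)
    \<comment> \<open>The excess over m is measurable and lies below k times the action, so
      monotonicity of the lower integral is enough; integrating the sum of m and k times the action
      would ask for additivity.\<close>
    define u where "u t = max 0 (indicator {0..1} t * \<bar>?N t\<bar> - m)" for t
    have iu: "integrable lborel (\<lambda>t. indicator {0..1} t * \<bar>?N t\<bar>)"
      using aN by (simp add: set_integrable_def)
    then have um: "u \<in> borel_measurable lborel"
      unfolding u_def[abs_def] by (intro borel_measurable_max borel_measurable_const borel_measurable_diff borel_measurable_integrable)
    have u0: "0 \<le> u t" for t by (simp add: u_def)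
    have u: "integrable lborel u"
      by (rule Bochner_Integration.integrable_bound[OF iu um]) (use m in \<open>auto simp: u_def\<close>)
    have "ennreal (u t) \<le> ennreal k * (action \<phi> \<gamma> (\<mu> t) (\<nu> t) * indicator {0..1} t)" for t
    proof (cases "t \<in> {0..1}")
      case True
      let ?X = "ennreal k * action \<phi> \<gamma> (\<mu> t) (\<nu> t)"
      have le: "ennreal \<bar>?N t\<bar> \<le> ennreal m + ?X"
        unfolding m_def k_def by (rule c(2)[OF static_test_bounded_fn(2)[OF h] G L s])
      have "ennreal (u t) \<le> ?X"
      proof (cases "?X")
        case (real r)
        then have "ennreal \<bar>?N t\<bar> \<le> ennreal (m + r)" using le m by simp
        then have "\<bar>?N t\<bar> \<le> m + r" using m real by (simp add: ennreal_le_iff del: ennreal_plus)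
        then show ?thesis using True real by (auto simp: u_def intro!: ennreal_leI)
      qed simp
      then show ?thesis using True by simp
    next
      case False
      then have "u t = 0" using m by (simp add: u_def)
      then show ?thesis by simp
    qed
    then have "(\<integral>\<^sup>+t. ennreal (u t) \<partial>lborel) \<le> (\<integral>\<^sup>+t. ennreal k * (action \<phi> \<gamma> (\<mu> t) (\<nu> t) * indicator {0..1} t) \<partial>lborel)"
      by (intro nn_integral_mono)
    also have "\<dots> \<le> ennreal k * A"
      unfolding A(1) by (rule nn_integral_cmult_le[OF k])
    also have "\<dots> = ennreal (k * enn2real A)"
      using A(2) k by (simp add: ennreal_mult)
    finally have "ennreal (integral\<^sup>L lborel u) \<le> ennreal (k * enn2real A)"
      using u u0 by (simp add: nn_integral_eq_integral)
    then have iu_le: "integral\<^sup>L lborel u \<le> k * enn2real A"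
      using k by (simp add: ennreal_le_iff)
    have "\<bar>LBINT t:{0..1}. ?N t\<bar> \<le> (LBINT t:{0..1}. \<bar>?N t\<bar>)"
      using set_integral_norm_bound[OF iN] by simp
    also have "\<dots> = (\<integral>t. indicator {0..1} t * \<bar>?N t\<bar> \<partial>lborel)"
      by (simp add: set_lebesgue_integral_def)
    also have "\<dots> \<le> (\<integral>t. m * indicator {0..1} t + u t \<partial>lborel)"
    proof (rule integral_mono[OF iu])
      show "integrable lborel (\<lambda>t. m * indicator {0..1} t + u t)"
        using u by (intro Bochner_Integration.integrable_add integrable_mult_right) (simp_all add: integrable_indicator_iff)
    qed (auto simp: u_def indicator_def)
    also have "\<dots> = m + integral\<^sup>L lborel u"
      using u by simp
    finally show "\<bar>radon_integral y h - radon_integral x h\<bar> \<le> L * s * measure \<gamma> K + L * s powr (1 - p) / c * enn2real (total_action \<phi> \<gamma> \<mu> \<nu>)"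
      using eq iu_le unfolding m_def k_def A_def by simp
  qed
qed

section \<open>From curves to the distance\<close>

lemma W_dist_less_curve:
  assumes "W_dist p \<phi> \<gamma> x y < e"
  obtains \<mu> \<nu> where "(\<mu>, \<nu>) \<in> finite_action_curves \<phi> \<gamma> x y"
    "ennreal (enn2real (total_action \<phi> \<gamma> \<mu> \<nu>) powr (1 / p)) < e"
  using assms unfolding W_dist_def INF_less_iff by auto

lemma W_dist_finite_between:
  assumes "W_dist p \<phi> \<gamma> x y < \<infinity>"
  shows "x \<in> between \<gamma> a b" "y \<in> between \<gamma> a b"
proof -
  obtain \<mu> \<nu> where c: "(\<mu>, \<nu>) \<in> finite_action_curves \<phi> \<gamma> x y"
    using W_dist_less_curve[OF assms] by blast
  show "x \<in> between \<gamma> a b" "y \<in> between \<gamma> a b"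
    using curve_between[OF c, of 0] curve_between[OF c, of 1] finite_action_curvesD(1,2)[OF c] by auto
qed

text \<open>The radius depends on f and e only, not on x and y. Four errors of at most e / 8 are
  collected: replacing f by h at each end, the term free of the action, and the action term.\<close>

lemma W_dist_weak_close:
  assumes f: "compactly_supported_continuous f" and e: "0 < e"
  obtains r where "0 < r" "\<And>x y. W_dist p \<phi> \<gamma> x y < ennreal r \<Longrightarrow> \<bar>radon_integral y f - radon_integral x f\<bar> < e"
proof -
  obtain c where c: "0 < c" "\<And>\<mu> \<nu> x y K h G L s. (\<mu>, \<nu>) \<in> finite_action_curves \<phi> \<gamma> x y \<Longrightarrow> static_test K h G \<Longrightarrow>
    (\<And>x. norm (G x) \<le> L) \<Longrightarrow> 0 < L \<Longrightarrow> 0 < s \<Longrightarrow>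
    \<bar>radon_integral y h - radon_integral x h\<bar> \<le> L * s * measure \<gamma> K + L * s powr (1 - p) / c * enn2real (total_action \<phi> \<gamma> \<mu> \<nu>)"
    using curve_estimate by blast
  obtain K where K: "compact K" "bounded_fn K f"
    "\<And>e. 0 < e \<Longrightarrow> \<exists>h G. static_test K h G \<and> (\<forall>x. \<bar>f x - h x\<bar> \<le> e)"
    using static_test_approx[OF f] by blast
  have Kb: "bounded_borel K" using K(2) by (simp add: bounded_fn_def)
  define D where "D = max \<bar>a\<bar> \<bar>b\<bar> * measure \<gamma> K"
  have D: "0 \<le> D" by (auto simp: D_def)
  have small: "e / 8 / (d + 1) * d < e / 8" if "0 \<le> d" for d :: real
  proof -
    have "e / 8 / (d + 1) * d < e / 8 / (d + 1) * (d + 1)"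
      using e that by (intro mult_strict_left_mono) auto
    also have "\<dots> = e / 8" using that by (metis add_nonneg_pos less_irrefl nonzero_eq_divide_eq zero_less_one)
    finally show ?thesis .
  qed
  define e1 where "e1 = e / 8 / (D + 1)"
  have e1: "0 < e1" "e1 * D < e / 8" using e D small[OF D] by (auto simp: e1_def)
  obtain h G where h: "static_test K h G" and fh: "\<And>x. norm (f x - h x) \<le> e1"
    using K(3)[OF e1(1)] by auto
  obtain L where L: "0 < L" "\<And>x. norm (G x) \<le> L"
    using bounded_fn_bound[OF static_test_bounded_fn(2)[OF h]] by blast
  have LD: "0 \<le> L * measure \<gamma> K" using L by simp
  \<comment> \<open>The order matters: s makes the term free of the action small, which may enlarge
    the coefficient k of the action, and only then is r chosen in terms of k.\<close>
  define s where "s = e / 8 / (L * measure \<gamma> K + 1)"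
  have s: "0 < s" "L * s * measure \<gamma> K < e / 8"
    using e LD small[OF LD] by (auto simp: s_def mult_ac add_nonneg_pos)
  define k where "k = L * s powr (1 - p) / c"
  have k: "0 < k" using L s c(1) by (simp add: k_def)
  define r where "r = (e / 8 / k) powr (1 / p)"
  have r: "0 < r" using e k by (simp add: r_def)
  show thesis
  proof (rule that[OF r])
    fix x y assume "W_dist p \<phi> \<gamma> x y < ennreal r"
    then obtain \<mu> \<nu> where cur: "(\<mu>, \<nu>) \<in> finite_action_curves \<phi> \<gamma> x y"
      and act: "ennreal (enn2real (total_action \<phi> \<gamma> \<mu> \<nu>) powr (1 / p)) < ennreal r"
      by (rule W_dist_less_curve)
    define A where "A = enn2real (total_action \<phi> \<gamma> \<mu> \<nu>)"
    have "A powr (1 / p) < r" using act by (simp add: A_def ennreal_less_iff)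
    have "A < e / 8 / k"
    proof (rule ccontr)
      assume "\<not> ?thesis"
      then have "r \<le> A powr (1 / p)"
        unfolding r_def using p e k by (intro powr_mono2) auto
      with \<open>A powr (1 / p) < r\<close> show False by simp
    qed
    then have kA: "k * A < e / 8" using k by (simp add: field_simps)
    have "\<bar>radon_integral y h - radon_integral x h\<bar> \<le> L * s * measure \<gamma> K + k * A"
      unfolding k_def A_def by (rule c(2)[OF cur h L(2,1) s(1)])
    moreover have near: "\<bar>radon_integral m f - radon_integral m h\<bar> < e / 8" if m: "m \<in> between \<gamma> a b" for m
    proof -
      have "\<bar>radon_integral m (\<lambda>x. f x - h x)\<bar> \<le> e1 * (DIM(real) * measure (total_variation m) K)"
        by (rule radon_integral_bound[OF bounded_fn_diff[OF K(2) static_test_bounded_fn(1)[OF h]] fh])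
      also have "\<dots> \<le> e1 * D"
        using between_total_variation_le(2)[OF gamma m Kb] e1(1) by (intro mult_left_mono) (auto simp: D_def)
      also have "\<dots> < e / 8" by (rule e1)
      finally show ?thesis by (simp add: radon_integral_diff[OF K(2) static_test_bounded_fn(1)[OF h]])
    qed
    have "x \<in> between \<gamma> a b" "y \<in> between \<gamma> a b"
      using curve_between[OF cur, of 0] curve_between[OF cur, of 1] finite_action_curvesD(1,2)[OF cur] by auto
    ultimately show "\<bar>radon_integral y f - radon_integral x f\<bar> < e"
      using near[of x] near[of y] kA s(2) e by linarith
  qed
qed

end

section \<open>Affine changes of time\<close>

text \<open>The inverse of t \<mapsto> \<beta> + \<alpha> t: a curve on the unit interval is
  transplanted to the image interval \<open>reparam_times\<close>. Negative \<alpha> is allowed, and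
  \<alpha> = -1 with \<beta> = 1 is time reversal.\<close>

definition reparam :: "real \<Rightarrow> real \<Rightarrow> real \<Rightarrow> real" where
  "reparam \<alpha> \<beta> t = (t - \<beta>) / \<alpha>"

definition reparam_times :: "real \<Rightarrow> real \<Rightarrow> real set" where
  "reparam_times \<alpha> \<beta> = reparam \<alpha> \<beta> -` {0..1}"

lemma indicator_reparam_times: "indicator (reparam_times \<alpha> \<beta>) t = indicator {0..1} (reparam \<alpha> \<beta> t)"
  by (simp add: reparam_times_def indicator_def)

lemma reparam_inverse: "\<alpha> \<noteq> 0 \<Longrightarrow> \<beta> + \<alpha> * reparam \<alpha> \<beta> t = t"
  by (simp add: reparam_def)

lemma reparam_affine: "\<alpha> \<noteq> 0 \<Longrightarrow> reparam \<alpha> \<beta> t = - \<beta> / \<alpha> + 1 / \<alpha> * t"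
  by (simp add: reparam_def field_simps)

lemma reparam_continuous_on:
  "\<alpha> \<noteq> 0 \<Longrightarrow> continuous_on {0..1} F \<Longrightarrow> continuous_on (reparam_times \<alpha> \<beta>) (\<lambda>t. F (reparam \<alpha> \<beta> t))"
  by (rule continuous_on_compose2[of "{0..1}" F]) (auto simp: reparam_times_def reparam_def[abs_def] intro!: continuous_intros)

lemma reparam_measurable:
  fixes f :: "real \<Rightarrow> 'b::euclidean_space"
  assumes "f \<in> borel_measurable (restrict_space borel {0..1})"
  shows "(\<lambda>t. indicator (reparam_times \<alpha> \<beta>) t *\<^sub>R f (reparam \<alpha> \<beta> t)) \<in> borel_measurable borel"
proof -
  have "(\<lambda>t. indicator {0..1} t *\<^sub>R f t) \<in> borel_measurable borel"
    using assms by (subst borel_measurable_restrict_space_iff[symmetric]) auto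
  moreover have "reparam \<alpha> \<beta> \<in> borel_measurable borel"
    unfolding reparam_def[abs_def] by measurable
  ultimately show ?thesis
    unfolding indicator_reparam_times by (rule measurable_compose[rotated])
qed

lemma nn_integral_reparam_le:
  fixes F :: "real \<Rightarrow> ennreal"
  assumes \<alpha>: "\<alpha> \<noteq> 0" and k: "0 < k"
  shows "(\<integral>\<^sup>+t\<in>reparam_times \<alpha> \<beta>. (ennreal k * F (reparam \<alpha> \<beta> t)) \<partial>lborel) \<le> ennreal (k * \<bar>\<alpha>\<bar>) * (\<integral>\<^sup>+t\<in>{0..1}. F t \<partial>lborel)"
  using nn_integral_affine_le[of "1 / \<alpha>" k "\<lambda>t. F t * indicator {0..1} t" "- \<beta> / \<alpha>"] \<alpha> k
  by (simp add: indicator_reparam_times reparam_affine mult.assoc)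

lemma set_integral_reparam:
  fixes u :: "real \<Rightarrow> real"
  assumes \<alpha>: "\<alpha> \<noteq> 0" and u: "set_integrable lborel {0..1} u"
  shows "set_integrable lborel (reparam_times \<alpha> \<beta>) (\<lambda>t. u (reparam \<alpha> \<beta> t))"
    and "(LBINT t:reparam_times \<alpha> \<beta>. u (reparam \<alpha> \<beta> t)) = \<bar>\<alpha>\<bar> * (LBINT t:{0..1}. u t)"
proof -
  let ?f = "\<lambda>t. indicator {0..1} t *\<^sub>R u t"
  have eq: "indicator (reparam_times \<alpha> \<beta>) t *\<^sub>R u (reparam \<alpha> \<beta> t) = ?f (- \<beta> / \<alpha> + 1 / \<alpha> * t)" for t
    using \<alpha> by (simp add: indicator_reparam_times reparam_affine)
  have c: "1 / \<alpha> \<noteq> 0" using \<alpha> by simp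
  show "set_integrable lborel (reparam_times \<alpha> \<beta>) (\<lambda>t. u (reparam \<alpha> \<beta> t))"
    unfolding set_integrable_def eq
    by (rule lborel_integrable_real_affine[OF u[unfolded set_integrable_def] c])
  have "(LBINT t:{0..1}. u t) = \<bar>1 / \<alpha>\<bar> * (LBINT t:reparam_times \<alpha> \<beta>. u (reparam \<alpha> \<beta> t))"
    unfolding set_lebesgue_integral_def eq
    using lborel_integral_real_affine[OF c, of ?f "- \<beta> / \<alpha>"] by simp
  then show "(LBINT t:reparam_times \<alpha> \<beta>. u (reparam \<alpha> \<beta> t)) = \<bar>\<alpha>\<bar> * (LBINT t:{0..1}. u t)"
    using \<alpha> by (simp add: abs_divide)
qed

lemma spatial_test_affine:
  assumes \<zeta>: "spatial_test K \<zeta> g"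
  shows "spatial_test K (\<lambda>z. \<zeta> (fst z, \<beta> + \<alpha> * snd z)) (\<lambda>z. (fst (g (fst z, \<beta> + \<alpha> * snd z)), \<alpha> * snd (g (fst z, \<beta> + \<alpha> * snd z))))"
proof -
  let ?A = "\<lambda>z::'a \<times> real. (fst z, \<beta> + \<alpha> * snd z)"
  have d: "(\<zeta> has_derivative (\<lambda>h. h \<bullet> g z)) (at z)" for z
    using \<zeta> unfolding spatial_test_def gderiv_def by blast
  have A: "(?A has_derivative (\<lambda>h. (fst h, \<alpha> * snd h))) (at z)" for z
    by (auto intro!: derivative_eq_intros)
  have cg: "continuous_on UNIV g" using \<zeta> by (simp add: spatial_test_def)
  have c: "continuous_on UNIV (\<lambda>z. g (?A z))"
    by (rule continuous_on_compose2[OF cg]) (auto intro!: continuous_intros)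
  show ?thesis
    unfolding spatial_test_def
  proof (intro conjI allI impI)
    show "GDERIV (\<lambda>z. \<zeta> (?A z)) z :> (fst (g (?A z)), \<alpha> * snd (g (?A z)))" for z
      unfolding gderiv_def using has_derivative_compose[OF A d, of z]
      by (simp add: inner_prod_def mult.left_commute mult.assoc)
    show "continuous_on UNIV (\<lambda>z. (fst (g (?A z)), \<alpha> * snd (g (?A z))))"
      by (intro continuous_on_Pair continuous_on_fst continuous_on_mult continuous_on_const continuous_on_snd c)
  qed (use \<zeta> in \<open>auto simp: spatial_test_def\<close>)
qed

lemma nn_integral_concat_le:
  fixes F G :: "real \<Rightarrow> ennreal"
  assumes \<theta>: "0 < \<theta>" "\<theta> < 1"
  shows "(\<integral>\<^sup>+t\<in>{0..1}. (if t \<le> \<theta> then F t else G t) \<partial>lborel) \<le>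
    (\<integral>\<^sup>+t\<in>reparam_times \<theta> 0. F t \<partial>lborel) + (\<integral>\<^sup>+t\<in>reparam_times (1 - \<theta>) \<theta>. G t \<partial>lborel)"
proof -
  let ?H = "\<lambda>t. (if t \<le> \<theta> then F t else G t) * indicator {0..1} t"
  have "(\<integral>\<^sup>+t. ?H t \<partial>lborel) \<le> (\<integral>\<^sup>+t. ?H t * indicator {..\<theta>} t \<partial>lborel) + (\<integral>\<^sup>+t. ?H t * indicator (- {..\<theta>}) t \<partial>lborel)"
    by (rule nn_integral_split_le) simp
  also have "\<dots> \<le> (\<integral>\<^sup>+t\<in>reparam_times \<theta> 0. F t \<partial>lborel) + (\<integral>\<^sup>+t\<in>reparam_times (1 - \<theta>) \<theta>. G t \<partial>lborel)"
    using \<theta> by (intro add_mono nn_integral_mono) (auto simp: reparam_times_def reparam_def indicator_def)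
  finally show ?thesis .
qed

text \<open>Writes the concatenation as a sum of pieces extended by 0 to the whole line, so that
  measurability and integrability of the pieces can be used; the common time \<theta> is assigned to
  the first piece.\<close>

lemma indicator_concat:
  fixes u v :: "real \<Rightarrow> 'b::real_vector"
  assumes \<theta>: "0 < \<theta>" "\<theta> < 1"
  shows "indicator {0..1} t *\<^sub>R (if t \<le> \<theta> then u t else v t) =
    indicator {..\<theta>} t *\<^sub>R (indicator (reparam_times \<theta> 0) t *\<^sub>R u t) +
    indicator {\<theta><..} t *\<^sub>R (indicator (reparam_times (1 - \<theta>) \<theta>) t *\<^sub>R v t)"
  using \<theta> by (auto simp: reparam_times_def reparam_def indicator_def field_simps)

lemma set_integral_concat:
  fixes u v :: "real \<Rightarrow> real"
  assumes \<theta>: "0 < \<theta>" "\<theta> < 1"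
    and u: "set_integrable lborel (reparam_times \<theta> 0) u" and v: "set_integrable lborel (reparam_times (1 - \<theta>) \<theta>) v"
  shows "(LBINT t:{0..1}. (if t \<le> \<theta> then u t else v t)) =
    (LBINT t:reparam_times \<theta> 0. u t) + (LBINT t:reparam_times (1 - \<theta>) \<theta>. v t)"
proof -
  let ?u = "\<lambda>t. indicator (reparam_times \<theta> 0) t *\<^sub>R u t" and ?v = "\<lambda>t. indicator (reparam_times (1 - \<theta>) \<theta>) t *\<^sub>R v t"
  have i: "integrable lborel ?u" "integrable lborel ?v"
    using u v by (auto simp: set_integrable_def)
  have m: "?u \<in> borel_measurable lborel" "?v \<in> borel_measurable lborel"
    by (intro borel_measurable_integrable i)+
  have "(LBINT t:{0..1}. (if t \<le> \<theta> then u t else v t)) = (\<integral>t. ?u t + ?v t \<partial>lborel)"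
    unfolding set_lebesgue_integral_def indicator_concat[OF \<theta>]
  proof (rule integral_cong_AE)
    show "(\<lambda>t. indicator {..\<theta>} t *\<^sub>R ?u t + indicator {\<theta><..} t *\<^sub>R ?v t) \<in> borel_measurable lborel"
      by (intro borel_measurable_add borel_measurable_scaleR m borel_measurable_indicator) auto
    show "(\<lambda>t. ?u t + ?v t) \<in> borel_measurable lborel" by (intro borel_measurable_add m)
    have "AE t in lborel. t \<noteq> \<theta>" by (rule AE_lborel_singleton)
    then show "AE t in lborel. indicator {..\<theta>} t *\<^sub>R ?u t + indicator {\<theta><..} t *\<^sub>R ?v t = ?u t + ?v t"
    proof eventually_elim
      case (elim t)
      then show ?case
        using \<theta> by (auto simp: reparam_times_def reparam_def indicator_def field_simps)
    qed
  qed
  then show ?thesis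
    using i by (simp add: set_lebesgue_integral_def)
qed

section \<open>Constructing curves\<close>

context admissible_action
begin

text \<open>The bounds by \<gamma> supply the local mass condition on \<mu>. The weak equation is
  asked for all test functions that vanish at times 0 and 1, a larger class than
  \<open>C1c_test\<close> but the one for which boundary terms drop out directly.\<close>

lemma finite_action_curvesI:
  assumes ends: "\<mu> 0 = x" "\<mu> 1 = y"
    and btw: "\<And>t. t \<in> {0..1} \<Longrightarrow> \<mu> t \<in> between \<gamma> a b"
    and cont: "\<And>f. compactly_supported_continuous f \<Longrightarrow> continuous_on {0..1} (\<lambda>t. radon_integral (\<mu> t) f)"
    and meas: "\<And>B. bounded_borel B \<Longrightarrow> (\<lambda>t. indicator {0..1} t *\<^sub>R rmeas (\<nu> t) B) \<in> borel_measurable borel"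
    and fin: "\<And>R. 0 < R \<Longrightarrow> (\<integral>\<^sup>+t\<in>{0..1}. emeasure (total_variation (\<nu> t)) (ball 0 R) \<partial>lborel) < \<infinity>"
    and act: "total_action \<phi> \<gamma> \<mu> \<nu> < \<infinity>"
    and weak: "\<And>K \<zeta> g. spatial_test K \<zeta> g \<Longrightarrow> (\<And>x. \<zeta> (x, 0) = 0) \<Longrightarrow> (\<And>x. \<zeta> (x, 1) = 0) \<Longrightarrow>
      (LBINT t:{0..1}. radon_integral (\<mu> t) (\<lambda>x. snd (g (x, t)))) + (LBINT t:{0..1}. radon_integral (\<nu> t) (\<lambda>x. fst (g (x, t)))) = 0"
  shows "(\<mu>, \<nu>) \<in> finite_action_curves \<phi> \<gamma> x y"
proof -
  have "continuity_equation 1 \<mu> \<nu>"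
    unfolding continuity_equation_def
  proof (intro conjI allI impI fin)
    show "continuous_map (top_of_set {0..1}) weak_star \<mu>"
      using cont by (simp add: continuous_map_weak_star_iff)
    show "(\<lambda>t. rmeas (\<nu> t) B) \<in> borel_measurable (restrict_space borel {0..1})" if "bounded_borel B" for B
      using meas[OF that] by (subst borel_measurable_restrict_space_iff) auto
    show "(\<integral>\<^sup>+t\<in>{0..1}. emeasure (total_variation (\<mu> t)) (ball 0 R) \<partial>lborel) < \<infinity>" for R
    proof -
      let ?c = "ennreal (max \<bar>a\<bar> \<bar>b\<bar>) * emeasure \<gamma> (ball 0 R)"
      have c: "?c < \<infinity>"
        using nonneg_radon_finite[OF gamma, of "ball 0 R"] by (simp add: ennreal_mult_less_top)
      have "(\<integral>\<^sup>+t\<in>{0..1}. emeasure (total_variation (\<mu> t)) (ball 0 R) \<partial>lborel) \<le> (\<integral>\<^sup>+t. ?c * indicator {0..1::real} t \<partial>lborel)"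
        using between_total_variation_le(1)[OF gamma btw] by (intro nn_integral_mono) (auto simp: indicator_def)
      also have "\<dots> = ?c" by (simp add: nn_integral_cmult_indicator)
      finally show ?thesis using c by (rule order_le_less_trans)
    qed
    fix \<zeta> :: "'a \<times> real \<Rightarrow> real" and g assume "C1c_test 1 \<zeta> g"
    then obtain K where K: "compact K" "K \<subseteq> UNIV \<times> {0<..<1}" "\<And>z. z \<notin> K \<Longrightarrow> \<zeta> z = 0"
      and g: "\<And>z. GDERIV \<zeta> z :> g z" "continuous_on UNIV g"
      by (auto simp: C1c_test_def)
    have "spatial_test (fst ` K) \<zeta> g"
      unfolding spatial_test_def
    proof (intro conjI allI impI g)
      show "compact (fst ` K)" by (intro compact_continuous_image K(1) continuous_intros)
      show "\<zeta> (x, t) = 0" if "x \<notin> fst ` K" for x t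
        using that by (intro K(3)) (auto simp: image_iff)
    qed
    moreover have "\<zeta> (x, 0) = 0" "\<zeta> (x, 1) = 0" for x using K(2) by (auto intro!: K(3))
    ultimately show "(LBINT t:{0..1}. radon_integral (\<mu> t) (\<lambda>x. snd (g (x, t)))) + (LBINT t:{0..1}. radon_integral (\<nu> t) (\<lambda>x. fst (g (x, t)))) = 0"
      by (rule weak)
  qed
  then show ?thesis
    using ends act by (simp add: finite_action_curves_def)
qed

text \<open>The change of variables contributes \<bar>\<alpha>\<bar> to both integrals, and the flux
  carries an extra 1 / \<alpha>; what remains in front of the boundary terms is the orientation
  \<open>sgn \<alpha>\<close>.\<close>

lemma curve_reparam_weak:
  assumes \<alpha>: "\<alpha> \<noteq> 0" and c: "(\<mu>, \<nu>) \<in> finite_action_curves \<phi> \<gamma> x y" and \<zeta>: "spatial_test K \<zeta> g"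
  shows "set_integrable lborel (reparam_times \<alpha> \<beta>) (\<lambda>t. radon_integral (\<mu> (reparam \<alpha> \<beta> t)) (\<lambda>x. snd (g (x, t))))"
    and "set_integrable lborel (reparam_times \<alpha> \<beta>) (\<lambda>t. radon_integral (scale_radon (1 / \<alpha>) (\<nu> (reparam \<alpha> \<beta> t))) (\<lambda>x. fst (g (x, t))))"
    and "(LBINT t:reparam_times \<alpha> \<beta>. radon_integral (\<mu> (reparam \<alpha> \<beta> t)) (\<lambda>x. snd (g (x, t)))) +
      (LBINT t:reparam_times \<alpha> \<beta>. radon_integral (scale_radon (1 / \<alpha>) (\<nu> (reparam \<alpha> \<beta> t))) (\<lambda>x. fst (g (x, t)))) =
      sgn \<alpha> * (radon_integral y (\<lambda>x. \<zeta> (x, \<beta> + \<alpha>)) - radon_integral x (\<lambda>x. \<zeta> (x, \<beta>)))"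
proof -
  let ?P = "\<lambda>s. radon_integral (\<mu> s) (\<lambda>x. snd (g (x, \<beta> + \<alpha> * s)))"
  let ?N = "\<lambda>s. radon_integral (\<nu> s) (\<lambda>x. fst (g (x, \<beta> + \<alpha> * s)))"
  note B = curve_boundary[OF c spatial_test_affine[OF \<zeta>, of \<beta> \<alpha>]]
  have P': "radon_integral (\<mu> s) (\<lambda>x. \<alpha> * snd (g (x, \<beta> + \<alpha> * s))) = \<alpha> * ?P s" for s
    using radon_integral_scaleR[of "\<mu> s" \<alpha> "\<lambda>x. snd (g (x, \<beta> + \<alpha> * s))"] by simp
  have iP: "set_integrable lborel {0..1} ?P" and iN: "set_integrable lborel {0..1} ?N"
    and eq: "\<alpha> * (LBINT s:{0..1}. ?P s) + (LBINT s:{0..1}. ?N s) = radon_integral y (\<lambda>x. \<zeta> (x, \<beta> + \<alpha>)) - radon_integral x (\<lambda>x. \<zeta> (x, \<beta>))"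
    using B \<alpha> by (simp_all add: P')
  have 1: "radon_integral (\<mu> (reparam \<alpha> \<beta> t)) (\<lambda>x. snd (g (x, t))) = ?P (reparam \<alpha> \<beta> t)" for t
    by (simp add: reparam_inverse[OF \<alpha>])
  have 2: "radon_integral (scale_radon (1 / \<alpha>) (\<nu> (reparam \<alpha> \<beta> t))) (\<lambda>x. fst (g (x, t))) = 1 / \<alpha> * ?N (reparam \<alpha> \<beta> t)" for t
    unfolding radon_integral_scale_radon[OF slice_fn_bounded_fn[OF spatial_test_slices(3)[OF \<zeta>]]]
    by (simp add: reparam_inverse[OF \<alpha>])
  show "set_integrable lborel (reparam_times \<alpha> \<beta>) (\<lambda>t. radon_integral (\<mu> (reparam \<alpha> \<beta> t)) (\<lambda>x. snd (g (x, t))))"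
    unfolding 1 by (rule set_integral_reparam(1)[OF \<alpha> iP])
  show "set_integrable lborel (reparam_times \<alpha> \<beta>) (\<lambda>t. radon_integral (scale_radon (1 / \<alpha>) (\<nu> (reparam \<alpha> \<beta> t))) (\<lambda>x. fst (g (x, t))))"
    unfolding 2 by (intro set_integrable_mult_right set_integral_reparam(1)[OF \<alpha> iN])
  have "(LBINT t:reparam_times \<alpha> \<beta>. ?P (reparam \<alpha> \<beta> t)) + (LBINT t:reparam_times \<alpha> \<beta>. 1 / \<alpha> * ?N (reparam \<alpha> \<beta> t)) =
      \<bar>\<alpha>\<bar> * (LBINT s:{0..1}. ?P s) + 1 / \<alpha> * (\<bar>\<alpha>\<bar> * (LBINT s:{0..1}. ?N s))"
    unfolding set_integral_mult_right set_integral_reparam(2)[OF \<alpha> iP] set_integral_reparam(2)[OF \<alpha> iN] ..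
  also have "\<dots> = sgn \<alpha> * (\<alpha> * (LBINT s:{0..1}. ?P s) + (LBINT s:{0..1}. ?N s))"
    using \<alpha> by (cases "0 < \<alpha>") (auto simp: algebra_simps)
  finally show "(LBINT t:reparam_times \<alpha> \<beta>. radon_integral (\<mu> (reparam \<alpha> \<beta> t)) (\<lambda>x. snd (g (x, t)))) +
      (LBINT t:reparam_times \<alpha> \<beta>. radon_integral (scale_radon (1 / \<alpha>) (\<nu> (reparam \<alpha> \<beta> t))) (\<lambda>x. fst (g (x, t)))) =
      sgn \<alpha> * (radon_integral y (\<lambda>x. \<zeta> (x, \<beta> + \<alpha>)) - radon_integral x (\<lambda>x. \<zeta> (x, \<beta>)))"
    unfolding 1 2 eq .
qed

text \<open>Scaling the flux by 1 / \<alpha> costs the power -p of \<bar>\<alpha>\<bar>, the change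
  of variables gives one power back; hence the exponent 1 - p.\<close>

lemma curve_reparam_bounds:
  assumes \<alpha>: "\<alpha> \<noteq> 0" and c: "(\<mu>, \<nu>) \<in> finite_action_curves \<phi> \<gamma> x y"
  shows "0 < R \<Longrightarrow> (\<integral>\<^sup>+t\<in>reparam_times \<alpha> \<beta>. emeasure (total_variation (scale_radon (1 / \<alpha>) (\<nu> (reparam \<alpha> \<beta> t)))) (ball 0 R) \<partial>lborel) < \<infinity>"
    and "(\<integral>\<^sup>+t\<in>reparam_times \<alpha> \<beta>. action \<phi> \<gamma> (\<mu> (reparam \<alpha> \<beta> t)) (scale_radon (1 / \<alpha>) (\<nu> (reparam \<alpha> \<beta> t))) \<partial>lborel) \<le>
      ennreal (\<bar>\<alpha>\<bar> powr (1 - p)) * total_action \<phi> \<gamma> \<mu> \<nu>"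
proof -
  assume R: "0 < R"
  let ?T = "\<lambda>s. emeasure (total_variation (\<nu> s)) (ball 0 R)"
  have k: "0 < \<bar>1 / \<alpha>\<bar>" using \<alpha> by simp
  have "(\<integral>\<^sup>+t\<in>reparam_times \<alpha> \<beta>. emeasure (total_variation (scale_radon (1 / \<alpha>) (\<nu> (reparam \<alpha> \<beta> t)))) (ball 0 R) \<partial>lborel)
      \<le> (\<integral>\<^sup>+t\<in>reparam_times \<alpha> \<beta>. (ennreal \<bar>1 / \<alpha>\<bar> * ?T (reparam \<alpha> \<beta> t)) \<partial>lborel)"
    by (intro nn_integral_mono mult_right_mono total_variation_scale_radon_le) auto
  also have "\<dots> \<le> ennreal (\<bar>1 / \<alpha>\<bar> * \<bar>\<alpha>\<bar>) * (\<integral>\<^sup>+t\<in>{0..1}. ?T t \<partial>lborel)"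
    by (rule nn_integral_reparam_le[OF \<alpha> k])
  also have "\<dots> < \<infinity>"
    using finite_action_curvesD(5)[OF c R] by (simp add: ennreal_mult_less_top)
  finally show "(\<integral>\<^sup>+t\<in>reparam_times \<alpha> \<beta>. emeasure (total_variation (scale_radon (1 / \<alpha>) (\<nu> (reparam \<alpha> \<beta> t)))) (ball 0 R) \<partial>lborel) < \<infinity>" .
next
  let ?A = "\<lambda>s. action \<phi> \<gamma> (\<mu> s) (\<nu> s)"
  have k: "0 < \<bar>1 / \<alpha>\<bar> powr p" using \<alpha> by simp
  have "(\<integral>\<^sup>+t\<in>reparam_times \<alpha> \<beta>. action \<phi> \<gamma> (\<mu> (reparam \<alpha> \<beta> t)) (scale_radon (1 / \<alpha>) (\<nu> (reparam \<alpha> \<beta> t))) \<partial>lborel)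
      \<le> (\<integral>\<^sup>+t\<in>reparam_times \<alpha> \<beta>. (ennreal (\<bar>1 / \<alpha>\<bar> powr p) * ?A (reparam \<alpha> \<beta> t)) \<partial>lborel)"
    using \<alpha> by (intro nn_integral_mono mult_right_mono action_scale_radon_le) auto
  also have "\<dots> \<le> ennreal (\<bar>1 / \<alpha>\<bar> powr p * \<bar>\<alpha>\<bar>) * (\<integral>\<^sup>+t\<in>{0..1}. ?A t \<partial>lborel)"
    by (rule nn_integral_reparam_le[OF \<alpha> k])
  also have "\<bar>1 / \<alpha>\<bar> powr p * \<bar>\<alpha>\<bar> = \<bar>\<alpha>\<bar> powr (1 - p)"
    using \<alpha> by (simp add: powr_diff powr_divide abs_divide)
  finally show "(\<integral>\<^sup>+t\<in>reparam_times \<alpha> \<beta>. action \<phi> \<gamma> (\<mu> (reparam \<alpha> \<beta> t)) (scale_radon (1 / \<alpha>) (\<nu> (reparam \<alpha> \<beta> t))) \<partial>lborel) \<le>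
      ennreal (\<bar>\<alpha>\<bar> powr (1 - p)) * total_action \<phi> \<gamma> \<mu> \<nu>"
    by (simp add: total_action_def)
qed

lemma curve_reparam_continuous_measurable:
  assumes \<alpha>: "\<alpha> \<noteq> 0" and c: "(\<mu>, \<nu>) \<in> finite_action_curves \<phi> \<gamma> x y"
  shows "compactly_supported_continuous f \<Longrightarrow> continuous_on (reparam_times \<alpha> \<beta>) (\<lambda>t. radon_integral (\<mu> (reparam \<alpha> \<beta> t)) f)"
    and "bounded_borel B \<Longrightarrow> (\<lambda>t. indicator (reparam_times \<alpha> \<beta>) t *\<^sub>R rmeas (scale_radon (1 / \<alpha>) (\<nu> (reparam \<alpha> \<beta> t))) B) \<in> borel_measurable borel"
proof -
  assume f: "compactly_supported_continuous f"
  show "continuous_on (reparam_times \<alpha> \<beta>) (\<lambda>t. radon_integral (\<mu> (reparam \<alpha> \<beta> t)) f)"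
    using finite_action_curvesD(3)[OF c] f by (intro reparam_continuous_on[OF \<alpha>]) (simp add: continuous_map_weak_star_iff)
next
  assume B: "bounded_borel B"
  have "(\<lambda>t. rmeas (scale_radon (1 / \<alpha>) (\<nu> t)) B) \<in> borel_measurable (restrict_space borel {0..1})"
    unfolding rmeas_scale_radon by (intro borel_measurable_scaleR borel_measurable_const finite_action_curvesD(4)[OF c B])
  then show "(\<lambda>t. indicator (reparam_times \<alpha> \<beta>) t *\<^sub>R rmeas (scale_radon (1 / \<alpha>) (\<nu> (reparam \<alpha> \<beta> t))) B) \<in> borel_measurable borel"
    by (rule reparam_measurable)
qed

section \<open>Reversed, concatenated and constant curves\<close>

lemma curve_reverse:
  assumes c: "(\<mu>, \<nu>) \<in> finite_action_curves \<phi> \<gamma> x y"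
  obtains \<mu>' \<nu>' where "(\<mu>', \<nu>') \<in> finite_action_curves \<phi> \<gamma> y x" "total_action \<phi> \<gamma> \<mu>' \<nu>' \<le> total_action \<phi> \<gamma> \<mu> \<nu>"
proof -
  let ?r = "reparam (-1) 1"
  let ?\<mu> = "\<lambda>t. \<mu> (?r t)" and ?\<nu> = "\<lambda>t. scale_radon (1 / -1) (\<nu> (?r t))"
  have I: "reparam_times (-1) 1 = {0..1}" by (auto simp: reparam_times_def reparam_def)
  have \<alpha>: "(-1::real) \<noteq> 0" by simp
  note cm = curve_reparam_continuous_measurable[OF \<alpha> c, where \<beta> = 1, unfolded I]
  note bd = curve_reparam_bounds[OF \<alpha> c, where \<beta> = 1, unfolded I]
  have act: "total_action \<phi> \<gamma> ?\<mu> ?\<nu> \<le> total_action \<phi> \<gamma> \<mu> \<nu>"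
    using bd(2) by (simp add: total_action_def)
  have "(?\<mu>, ?\<nu>) \<in> finite_action_curves \<phi> \<gamma> y x"
  proof (rule finite_action_curvesI)
    show "\<mu> (?r 0) = y" "\<mu> (?r 1) = x"
      using finite_action_curvesD(1,2)[OF c] by (simp_all add: reparam_def)
    show "\<mu> (?r t) \<in> between \<gamma> a b" if "t \<in> {0..1}" for t
      using that by (intro curve_between[OF c]) (auto simp: reparam_def)
    show "total_action \<phi> \<gamma> ?\<mu> ?\<nu> < \<infinity>"
      using act finite_action_curvesD(6)[OF c] by (auto simp: total_action_def intro: order_le_less_trans)
    fix K and \<zeta> :: "'a \<times> real \<Rightarrow> real" and g assume \<zeta>: "spatial_test K \<zeta> g" "\<And>x. \<zeta> (x, 0) = 0" "\<And>x. \<zeta> (x, 1) = 0"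
    show "(LBINT t:{0..1}. radon_integral (?\<mu> t) (\<lambda>x. snd (g (x, t)))) + (LBINT t:{0..1}. radon_integral (?\<nu> t) (\<lambda>x. fst (g (x, t)))) = 0"
      using curve_reparam_weak(3)[OF \<alpha> c \<zeta>(1), where \<beta> = 1, unfolded I] \<zeta>(2,3) by simp
  qed (use cm bd(1) in blast)+
  with act show thesis using that by blast
qed

lemma curve_concat:
  assumes c1: "(\<mu>1, \<nu>1) \<in> finite_action_curves \<phi> \<gamma> x y" and c2: "(\<mu>2, \<nu>2) \<in> finite_action_curves \<phi> \<gamma> y z"
    and \<theta>: "0 < \<theta>" "\<theta> < 1"
  obtains \<mu> \<nu> where "(\<mu>, \<nu>) \<in> finite_action_curves \<phi> \<gamma> x z"
    "total_action \<phi> \<gamma> \<mu> \<nu> \<le> ennreal (\<theta> powr (1 - p)) * total_action \<phi> \<gamma> \<mu>1 \<nu>1 + ennreal ((1 - \<theta>) powr (1 - p)) * total_action \<phi> \<gamma> \<mu>2 \<nu>2"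
proof -
  let ?r1 = "reparam \<theta> 0" and ?r2 = "reparam (1 - \<theta>) \<theta>"
  let ?I1 = "reparam_times \<theta> 0" and ?I2 = "reparam_times (1 - \<theta>) \<theta>"
  let ?\<mu>1 = "\<lambda>t. \<mu>1 (?r1 t)" and ?\<nu>1 = "\<lambda>t. scale_radon (1 / \<theta>) (\<nu>1 (?r1 t))"
  let ?\<mu>2 = "\<lambda>t. \<mu>2 (?r2 t)" and ?\<nu>2 = "\<lambda>t. scale_radon (1 / (1 - \<theta>)) (\<nu>2 (?r2 t))"
  define \<mu> where "\<mu> t = (if t \<le> \<theta> then ?\<mu>1 t else ?\<mu>2 t)" for t
  define \<nu> where "\<nu> t = (if t \<le> \<theta> then ?\<nu>1 t else ?\<nu>2 t)" for t
  have \<alpha>: "\<theta> \<noteq> 0" "1 - \<theta> \<noteq> 0" using \<theta> by auto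
  have I: "?I1 = {0..\<theta>}" "?I2 = {\<theta>..1}"
    using \<theta> by (auto simp: reparam_times_def reparam_def field_simps)
  note cm1 = curve_reparam_continuous_measurable[OF \<alpha>(1) c1, where \<beta> = 0]
  note cm2 = curve_reparam_continuous_measurable[OF \<alpha>(2) c2, where \<beta> = \<theta>]
  note bd1 = curve_reparam_bounds[OF \<alpha>(1) c1, where \<beta> = 0]
  note bd2 = curve_reparam_bounds[OF \<alpha>(2) c2, where \<beta> = \<theta>]
  have join: "?\<mu>1 \<theta> = ?\<mu>2 \<theta>"
    using finite_action_curvesD(2)[OF c1] finite_action_curvesD(1)[OF c2] \<theta> by (simp add: reparam_def)
  have "total_action \<phi> \<gamma> \<mu> \<nu> = (\<integral>\<^sup>+t\<in>{0..1}. (if t \<le> \<theta> then action \<phi> \<gamma> (?\<mu>1 t) (?\<nu>1 t) else action \<phi> \<gamma> (?\<mu>2 t) (?\<nu>2 t)) \<partial>lborel)"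
    unfolding total_action_def by (intro nn_integral_cong) (simp add: \<mu>_def \<nu>_def)
  also have "\<dots> \<le> (\<integral>\<^sup>+t\<in>?I1. action \<phi> \<gamma> (?\<mu>1 t) (?\<nu>1 t) \<partial>lborel) + (\<integral>\<^sup>+t\<in>?I2. action \<phi> \<gamma> (?\<mu>2 t) (?\<nu>2 t) \<partial>lborel)"
    by (rule nn_integral_concat_le[OF \<theta>])
  also have "\<dots> \<le> ennreal (\<theta> powr (1 - p)) * total_action \<phi> \<gamma> \<mu>1 \<nu>1 + ennreal ((1 - \<theta>) powr (1 - p)) * total_action \<phi> \<gamma> \<mu>2 \<nu>2"
    using bd1(2) bd2(2) \<theta> by (intro add_mono) (simp_all add: abs_of_pos)
  finally have act: "total_action \<phi> \<gamma> \<mu> \<nu> \<le> ennreal (\<theta> powr (1 - p)) * total_action \<phi> \<gamma> \<mu>1 \<nu>1 + ennreal ((1 - \<theta>) powr (1 - p)) * total_action \<phi> \<gamma> \<mu>2 \<nu>2" .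
  have "(\<mu>, \<nu>) \<in> finite_action_curves \<phi> \<gamma> x z"
  proof (rule finite_action_curvesI)
    show "\<mu> 0 = x" "\<mu> 1 = z"
      using finite_action_curvesD(1)[OF c1] finite_action_curvesD(2)[OF c2] \<theta> by (simp_all add: \<mu>_def reparam_def)
    show "\<mu> t \<in> between \<gamma> a b" if t: "t \<in> {0..1}" for t
    proof (cases "t \<le> \<theta>")
      case True
      then have "?r1 t \<in> {0..1}" using t \<theta> by (auto simp: reparam_def)
      then show ?thesis using True curve_between[OF c1] by (simp add: \<mu>_def)
    next
      case False
      then have "?r2 t \<in> {0..1}" using t \<theta> by (auto simp: reparam_def)
      then show ?thesis using False curve_between[OF c2] by (simp add: \<mu>_def)
    qed
    show "continuous_on {0..1} (\<lambda>t. radon_integral (\<mu> t) f)" if f: "compactly_supported_continuous f" for f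
    proof -
      have U: "{0..1} = {0..\<theta>} \<union> {\<theta>..1}" using \<theta> by auto
      have eq: "(\<lambda>t. radon_integral (\<mu> t) f) = (\<lambda>t. if t \<le> \<theta> then radon_integral (?\<mu>1 t) f else radon_integral (?\<mu>2 t) f)"
        by (auto simp: \<mu>_def)
      have "continuous_on ({0..\<theta>} \<union> {\<theta>..1}) (\<lambda>t. if t \<le> \<theta> then radon_integral (?\<mu>1 t) f else radon_integral (?\<mu>2 t) f)"
      proof (rule continuous_on_cases)
        show "continuous_on {0..\<theta>} (\<lambda>t. radon_integral (?\<mu>1 t) f)" "continuous_on {\<theta>..1} (\<lambda>t. radon_integral (?\<mu>2 t) f)"
          using cm1(1)[OF f] cm2(1)[OF f] by (simp_all add: I)
        show "\<forall>t. t \<in> {0..\<theta>} \<and> \<not> t \<le> \<theta> \<or> t \<in> {\<theta>..1} \<and> t \<le> \<theta> \<longrightarrow> radon_integral (?\<mu>1 t) f = radon_integral (?\<mu>2 t) f"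
          using join by (auto dest: antisym)
      qed auto
      then show ?thesis unfolding U eq .
    qed
    show "(\<lambda>t. indicator {0..1} t *\<^sub>R rmeas (\<nu> t) B) \<in> borel_measurable borel" if B: "bounded_borel B" for B
    proof -
      have eq: "indicator {0..1} t *\<^sub>R rmeas (\<nu> t) B = indicator {..\<theta>} t *\<^sub>R (indicator ?I1 t *\<^sub>R rmeas (?\<nu>1 t) B) +
          indicator {\<theta><..} t *\<^sub>R (indicator ?I2 t *\<^sub>R rmeas (?\<nu>2 t) B)" for t
      proof -
        have "rmeas (\<nu> t) B = (if t \<le> \<theta> then rmeas (?\<nu>1 t) B else rmeas (?\<nu>2 t) B)"
          by (simp only: \<nu>_def split: if_split) blast
        then show ?thesis
          by (simp only: indicator_concat[OF \<theta>, of t "\<lambda>t. rmeas (?\<nu>1 t) B" "\<lambda>t. rmeas (?\<nu>2 t) B"])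
      qed
      show ?thesis
        unfolding eq
        by (rule borel_measurable_add[OF borel_measurable_scaleR[OF _ cm1(2)[OF B]] borel_measurable_scaleR[OF _ cm2(2)[OF B]]]) measurable
    qed
    show "(\<integral>\<^sup>+t\<in>{0..1}. emeasure (total_variation (\<nu> t)) (ball 0 R) \<partial>lborel) < \<infinity>" if R: "0 < R" for R
    proof -
      have "(\<integral>\<^sup>+t\<in>{0..1}. emeasure (total_variation (\<nu> t)) (ball 0 R) \<partial>lborel) =
          (\<integral>\<^sup>+t\<in>{0..1}. (if t \<le> \<theta> then emeasure (total_variation (?\<nu>1 t)) (ball 0 R) else emeasure (total_variation (?\<nu>2 t)) (ball 0 R)) \<partial>lborel)"
        by (intro nn_integral_cong) (simp add: \<nu>_def)
      also note nn_integral_concat_le[OF \<theta>]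
      also have "(\<integral>\<^sup>+t\<in>?I1. emeasure (total_variation (?\<nu>1 t)) (ball 0 R) \<partial>lborel) + (\<integral>\<^sup>+t\<in>?I2. emeasure (total_variation (?\<nu>2 t)) (ball 0 R) \<partial>lborel) < \<infinity>"
        using bd1(1)[OF R] bd2(1)[OF R] by simp
      finally show ?thesis .
    qed
    show "total_action \<phi> \<gamma> \<mu> \<nu> < \<infinity>"
      using act finite_action_curvesD(6)[OF c1] finite_action_curvesD(6)[OF c2]
      by (auto simp: total_action_def ennreal_mult_less_top intro: order_le_less_trans)
    fix K and \<zeta> :: "'a \<times> real \<Rightarrow> real" and g assume \<zeta>: "spatial_test K \<zeta> g" "\<And>x. \<zeta> (x, 0) = 0" "\<And>x. \<zeta> (x, 1) = 0"
    note w1 = curve_reparam_weak[OF \<alpha>(1) c1 \<zeta>(1), where \<beta> = 0]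
    note w2 = curve_reparam_weak[OF \<alpha>(2) c2 \<zeta>(1), where \<beta> = \<theta>]
    have 1: "radon_integral (\<mu> t) (\<lambda>x. snd (g (x, t))) =
        (if t \<le> \<theta> then radon_integral (?\<mu>1 t) (\<lambda>x. snd (g (x, t))) else radon_integral (?\<mu>2 t) (\<lambda>x. snd (g (x, t))))" for t
      by (simp add: \<mu>_def)
    have 2: "radon_integral (\<nu> t) (\<lambda>x. fst (g (x, t))) =
        (if t \<le> \<theta> then radon_integral (?\<nu>1 t) (\<lambda>x. fst (g (x, t))) else radon_integral (?\<nu>2 t) (\<lambda>x. fst (g (x, t))))" for t
      by (simp add: \<nu>_def)
    \<comment> \<open>The pieces have the common end point y, so the boundary terms at time \<theta>
      cancel; those at 0 and 1 vanish with the test function.\<close>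
    show "(LBINT t:{0..1}. radon_integral (\<mu> t) (\<lambda>x. snd (g (x, t)))) + (LBINT t:{0..1}. radon_integral (\<nu> t) (\<lambda>x. fst (g (x, t)))) = 0"
      unfolding 1 2 set_integral_concat[OF \<theta> w1(1) w2(1)] set_integral_concat[OF \<theta> w1(2) w2(2)]
      using w1(3) w2(3) \<theta> \<zeta>(2,3) by simp
  qed
  with act show thesis using that by blast
qed

text \<open>With zero flux the equation reduces to the fundamental theorem of calculus for the
  integral of \<zeta> against x, as a function of time. What has to be proved is differentiation
  under the integral, done by a uniform bound on difference quotients.\<close>

lemma curve_constant:
  assumes x: "x \<in> between \<gamma> a b"
  shows "((\<lambda>_. x), (\<lambda>_. zero_radon)) \<in> finite_action_curves \<phi> \<gamma> x x"
    and "total_action \<phi> \<gamma> (\<lambda>_. x) (\<lambda>_. zero_radon) = 0"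
proof -
  show act: "total_action \<phi> \<gamma> (\<lambda>_. x) (\<lambda>_. zero_radon) = 0"
    unfolding total_action_def by (simp add: action_zero_radon[OF x])
  show "((\<lambda>_. x), (\<lambda>_. zero_radon)) \<in> finite_action_curves \<phi> \<gamma> x x"
  proof (rule finite_action_curvesI)
    show "(\<integral>\<^sup>+t\<in>{0..1}. emeasure (total_variation (zero_radon :: ('a, 'a) radon)) (ball 0 R) \<partial>lborel) < \<infinity>" for R
      using total_variation_zero[of "zero_radon :: ('a, 'a) radon" "ball 0 R"] by simp
    fix K and \<zeta> :: "'a \<times> real \<Rightarrow> real" and g assume \<zeta>: "spatial_test K \<zeta> g" "\<And>x. \<zeta> (x, 0) = 0" "\<And>x. \<zeta> (x, 1) = 0"
    note sl = spatial_test_slices[OF \<zeta>(1)]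
    let ?F = "\<lambda>t. radon_integral x (\<lambda>x. \<zeta> (x, t))" and ?P = "\<lambda>t. radon_integral x (\<lambda>x. snd (g (x, t)))"
    have P: "continuous_on {0..1} ?P"
      by (rule between_slice_continuous[OF _ x sl(2)]) simp
    define D where "D = DIM(real) * measure (total_variation x) K"
    have D: "0 \<le> D" by (simp add: D_def)
    have "(?F has_real_derivative ?P t) (at t)" if t: "t \<in> {0..1}" for t
      unfolding DERIV_def LIM_eq
    proof (intro allI impI)
      fix e :: real assume e: "0 < e"
      define e' where "e' = e / (D + 1)"
      have D1: "0 < D + 1" using D by linarith
      then have e': "0 < e'" "e' * D < e"
      proof -
        show "0 < e'" using e D1 by (simp add: e'_def)
        then have "e' * D < e' * (D + 1)" by (intro mult_strict_left_mono) auto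
        then show "e' * D < e" using D1 by (simp add: e'_def)
      qed
      obtain d where d: "0 < d" "\<And>s t x. s \<in> {-1..2} \<Longrightarrow> t \<in> {-1..2} \<Longrightarrow> \<bar>s - t\<bar> < d \<Longrightarrow> norm (snd (g (x, s)) - snd (g (x, t))) \<le> e'"
        using slice_fn_uniform[OF sl(2) e'(1)] by metis
      show "\<exists>s>0. \<forall>h. h \<noteq> 0 \<and> norm (h - 0) < s \<longrightarrow> norm ((?F (t + h) - ?F t) / h - ?P t) < e"
      proof (intro exI[of _ "min d 1"] conjI allI impI)
        show "0 < min d 1" using d by simp
        fix h :: real assume h: "h \<noteq> 0 \<and> norm (h - 0) < min d 1"
        let ?V = "\<lambda>x. (1 / h) *\<^sub>R (\<zeta> (x, t + h) - \<zeta> (x, t)) - snd (g (x, t))"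
        have bV: "bounded_fn K ?V"
          by (intro bounded_fn_diff bounded_fn_scaleR slice_fn_bounded_fn sl)
        have V: "norm (?V x) \<le> e'" for x
        proof -
          \<comment> \<open>Subtracting the linear part leaves a function of time whose derivative
            is at most e' near t; the mean value inequality then bounds the error of the difference
            quotient uniformly in space.\<close>
          let ?\<psi> = "\<lambda>s. \<zeta> (x, s) - s * snd (g (x, t))"
          have "norm (?\<psi> (t + h) - ?\<psi> t) \<le> e' * norm (t + h - t)"
          proof (rule field_differentiable_bound[where S = "cball t \<bar>h\<bar>"])
            fix s assume s: "s \<in> cball t \<bar>h\<bar>"
            have "((\<lambda>s. \<zeta> (x, s)) has_real_derivative snd (g (x, s))) (at s)"
            proof -
              have "(\<zeta> has_derivative (\<lambda>v. v \<bullet> g (x, s))) (at (x, s))"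
                using \<zeta>(1) by (simp add: spatial_test_def gderiv_def)
              moreover have "((\<lambda>s. (x, s)) has_derivative (\<lambda>v. (0, v))) (at s)"
                by (auto intro!: derivative_eq_intros)
              ultimately have "((\<lambda>s. \<zeta> (x, s)) has_derivative (\<lambda>v. (0, v) \<bullet> g (x, s))) (at s)"
                by (rule has_derivative_compose[rotated])
              then show ?thesis
                by (simp add: has_field_derivative_def inner_prod_def mult_commute_abs)
            qed
            then show "(?\<psi> has_real_derivative snd (g (x, s)) - snd (g (x, t))) (at s within cball t \<bar>h\<bar>)"
              by (auto intro!: derivative_eq_intros intro: has_field_derivative_at_within)
            have "\<bar>s - t\<bar> \<le> \<bar>h\<bar>" using s by (simp add: dist_real_def abs_minus_commute)
            then have "s \<in> {-1..2}" "t \<in> {-1..2}" "\<bar>s - t\<bar> < d" using h t by auto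
            then show "norm (snd (g (x, s)) - snd (g (x, t))) \<le> e'" by (rule d(2))
          qed (auto simp: dist_real_def)
          moreover have "?V x = (?\<psi> (t + h) - ?\<psi> t) / h"
            using h by (simp add: field_simps)
          ultimately show ?thesis using h by (simp add: field_simps)
        qed
        have "(?F (t + h) - ?F t) / h - ?P t = radon_integral x ?V"
          unfolding radon_integral_diff[OF bounded_fn_scaleR[OF bounded_fn_diff[OF slice_fn_bounded_fn[OF sl(1)] slice_fn_bounded_fn[OF sl(1)]]] slice_fn_bounded_fn[OF sl(2)]]
            radon_integral_scaleR radon_integral_diff[OF slice_fn_bounded_fn[OF sl(1)] slice_fn_bounded_fn[OF sl(1)]]
          by simp
        also have "norm \<dots> \<le> e' * D"
          using radon_integral_bound[OF bV V, of x] by (simp add: D_def)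
        also have "\<dots> < e" by (rule e')
        finally show "norm ((?F (t + h) - ?F t) / h - ?P t) < e" .
      qed
    qed
    then have "(?P has_integral ?F 1 - ?F 0) {0..1}"
      by (intro fundamental_theorem_of_calculus)
        (auto simp flip: has_real_derivative_iff_has_vector_derivative intro: has_field_derivative_at_within)
    then have "(LBINT t:{0..1}. ?P t) = ?F 1 - ?F 0"
      using set_borel_integral_eq_integral(2)[OF borel_integrable_atLeastAtMost'[OF P]] by (simp add: integral_unique)
    then show "(LBINT t:{0..1}. ?P t) + (LBINT t:{0..1}. radon_integral zero_radon (\<lambda>x. fst (g (x, t)))) = 0"
      using \<zeta>(2,3) by simp
  qed (use x act in auto)
qed

end

section \<open>The pseudo-distance\<close>

context admissible_action
begin

lemma W_dist_le_action:
  assumes "(\<mu>, \<nu>) \<in> finite_action_curves \<phi> \<gamma> x y"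
  shows "W_dist p \<phi> \<gamma> x y \<le> ennreal (enn2real (total_action \<phi> \<gamma> \<mu> \<nu>) powr (1 / p))"
  unfolding W_dist_def using assms by (intro INF_lower2[of "(\<mu>, \<nu>)"]) auto

lemma W_dist_refl: "x \<in> between \<gamma> a b \<Longrightarrow> W_dist p \<phi> \<gamma> x x = 0"
  using W_dist_le_action[OF curve_constant(1)] curve_constant(2) by fastforce

lemma W_dist_sym_le: "W_dist p \<phi> \<gamma> y x \<le> W_dist p \<phi> \<gamma> x y"
proof -
  have "W_dist p \<phi> \<gamma> y x \<le> ennreal (enn2real (total_action \<phi> \<gamma> \<mu> \<nu>) powr (1 / p))"
    if c: "(\<mu>, \<nu>) \<in> finite_action_curves \<phi> \<gamma> x y" for \<mu> \<nu>
  proof -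
    obtain \<mu>' \<nu>' where r: "(\<mu>', \<nu>') \<in> finite_action_curves \<phi> \<gamma> y x" "total_action \<phi> \<gamma> \<mu>' \<nu>' \<le> total_action \<phi> \<gamma> \<mu> \<nu>"
      using curve_reverse[OF c] by blast
    have "total_action \<phi> \<gamma> \<mu> \<nu> < top"
      using c by (simp add: finite_action_curves_def)
    then have "enn2real (total_action \<phi> \<gamma> \<mu>' \<nu>') \<le> enn2real (total_action \<phi> \<gamma> \<mu> \<nu>)"
      using r(2) by (intro enn2real_mono)
    then have "ennreal (enn2real (total_action \<phi> \<gamma> \<mu>' \<nu>') powr (1 / p)) \<le> ennreal (enn2real (total_action \<phi> \<gamma> \<mu> \<nu>) powr (1 / p))"
      using p by (intro ennreal_leI powr_mono2) auto
    with W_dist_le_action[OF r(1)] show ?thesis by (rule order_trans)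
  qed
  then show ?thesis
    unfolding W_dist_def[of p \<phi> \<gamma> x y] by (intro INF_greatest) auto
qed

text \<open>Distance 0 lies below every radius, so all integrals of test functions agree; the
  comparison on sets with c = 0, used in both directions, identifies the measures.\<close>

lemma W_dist_eq_0:
  assumes "W_dist p \<phi> \<gamma> x y = 0"
  shows "x = y"
proof -
  have eq: "radon_integral y f = radon_integral x f" if f: "compactly_supported_continuous f" for f
  proof (rule ccontr)
    assume "radon_integral y f \<noteq> radon_integral x f"
    then have "0 < \<bar>radon_integral y f - radon_integral x f\<bar>" by simp
    from W_dist_weak_close[OF f this] show False
      using assms by (metis ennreal_0 ennreal_less_iff less_irrefl order_refl)
  qed
  have "rmeas x B = rmeas y B" if B: "bounded_borel B" for B
  proof (rule antisym)
    have "rmeas x B \<le> 0 * measure \<gamma> B + rmeas y B" "rmeas y B \<le> 0 * measure \<gamma> B + rmeas x B"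
      by (rule rmeas_le_if_integral_le[OF gamma _ B], simp add: eq)+
    then show "rmeas x B \<le> rmeas y B" "rmeas y B \<le> rmeas x B" by simp_all
  qed
  then show ?thesis by (rule radon_eqI)
qed

text \<open>Two curves of actions at most \<open>\<alpha> powr p\<close> and \<open>\<beta> powr p\<close> are run through during fractions
  of the unit time proportional to \<open>\<alpha>\<close> and \<open>\<beta>\<close>; the concatenation has action at most
  \<open>(\<alpha> + \<beta>) powr p\<close>.\<close>

lemma W_dist_triangle: "W_dist p \<phi> \<gamma> x z \<le> W_dist p \<phi> \<gamma> x y + W_dist p \<phi> \<gamma> y z"
proof (rule ennreal_le_epsilon)
  fix e :: real assume fin: "W_dist p \<phi> \<gamma> x y + W_dist p \<phi> \<gamma> y z < top" and e: "0 < e"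
  define u where "u = enn2real (W_dist p \<phi> \<gamma> x y)"
  define v where "v = enn2real (W_dist p \<phi> \<gamma> y z)"
  have uv: "W_dist p \<phi> \<gamma> x y = ennreal u" "W_dist p \<phi> \<gamma> y z = ennreal v" "0 \<le> u" "0 \<le> v"
    using fin by (auto simp: u_def v_def)
  \<comment> \<open>Half of e is added on each side: the bounds become strict, so curves below them
    exist, and positive, so the time split is proper even when a distance is 0.\<close>
  define \<alpha> where "\<alpha> = u + e / 2"
  define \<beta> where "\<beta> = v + e / 2"
  have pos: "0 < \<alpha>" "0 < \<beta>" using uv e by (auto simp: \<alpha>_def \<beta>_def)
  have "W_dist p \<phi> \<gamma> x y < ennreal \<alpha>" "W_dist p \<phi> \<gamma> y z < ennreal \<beta>"
    using uv e by (auto simp: \<alpha>_def \<beta>_def ennreal_less_iff simp del: ennreal_plus)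
  then obtain \<mu>1 \<nu>1 \<mu>2 \<nu>2 where c: "(\<mu>1, \<nu>1) \<in> finite_action_curves \<phi> \<gamma> x y" "(\<mu>2, \<nu>2) \<in> finite_action_curves \<phi> \<gamma> y z"
    and A: "ennreal (enn2real (total_action \<phi> \<gamma> \<mu>1 \<nu>1) powr (1 / p)) < ennreal \<alpha>"
      "ennreal (enn2real (total_action \<phi> \<gamma> \<mu>2 \<nu>2) powr (1 / p)) < ennreal \<beta>"
    by (metis W_dist_less_curve)
  have le: "total_action \<phi> \<gamma> \<mu> \<nu> \<le> ennreal (r powr p)"
    if c: "(\<mu>, \<nu>) \<in> finite_action_curves \<phi> \<gamma> x' y'" and r: "0 < r"
      and A: "ennreal (enn2real (total_action \<phi> \<gamma> \<mu> \<nu>) powr (1 / p)) < ennreal r" for \<mu> \<nu> x' y' r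
  proof -
    let ?A = "enn2real (total_action \<phi> \<gamma> \<mu> \<nu>)"
    have "?A powr (1 / p) \<le> r" using A r by (simp add: ennreal_less_iff)
    then have "(?A powr (1 / p)) powr p \<le> r powr p" using p by (intro powr_mono2) auto
    then have "?A \<le> r powr p" using p by (simp add: powr_powr)
    moreover have "total_action \<phi> \<gamma> \<mu> \<nu> = ennreal ?A"
      using c by (simp add: finite_action_curves_def)
    ultimately show ?thesis by (metis ennreal_leI)
  qed
  define \<theta> where "\<theta> = \<alpha> / (\<alpha> + \<beta>)"
  have \<theta>: "0 < \<theta>" "\<theta> < 1" "1 - \<theta> = \<beta> / (\<alpha> + \<beta>)"
    using pos by (auto simp: \<theta>_def field_simps)
  obtain \<mu> \<nu> where cc: "(\<mu>, \<nu>) \<in> finite_action_curves \<phi> \<gamma> x z"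
    and act: "total_action \<phi> \<gamma> \<mu> \<nu> \<le> ennreal (\<theta> powr (1 - p)) * total_action \<phi> \<gamma> \<mu>1 \<nu>1 + ennreal ((1 - \<theta>) powr (1 - p)) * total_action \<phi> \<gamma> \<mu>2 \<nu>2"
    using curve_concat[OF c \<theta>(1,2)] by blast
  have piece: "(r / (\<alpha> + \<beta>)) powr (1 - p) * r powr p = r * (\<alpha> + \<beta>) powr (p - 1)" if r: "0 < r" for r
  proof -
    have "(r / (\<alpha> + \<beta>)) powr (1 - p) = r powr (1 - p) * (\<alpha> + \<beta>) powr (p - 1)"
      using r pos by (simp add: powr_divide powr_diff field_simps)
    moreover have "r powr (1 - p) * r powr p = r" using r by (simp flip: powr_add)
    ultimately show ?thesis by (simp add: mult_ac)
  qed
  have "total_action \<phi> \<gamma> \<mu> \<nu> \<le> ennreal (\<theta> powr (1 - p)) * ennreal (\<alpha> powr p) + ennreal ((1 - \<theta>) powr (1 - p)) * ennreal (\<beta> powr p)"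
    using le[OF c(1) pos(1) A(1)] le[OF c(2) pos(2) A(2)]
    by (intro order_trans[OF act] add_mono mult_left_mono) auto
  also have "\<dots> = ennreal (\<theta> powr (1 - p) * \<alpha> powr p + (1 - \<theta>) powr (1 - p) * \<beta> powr p)"
    by (simp add: ennreal_mult)
  also have "\<theta> powr (1 - p) * \<alpha> powr p + (1 - \<theta>) powr (1 - p) * \<beta> powr p = \<alpha> * (\<alpha> + \<beta>) powr (p - 1) + \<beta> * (\<alpha> + \<beta>) powr (p - 1)"
    unfolding \<theta>(3) using piece[OF pos(1)] piece[OF pos(2)] by (simp add: \<theta>_def)
  also have "\<dots> = (\<alpha> + \<beta>) * (\<alpha> + \<beta>) powr (p - 1)"
    by (rule distrib_right[symmetric])
  also have "\<dots> = (\<alpha> + \<beta>) powr p"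
    using pos by (simp add: powr_mult_base)
  finally have "total_action \<phi> \<gamma> \<mu> \<nu> \<le> ennreal ((\<alpha> + \<beta>) powr p)" .
  then have "enn2real (total_action \<phi> \<gamma> \<mu> \<nu>) \<le> (\<alpha> + \<beta>) powr p"
    by (intro enn2real_leI) auto
  then have "enn2real (total_action \<phi> \<gamma> \<mu> \<nu>) powr (1 / p) \<le> ((\<alpha> + \<beta>) powr p) powr (1 / p)"
    using p by (intro powr_mono2) auto
  also have "\<dots> = \<alpha> + \<beta>" using p pos by (simp add: powr_powr)
  also have "\<dots> = u + v + e" by (simp add: \<alpha>_def \<beta>_def)
  finally have "W_dist p \<phi> \<gamma> x z \<le> ennreal (u + v + e)"
    using W_dist_le_action[OF cc] by (meson ennreal_leI order_trans)
  then show "W_dist p \<phi> \<gamma> x z \<le> W_dist p \<phi> \<gamma> x y + W_dist p \<phi> \<gamma> y z + ennreal e"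
    using uv e by simp
qed

lemma pseudo_distance_W_dist: "pseudo_distance (action_domain \<phi> \<gamma>) (W_dist p \<phi> \<gamma>)"
  unfolding pseudo_distance_def action_domain_eq
proof (intro conjI allI impI)
  fix x y z
  show "W_dist p \<phi> \<gamma> x x = 0 \<or> x \<notin> between \<gamma> a b \<and> (\<forall>y. W_dist p \<phi> \<gamma> x y = \<infinity>)"
  proof (cases "x \<in> between \<gamma> a b")
    case False
    then have "W_dist p \<phi> \<gamma> x y = \<infinity>" for y
      using W_dist_finite_between(1)[of x y] by (cases "W_dist p \<phi> \<gamma> x y = \<infinity>") (auto simp: less_top)
    with False show ?thesis by blast
  qed (simp add: W_dist_refl)
  show "W_dist p \<phi> \<gamma> x y = W_dist p \<phi> \<gamma> y x"
    by (intro antisym W_dist_sym_le)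
qed (rule W_dist_eq_0 W_dist_triangle, assumption?)+

text \<open>It suffices that the identity is continuous from the distance topology to
  \<open>weak_star\<close>, which is checked on the subbasis given by integrals.\<close>

lemma openin_dist_topology_W_dist:
  assumes "openin weak_star U"
  shows "openin (dist_topology (W_dist p \<phi> \<gamma>)) U"
proof -
  let ?X = "dist_topology (W_dist p \<phi> \<gamma>)"
  have "openin ?X UNIV"
    unfolding openin_dist_topology by (auto intro: exI[of _ 1])
  then have top: "topspace ?X = UNIV"
    using openin_subset by blast
  have "continuous_map ?X weak_star (\<lambda>\<mu>. \<mu>)"
  proof (rule continuous_map_weak_starI)
    fix f :: "'a \<Rightarrow> real" and V :: "real set"
    assume f: "compactly_supported_continuous f" and V: "open V"
    show "openin ?X {\<mu> \<in> topspace ?X. radon_integral \<mu> f \<in> V}"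
      unfolding openin_dist_topology
    proof
      fix x assume "x \<in> {\<mu> \<in> topspace ?X. radon_integral \<mu> f \<in> V}"
      then obtain e where e: "0 < e" "\<And>s. dist s (radon_integral x f) < e \<Longrightarrow> s \<in> V"
        using V by (auto simp: open_dist)
      obtain r where r: "0 < r" "\<And>x y. W_dist p \<phi> \<gamma> x y < ennreal r \<Longrightarrow> \<bar>radon_integral y f - radon_integral x f\<bar> < e"
        using W_dist_weak_close[OF f e(1)] by blast
      show "\<exists>r>0. \<forall>y. W_dist p \<phi> \<gamma> x y < r \<longrightarrow> y \<in> {\<mu> \<in> topspace ?X. radon_integral \<mu> f \<in> V}"
        using r e(2) by (intro exI[of _ "ennreal r"]) (auto simp: top dist_real_def)
    qed
  qed
  from openin_continuous_map_preimage[OF this assms] show ?thesis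
    by (simp add: top)
qed

lemma relatively_compactin_W_dist_bounded:
  assumes "dist_bounded (W_dist p \<phi> \<gamma>) S"
  shows "relatively_compactin weak_star S"
proof -
  have "S \<subseteq> between \<gamma> a b"
  proof
    fix y assume y: "y \<in> S"
    obtain x C where "C < \<infinity>" "W_dist p \<phi> \<gamma> x y \<le> C"
      using assms y by (auto simp: dist_bounded_def)
    then have "W_dist p \<phi> \<gamma> x y < \<infinity>" by (meson order_le_less_trans)
    then show "y \<in> between \<gamma> a b" by (rule W_dist_finite_between(2))
  qed
  then have "weak_star closure_of S \<subseteq> between \<gamma> a b"
    by (rule closure_of_minimal) (rule closedin_between[OF gamma less_imp_le[OF ab]])
  then have "compactin weak_star (weak_star closure_of S)"
    using compactin_between[OF gamma] closed_compactin closedin_closure_of by blast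
  then show ?thesis
    by (simp add: relatively_compactin_def)
qed

end

theorem proposition3p2:
  fixes p a b :: real
    and \<gamma> :: "'a::euclidean_space measure"
    and \<phi> :: "real \<times> 'a \<Rightarrow> ereal"
  assumes "1 < p" and "a < b" and "nonneg_radon \<gamma>" and "admissible_on p a b \<phi>"
  shows "pseudo_distance (action_domain \<phi> \<gamma>) (W_dist p \<phi> \<gamma>)
    \<and> (\<forall>U. openin weak_star U \<longrightarrow> openin (dist_topology (W_dist p \<phi> \<gamma>)) U)
    \<and> (\<forall>S. dist_bounded (W_dist p \<phi> \<gamma>) S \<longrightarrow> relatively_compactin weak_star S)"
proof -
  interpret admissible_action p a b \<phi> \<gamma>
    using assms by unfold_locales
  show ?thesis
    using pseudo_distance_W_dist openin_dist_topology_W_dist relatively_compactin_W_dist_bounded by blast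
qed

end
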